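(* Let $m\in\mathbb{N}\cup\{\infty\}$, and let $T=\bigoplus_{j}T_j\in\bigoplus_{j}M_{k_j}(\mathbb{C})$, where $j$ ranges over $\{1,\dots,m\}$ (over $\mathbb{N}$ if $m=\infty$), with $T_j\in M_{k_j}(\mathbb{C})$ such that $\{T_j\}_j$ is an irreducible family. For a given index $\ell$, let $\pi_\ell$ be the irreducible representation of $C^*(T)=\bigoplus_j M_{k_j}(\mathbb{C})$ given by compression to the $\ell$-th block. Then the following statements are equivalent: (1) $\pi_\ell$ is a boundary representation for $\mathcal{OS}(T)$; (2) $T_\ell\notin\mathbb{W}_{k_\ell}\left(\bigoplus_{j\neq\ell}T_j\right)$.
   Context: For a bounded operator $T$ on a complex Hilbert space $\mathcal{H}$, $\mathcal{OS}(T)=\mathrm{span}\{1,T,T^*\}\subset\mathcal{B}(\mathcal{H})$ is the operator system generated by $T$, and $C^*(T)$ is the unital C$^*$-algebra generated by $\mathcal{OS}(T)$. "ucp" means unital completely positive. A boundary representation for $\mathcal{OS}(T)$ is a unital $*$-representation $\rho:C^*(T)\to\mathcal{B}(\mathcal{H}_\rho)$ that is irreducible and such that $\rho|_{\mathcal{OS}(T)}$ has a unique ucp extension to a map $C^*(T)\to\mathcal{B}(\mathcal{H}_\rho)$ (namely $\rho$ itself). For $n\in\mathbb{N}$, $\mathbb{W}_n(T)=\{\varphi(T):\ \varphi:\mathcal{OS}(T)\to M_n(\mathbb{C})\text{ is ucp}\}$. $\bigoplus_j M_{k_j}(\mathbb{C})$ denotes the $\ell^\infty$-sum. The map $\pi_\ell$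 sends $\bigoplus_jX_j$ to $X_\ell$. The family $\{T_j\}_j$ of operators $T_j\in M_{k_j}(\mathbb{C})$ is an irreducible family if $C^*(\bigoplus_jT_j)=\bigoplus_jM_{k_j}(\mathbb{C})$. $\bigoplus_{j\ne\ell}T_j$ is regarded as an element of $\bigoplus_{j\neq\ell}M_{k_j}(\mathbb{C})$ (the $\ell$-th block is deleted), so $\mathcal{OS}(\bigoplus_{j\ne\ell}T_j)$ has as unit the identity of $\bigoplus_{j\neq\ell}M_{k_j}(\mathbb{C})$. (If there is only one block, the sum over $j\neq\ell$ is the zero algebra, which admits no ucp map into a matrix algebra, so the set in (2) is empty.) *)

theory Defs
  imports
    Complex_Main
    "HOL-Library.FuncSet"
    "HOL-Library.Extended_Nat"
    "HOL-Algebra.Module"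
    "Jordan_Normal_Form.Matrix"
    "Jordan_Normal_Form.VS_Connect"
    "Jordan_Normal_Form.Schur_Decomposition"
begin

section \<open>Unital C*-algebras as records\<close>

text \<open>
  A C*-algebra is presented by its complex algebra structure (the HOL-Algebra module record over
  the complex numbers, whose ring part supplies product and unit) together with involution and norm.
  The only instances used are the matrix algebras and their $\ell^\infty$-sums defined below.
\<close>

record 'a cstar_alg = "(complex, 'a) module" +
  adj :: "'a \<Rightarrow> 'a"
  nrm :: "'a \<Rightarrow> real"

definition op_sys :: "('a, 'b) cstar_alg_scheme \<Rightarrow> 'a \<Rightarrow> 'a set" where
  "op_sys A T = {(a \<odot>\<^bsub>A\<^esub> \<one>\<^bsub>A\<^esub>) \<oplus>\<^bsub>A\<^esub> (b \<odot>\<^bsub>A\<^esub> T) \<oplus>\<^bsub>A\<^esub> (c \<odot>\<^bsub>A\<^esub> adj A T) | a b c. True}"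

definition cstar_subalgebra :: "('a, 'b) cstar_alg_scheme \<Rightarrow> 'a set \<Rightarrow> bool" where
  "cstar_subalgebra A B \<longleftrightarrow>
     B \<subseteq> carrier A \<and> \<one>\<^bsub>A\<^esub> \<in> B \<and>
     (\<forall>x\<in>B. \<forall>y\<in>B. x \<oplus>\<^bsub>A\<^esub> y \<in> B \<and> x \<otimes>\<^bsub>A\<^esub> y \<in> B) \<and>
     (\<forall>c. \<forall>x\<in>B. c \<odot>\<^bsub>A\<^esub> x \<in> B) \<and>
     (\<forall>x\<in>B. adj A x \<in> B) \<and>
     (\<forall>X x. (\<forall>n::nat. X n \<in> B) \<and> x \<in> carrier A \<and> (\<lambda>n. nrm A (X n \<ominus>\<^bsub>A\<^esub> x)) \<longlonglongrightarrow> 0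
        \<longrightarrow> x \<in> B)"

definition cstar_gen :: "('a, 'b) cstar_alg_scheme \<Rightarrow> 'a \<Rightarrow> 'a set" where
  "cstar_gen A T = \<Inter>{B. cstar_subalgebra A B \<and> op_sys A T \<subseteq> B}"


section \<open>Unital completely positive maps\<close>

text \<open>
  A matrix in $M_n(A)$ is a function of two indices, of which only the values at indices
  below $n$ matter. It is positive iff it is of the form $Y^*Y$ with $Y \in M_n(A)$.
\<close>

definition matrices_over :: "nat \<Rightarrow> 'a set \<Rightarrow> (nat \<Rightarrow> nat \<Rightarrow> 'a) set" where
  "matrices_over n S = {X. \<forall>p<n. \<forall>q<n. X p q \<in> S}"

definition matrix_positive :: "('a, 'b) cstar_alg_scheme \<Rightarrow> nat \<Rightarrow> (nat \<Rightarrow> nat \<Rightarrow> 'a) \<Rightarrow> bool" where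
  "matrix_positive A n X \<longleftrightarrow>
     (\<exists>Y\<in>matrices_over n (carrier A). \<forall>p<n. \<forall>q<n.
        X p q = (\<Oplus>\<^bsub>A\<^esub>r\<in>{..<n}. adj A (Y r p) \<otimes>\<^bsub>A\<^esub> Y r q))"

definition linear_map_on ::
  "('a, 'c) cstar_alg_scheme \<Rightarrow> 'a set \<Rightarrow> ('b, 'd) cstar_alg_scheme \<Rightarrow> ('a \<Rightarrow> 'b) \<Rightarrow> bool" where
  "linear_map_on A S B \<phi> \<longleftrightarrow>
     (\<forall>x\<in>S. \<phi> x \<in> carrier B) \<and>
     (\<forall>x\<in>S. \<forall>y\<in>S. \<phi> (x \<oplus>\<^bsub>A\<^esub> y) = \<phi> x \<oplus>\<^bsub>B\<^esub> \<phi> y) \<and>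
     (\<forall>c. \<forall>x\<in>S. \<phi> (c \<odot>\<^bsub>A\<^esub> x) = c \<odot>\<^bsub>B\<^esub> \<phi> x)"

text \<open>
  \<open>ucp A S B \<phi>\<close>: the restriction of \<open>\<phi>\<close> to the operator system \<open>S \<subseteq> A\<close> is a ucp map into \<open>B\<close>;
  the matrix order on \<open>S\<close> is the one inherited from \<open>A\<close>.
\<close>

definition ucp ::
  "('a, 'c) cstar_alg_scheme \<Rightarrow> 'a set \<Rightarrow> ('b, 'd) cstar_alg_scheme \<Rightarrow> ('a \<Rightarrow> 'b) \<Rightarrow> bool" where
  "ucp A S B \<phi> \<longleftrightarrow>
     linear_map_on A S B \<phi> \<and> \<phi> \<one>\<^bsub>A\<^esub> = \<one>\<^bsub>B\<^esub> \<and>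
     (\<forall>n. \<forall>X\<in>matrices_over n S.
        matrix_positive A n X \<longrightarrow> matrix_positive B n (\<lambda>p q. \<phi> (X p q)))"


section \<open>Matrix algebras and direct sums\<close>

definition vec_l2_norm :: "complex vec \<Rightarrow> real" where
  "vec_l2_norm v = sqrt (Re (v \<bullet>c v))"

definition mat_op_norm :: "complex mat \<Rightarrow> real" where
  "mat_op_norm X = Sup {vec_l2_norm (X *\<^sub>v v) | v. v \<in> carrier_vec (dim_col X) \<and> vec_l2_norm v \<le> 1}"

definition mat_alg :: "nat \<Rightarrow> complex mat cstar_alg" where
  "mat_alg n =
     \<lparr>carrier = carrier_mat n n, monoid.mult = (*), monoid.one = 1\<^sub>m n, ring.zero = 0\<^sub>m n n, ring.add = (+),
      module.smult = (\<cdot>\<^sub>m), adj = mat_adjoint, nrm = mat_op_norm\<rparr>"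

text \<open>
  The $\ell^\infty$-sum over an index set \<open>J\<close>; for empty \<open>J\<close> it is the zero algebra, and the
  inserted \<open>0\<close> only serves to make its norm \<open>0\<close>.
\<close>

definition linf_sum :: "'i set \<Rightarrow> ('i \<Rightarrow> ('a, 'b) cstar_alg_scheme) \<Rightarrow> ('i \<Rightarrow> 'a) cstar_alg" where
  "linf_sum J A =
     \<lparr>carrier = {X \<in> (\<Pi>\<^sub>E j\<in>J. carrier (A j)). bdd_above ((\<lambda>j. nrm (A j) (X j)) ` J)},
      monoid.mult = (\<lambda>X Y. \<lambda>j\<in>J. X j \<otimes>\<^bsub>A j\<^esub> Y j), monoid.one = (\<lambda>j\<in>J. \<one>\<^bsub>A j\<^esub>),
      ring.zero = (\<lambda>j\<in>J. \<zero>\<^bsub>A j\<^esub>), ring.add = (\<lambda>X Y. \<lambda>j\<in>J. X j \<oplus>\<^bsub>A j\<^esub> Y j),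
      module.smult = (\<lambda>c X. \<lambda>j\<in>J. c \<odot>\<^bsub>A j\<^esub> X j), adj = (\<lambda>X. \<lambda>j\<in>J. adj (A j) (X j)),
      nrm = (\<lambda>X. Sup (insert 0 ((\<lambda>j. nrm (A j) (X j)) ` J)))\<rparr>"

definition mat_sum :: "nat set \<Rightarrow> (nat \<Rightarrow> nat) \<Rightarrow> (nat \<Rightarrow> complex mat) cstar_alg" where
  "mat_sum J k = linf_sum J (\<lambda>j. mat_alg (k j))"

definition block_indices :: "enat \<Rightarrow> nat set" where
  "block_indices m = {j. 1 \<le> j \<and> enat j \<le> m}"

definition irreducible_family :: "nat set \<Rightarrow> (nat \<Rightarrow> nat) \<Rightarrow> (nat \<Rightarrow> complex mat) \<Rightarrow> bool" where
  "irreducible_family J k T \<longleftrightarrow> cstar_gen (mat_sum J k) (\<lambda>j\<in>J. T j) = carrier (mat_sum J k)"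


section \<open>Matrix ranges and boundary representations\<close>

definition matrix_range :: "nat \<Rightarrow> ('a, 'b) cstar_alg_scheme \<Rightarrow> 'a \<Rightarrow> complex mat set" where
  "matrix_range n A T = {\<phi> T | \<phi>. ucp A (op_sys A T) (mat_alg n) \<phi>}"

text \<open>
  Representations on the Hilbert space $\mathbb{C}^d$; all its subspaces are closed, so
  irreducibility refers to arbitrary invariant subspaces.
\<close>

definition star_representation ::
  "('a, 'b) cstar_alg_scheme \<Rightarrow> 'a set \<Rightarrow> nat \<Rightarrow> ('a \<Rightarrow> complex mat) \<Rightarrow> bool" where
  "star_representation A C d \<rho> \<longleftrightarrow>
     linear_map_on A C (mat_alg d) \<rho> \<and> \<rho> \<one>\<^bsub>A\<^esub> = \<one>\<^bsub>mat_alg d\<^esub> \<and>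
     (\<forall>x\<in>C. \<forall>y\<in>C. \<rho> (x \<otimes>\<^bsub>A\<^esub> y) = \<rho> x \<otimes>\<^bsub>mat_alg d\<^esub> \<rho> y) \<and>
     (\<forall>x\<in>C. \<rho> (adj A x) = adj (mat_alg d) (\<rho> x))"

definition irreducible_on :: "'a set \<Rightarrow> nat \<Rightarrow> ('a \<Rightarrow> complex mat) \<Rightarrow> bool" where
  "irreducible_on C d \<rho> \<longleftrightarrow> d \<noteq> 0 \<and>
     (\<forall>W. VectorSpace.subspace class_ring W (module_vec TYPE(complex) d) \<and>
          (\<forall>x\<in>C. \<forall>w\<in>W. \<rho> x *\<^sub>v w \<in> W)
        \<longrightarrow> W = {0\<^sub>v d} \<or> W = carrier_vec d)"

definition boundary_representation ::
  "('a, 'b) cstar_alg_scheme \<Rightarrow> 'a \<Rightarrow> nat \<Rightarrow> ('a \<Rightarrow> complex mat) \<Rightarrow> bool" where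
  "boundary_representation A T d \<rho> \<longleftrightarrow>
     star_representation A (cstar_gen A T) d \<rho> \<and>
     irreducible_on (cstar_gen A T) d \<rho> \<and>
     ucp A (cstar_gen A T) (mat_alg d) \<rho> \<and>
     (\<forall>\<psi>. ucp A (cstar_gen A T) (mat_alg d) \<psi> \<and> (\<forall>x\<in>op_sys A T. \<psi> x = \<rho> x)
        \<longrightarrow> (\<forall>x\<in>cstar_gen A T. \<psi> x = \<rho> x))"

end

theory Submission
  imports Defs "HOL-Library.Function_Algebras" "HOL-Analysis.L2_Norm"
begin

text \<open>
  Let \<open>A\<close> be the sum of all blocks, \<open>A'\<close> the sum of the blocks other than \<open>l\<close>, and \<open>d = k l\<close>; for an
  element \<open>x\<close> of \<open>A\<close> write \<open>x\<^sub>l\<close> for its \<open>l\<close>-th block and \<open>x'\<close> for its image in \<open>A'\<close>.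
  
  If \<open>T\<^sub>l = \<phi> T'\<close> for a ucp map \<open>\<phi>\<close> on the operator system of \<open>T'\<close>, then Arveson's theorem
  (\<open>arveson_extension\<close>) extends \<open>\<phi>\<close> to \<open>A'\<close>, and composing the extension with \<open>x \<mapsto> x'\<close> gives a ucp map
  on \<open>A\<close> that agrees with the block projection on the operator system of \<open>T\<close> and yet vanishes on the
  unit of the \<open>l\<close>-th block.  So the projection is not a boundary representation.
  
  Conversely, let \<open>\<psi> : A \<rightarrow> M\<^sub>d\<close> be ucp with \<open>\<psi> x = x\<^sub>l\<close> on the operator system of \<open>T\<close>.  The matrices that
  dominate some \<open>\<psi> X - X\<^sub>l\<close> form a convex cone in \<open>M\<^sub>d\<close>, which leaves two cases.
  
  \<^item> The cone contains \<open>- 1\<close>.  Then there are \<open>g \<ge> 1\<close> in \<open>A\<close> and \<open>r < 1\<close> with \<open>\<psi> g \<le> r g\<^sub>l\<close>.  Let \<open>Y\<close> be a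
  matrix over the operator system of \<open>T\<close> with \<open>Y' \<ge> 0\<close>.  If \<open>Y + s g \<ge> 0\<close>, then applying \<open>\<psi>\<close>, which
  reproduces \<open>Y\<^sub>l\<close>, gives \<open>Y\<^sub>l + r s g\<^sub>l \<ge> 0\<close>, hence \<open>Y + r s g \<ge> 0\<close>.  Iterating, \<open>Y\<^sub>l \<ge> 0\<close>: the assignment
  \<open>x' \<mapsto> x\<^sub>l\<close> is well defined and completely positive, so \<open>T\<^sub>l\<close> lies in the matrix range of \<open>T'\<close>
  (\<open>strict_gain_imp_matrix_range\<close>).
  
  \<^item> It does not.  By Hahn-Banach (\<open>order_unit_functional\<close>) there is a nonzero positive functional
  \<open>F\<close> on \<open>M\<^sub>d\<close> with \<open>F (\<psi> X) = F X\<^sub>l\<close> for all \<open>X\<close> (\<open>exists_invariant\<close>).  Since \<open>\<psi>\<close> fixes \<open>t = T\<close> and \<open>t = T\<^sup>*\<close>,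
  the Schwarz inequality for \<open>\<psi>\<close> at \<open>t\<close> is an equality under \<open>F\<close>, and therefore
  \<open>F (b \<psi>(Y t)) = F (b \<psi>(Y) t\<^sub>l)\<close> (\<open>invariant_multiplicative\<close>).  It follows that the compressions
  \<open>M \<mapsto> F (t\<^sub>l\<^sup>* M t\<^sub>l)\<close> are invariant as well, so the common null ideal of all invariant functionals is
  stable under left multiplication by the blocks of the algebra generated by \<open>T\<close>, that is, by all of \<open>M\<^sub>d\<close>.
  It is a proper two-sided ideal and thus zero.  Hence \<open>\<psi>(Y t) = \<psi>(Y) t\<^sub>l\<close>, and this identity spreads from
  \<open>t\<close> to the generated C*-algebra: \<open>\<psi>\<close> is the block projection (\<open>eq_projection_if_invariant\<close>).
  
  Positivity is tested on the real part of quadratic forms throughout (\<open>accretive\<close>): a complex linear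
  map that preserves accretive matrices preserves positive ones and conversely, and accretive elements
  form a cone with an order unit in the whole space, not only in its self-adjoint part.
\<close>

section \<open>Quadratic forms on finite index sets\<close>

definition qform :: "'i set \<Rightarrow> ('i \<Rightarrow> 'i \<Rightarrow> complex) \<Rightarrow> ('i \<Rightarrow> complex) \<Rightarrow> complex" where
  "qform I G v = (\<Sum>i\<in>I. \<Sum>j\<in>I. cnj (v i) * G i j * v j)"

text \<open>
  Nonnegative real part.  In contrast to positivity, this defines a cone in the whole matrix algebra,
  seen as a real vector space, for which the identity is an order unit.
\<close>

definition accretive :: "'i set \<Rightarrow> ('i \<Rightarrow> 'i \<Rightarrow> complex) \<Rightarrow> bool" where
  "accretive I G \<longleftrightarrow> (\<forall>v. 0 \<le> Re (qform I G v))"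

definition psd :: "'i set \<Rightarrow> ('i \<Rightarrow> 'i \<Rightarrow> complex) \<Rightarrow> bool" where
  "psd I G \<longleftrightarrow> (\<forall>v. Im (qform I G v) = 0 \<and> 0 \<le> Re (qform I G v))"

lemma qform_cong:
  "(\<And>i. i \<in> I \<Longrightarrow> v i = w i) \<Longrightarrow> (\<And>i j. i \<in> I \<Longrightarrow> j \<in> I \<Longrightarrow> G i j = H i j) \<Longrightarrow> qform I G v = qform I H w"
  unfolding qform_def by (intro sum.cong refl) auto

lemma psd_cong:
  "(\<And>i j. i \<in> I \<Longrightarrow> j \<in> I \<Longrightarrow> G i j = H i j) \<Longrightarrow> psd I G \<longleftrightarrow> psd I H"
proof -
  assume "\<And>i j. i \<in> I \<Longrightarrow> j \<in> I \<Longrightarrow> G i j = H i j"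
  then have "qform I G v = qform I H v" for v by (intro qform_cong) auto
  then show ?thesis by (simp add: psd_def)
qed

lemma accretive_cong:
  "(\<And>i j. i \<in> I \<Longrightarrow> j \<in> I \<Longrightarrow> G i j = H i j) \<Longrightarrow> accretive I G \<longleftrightarrow> accretive I H"
proof -
  assume "\<And>i j. i \<in> I \<Longrightarrow> j \<in> I \<Longrightarrow> G i j = H i j"
  then have "qform I G v = qform I H v" for v by (intro qform_cong) auto
  then show ?thesis by (simp add: accretive_def)
qed

lemma qform_add: "qform I (\<lambda>i j. G i j + H i j) v = qform I G v + qform I H v"
  unfolding qform_def by (simp add: algebra_simps sum.distrib)

lemma qform_diff: "qform I (\<lambda>i j. G i j - H i j) v = qform I G v - qform I H v"
  unfolding qform_def by (simp add: algebra_simps sum_subtractf)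

lemma qform_scale: "qform I (\<lambda>i j. c * G i j) v = c * qform I G v"
  unfolding qform_def by (simp add: algebra_simps sum_distrib_left)

lemma qform_adj: "qform I (\<lambda>i j. cnj (G j i)) v = cnj (qform I G v)"
  unfolding qform_def cnj_sum complex_cnj_mult complex_cnj_cnj
  by (subst sum.swap) (simp add: mult_ac)

lemma qform_subset:
  assumes "finite I" "S \<subseteq> I" "\<And>i. i \<in> I - S \<Longrightarrow> v i = 0"
  shows "qform I G v = qform S G v"
proof -
  have "(\<Sum>j\<in>I. cnj (v i) * G i j * v j) = (\<Sum>j\<in>S. cnj (v i) * G i j * v j)" for i
    using assms by (intro sum.mono_neutral_right) auto
  moreover have "(\<Sum>i\<in>I. (\<Sum>j\<in>S. cnj (v i) * G i j * v j)) = (\<Sum>i\<in>S. \<Sum>j\<in>S. cnj (v i) * G i j * v j)"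
    using assms by (intro sum.mono_neutral_right) auto
  ultimately show ?thesis unfolding qform_def by simp
qed

lemma psd_subset: "finite I \<Longrightarrow> S \<subseteq> I \<Longrightarrow> psd I G \<Longrightarrow> psd S G"
  unfolding psd_def
proof
  fix v assume a: "finite I" "S \<subseteq> I"
    "\<forall>v. Im (qform I G v) = 0 \<and> 0 \<le> Re (qform I G v)"
  have "qform I G (\<lambda>i. if i \<in> S then v i else 0) = qform S G v"
    using a by (subst qform_subset[of I S]) (auto intro: qform_cong)
  then show "Im (qform S G v) = 0 \<and> 0 \<le> Re (qform S G v)" using a by metis
qed

lemma qform_pair:
  assumes "finite I" "i \<in> I" "j \<in> I" "i \<noteq> j"
  shows "qform I G ((\<lambda>_. 0)(i := x, j := y)) =
    cnj x * G i i * x + cnj x * G i j * y + cnj y * G j i * x + cnj y * G j j * y"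
  using assms by (subst qform_subset[of I "{i,j}"]) (auto simp: qform_def algebra_simps)

lemma qform_single:
  assumes "finite I" "i \<in> I"
  shows "qform I G ((\<lambda>_. 0)(i := x)) = cnj x * G i i * x"
  using assms by (subst qform_subset[of I "{i}"]) (auto simp: qform_def algebra_simps)

lemma psdD:
  assumes "psd I G"
  shows "Im (qform I G v) = 0" "0 \<le> Re (qform I G v)"
  using assms unfolding psd_def by auto

lemma psd_diag:
  assumes "finite I" "psd I G" "i \<in> I"
  shows "Im (G i i) = 0" "0 \<le> Re (G i i)"
  using psdD[OF assms(2), of "(\<lambda>_. 0)(i := 1)"] unfolding qform_single[OF assms(1,3)] by simp_all

lemma psd_hermitian:
  assumes "finite I" "psd I G" "i \<in> I" "j \<in> I"
  shows "G j i = cnj (G i j)"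
proof (cases "i = j")
  case True
  then show ?thesis using psd_diag[OF assms(1,2,3)] by (simp add: complex_eq_iff)
next
  case False
  have "Im (cnj x * G i i * x + cnj x * G i j * y + cnj y * G j i * x + cnj y * G j j * y) = 0" for x y
    using psdD(1)[OF assms(2), of "(\<lambda>_. 0)(i := x, j := y)"] unfolding qform_pair[OF assms(1,3,4) False] .
  from this[of 1 1] this[of 1 \<i>] psd_diag[OF assms(1,2,3)] psd_diag[OF assms(1,2,4)]
  show ?thesis by (simp add: complex_eq_iff)
qed

text \<open>
  Otherwise moving far along the \<open>i\<close>-th coordinate would make the form negative.
\<close>

lemma psd_zero_diag:
  assumes "finite I" "psd I G" "i \<in> I" "j \<in> I" "G i i = 0"
  shows "G i j = 0"
proof (cases "i = j")
  case False
  define c where "c = Re (G j j)"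
  have c: "c \<ge> 0" "G j j = c" using psd_diag[OF assms(1,2,4)] by (auto simp: c_def complex_eq_iff)
  \<comment> \<open>Test the form on \<open>- s * G i j\<close> at \<open>i\<close> and \<open>1\<close> at \<open>j\<close>.\<close>
  have "0 \<le> c - 2 * s * (cmod (G i j))\<^sup>2" for s :: real
  proof -
    have "qform I G ((\<lambda>_. 0)(i := - of_real s * G i j, j := 1)) = of_real (c - 2 * s * (cmod (G i j))\<^sup>2)"
      unfolding qform_pair[OF assms(1,3,4) False] psd_hermitian[OF assms(1-4)] c assms(5)
      by (simp add: algebra_simps complex_norm_square del: of_real_power)
    then show ?thesis using assms(2) unfolding psd_def by (metis Re_complex_of_real)
  qed
  from this[of "(c + 1) / (cmod (G i j))\<^sup>2"] show ?thesis
    using c(1) by (cases "G i j = 0") simp_all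
qed (use assms in auto)

lemma qform_insert:
  assumes "finite I" "a \<notin> I" "\<And>i. i \<in> I \<Longrightarrow> G i a = cnj (G a i)"
  shows "qform (insert a I) G v = cnj (v a) * G a a * v a + cnj (v a) * (\<Sum>j\<in>I. G a j * v j)
     + v a * cnj (\<Sum>j\<in>I. G a j * v j) + qform I G v"
proof -
  have "(\<Sum>i\<in>I. cnj (v i) * G i a * v a) = v a * cnj (\<Sum>j\<in>I. G a j * v j)"
    unfolding cnj_sum sum_distrib_left using assms(3) by (intro sum.cong refl) auto
  moreover have "(\<Sum>j\<in>I. cnj (v a) * G a j * v j) = cnj (v a) * (\<Sum>j\<in>I. G a j * v j)"
    unfolding sum_distrib_left by (intro sum.cong refl) auto
  ultimately show ?thesis using assms(1,2) unfolding qform_def by (simp add: sum.distrib)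
qed

text \<open>
  Cholesky decomposition, one index at a time: completing the square at \<open>a\<close> leaves the Schur complement
  \<open>H\<close>, which is again positive.  If the diagonal entry at \<open>a\<close> vanishes then so does its whole row, and
  division by zero makes the formulas for \<open>H\<close> and \<open>Z\<close> the right ones in this case too.
\<close>

theorem psd_imp_gram:
  assumes "finite I" "psd I G"
  shows "\<exists>Y. \<forall>i\<in>I. \<forall>j\<in>I. G i j = (\<Sum>r\<in>I. cnj (Y r i) * Y r j)"
  using assms
proof (induction I arbitrary: G rule: finite_induct)
  case empty
  then show ?case by simp
next
  case (insert a I)
  have fin: "finite (insert a I)" using insert by simp
  note herm = psd_hermitian[OF fin insert.prems]
  define g where "g = Re (G a a)"
  have g: "g \<ge> 0" "G a a = of_real g"
    using psd_diag[OF fin insert.prems, of a] by (auto simp: g_def complex_eq_iff)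
  have g0: "G a j = 0" if "g = 0" "j \<in> insert a I" for j
    using psd_zero_diag[OF fin insert.prems, of a j] that g by simp
  define H where "H = (\<lambda>i j. G i j - cnj (G a i) * G a j / of_real g)"
  have "psd I H"
  proof (cases "g = 0")
    case True
    then have "H = G" by (simp add: H_def fun_eq_iff)
    then show ?thesis using psd_subset[OF fin _ insert.prems, of I] by auto
  next
    case False
    show ?thesis unfolding psd_def
    proof
      fix v
      define S where "S = (\<Sum>j\<in>I. G a j * v j)"
      have "qform I (\<lambda>i j. cnj (G a i) * G a j) v = cnj S * S"
        unfolding qform_def S_def cnj_sum sum_product by (simp add: mult_ac)
      then have H: "qform I H v = qform I G v - cnj S * S / of_real g"
        unfolding H_def qform_diff using qform_scale[of I "1 / of_real g" "\<lambda>i j. cnj (G a i) * G a j" v]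
        by (simp add: field_simps)
      \<comment> \<open>The value at \<open>a\<close> that minimizes the form of \<open>G\<close> for the given values on \<open>I\<close>.\<close>
      define w where "w = v(a := - S / of_real g)"
      have Sw: "(\<Sum>j\<in>I. G a j * w j) = S" unfolding S_def w_def using insert.hyps by (intro sum.cong) auto
      have "qform I G w = qform I G v" unfolding w_def using insert.hyps by (intro qform_cong) auto
      moreover have "G i a = cnj (G a i)" if "i \<in> I" for i using herm[of a i] that by simp
      ultimately have "qform (insert a I) G w = cnj (w a) * of_real g * w a + cnj (w a) * S + w a * cnj S + qform I G v"
        using qform_insert[OF insert.hyps, of G w] unfolding Sw g(2) by simp
      also have "\<dots> = qform I H v"
        unfolding H using False by (simp add: w_def)
      finally have "qform (insert a I) G w = qform I H v" .
      then show "Im (qform I H v) = 0 \<and> 0 \<le> Re (qform I H v)" using insert.prems unfolding psd_def by metis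
    qed
  qed
  from insert.IH[OF this] obtain Y where Y: "H i j = (\<Sum>r\<in>I. cnj (Y r i) * Y r j)" if "i \<in> I" "j \<in> I" for i j
    by blast
  define Z where "Z r i = (if r = a then G a i / of_real (sqrt g) else if i = a then 0 else Y r i)" for r i
  have sq: "complex_of_real (sqrt g) * complex_of_real (sqrt g) = of_real g"
    using g by (simp flip: of_real_mult)
  show ?case
  proof (intro exI ballI)
    fix i j assume ij: "i \<in> insert a I" "j \<in> insert a I"
    have Za: "cnj (Z a i) * Z a j = cnj (G a i) * G a j / of_real g"
      using sq by (simp add: Z_def)
    have "(\<Sum>r\<in>I. cnj (Z r i) * Z r j) = (if i = a \<or> j = a then 0 else H i j)"
    proof (cases "i = a \<or> j = a")
      case True
      then show ?thesis using insert.hyps by (auto simp: Z_def intro!: sum.neutral)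
    next
      case False
      then have "(\<Sum>r\<in>I. cnj (Z r i) * Z r j) = (\<Sum>r\<in>I. cnj (Y r i) * Y r j)"
        using insert.hyps by (intro sum.cong) (auto simp: Z_def)
      then show ?thesis using Y[of i j] ij False by auto
    qed
    then have "(\<Sum>r\<in>insert a I. cnj (Z r i) * Z r j) = cnj (G a i) * G a j / of_real g + (if i = a \<or> j = a then 0 else H i j)"
      using insert.hyps Za by simp
    also have "\<dots> = G i j"
      using g g0[OF _ ij(1)] g0[OF _ ij(2)] herm[OF ij(1), of a] herm[OF ij(2), of a]
      by (cases "g = 0") (auto simp: H_def)
    finally show "G i j = (\<Sum>r\<in>insert a I. cnj (Z r i) * Z r j)" ..
  qed
qed

lemma qform_gram:
  assumes "\<And>i j. i \<in> I \<Longrightarrow> j \<in> I \<Longrightarrow> G i j = (\<Sum>r\<in>R. cnj (Y r i) * Y r j)"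
  shows "qform I G v = of_real (\<Sum>r\<in>R. (cmod (\<Sum>j\<in>I. Y r j * v j))\<^sup>2)"
proof -
  have "qform I G v = (\<Sum>i\<in>I. \<Sum>j\<in>I. \<Sum>r\<in>R. cnj (v i) * (cnj (Y r i) * Y r j) * v j)"
    unfolding qform_def by (intro sum.cong refl) (simp add: assms sum_distrib_left sum_distrib_right)
  also have "\<dots> = (\<Sum>i\<in>I. \<Sum>r\<in>R. \<Sum>j\<in>I. cnj (v i) * (cnj (Y r i) * Y r j) * v j)"
    by (intro sum.cong refl sum.swap)
  also have "\<dots> = (\<Sum>r\<in>R. \<Sum>i\<in>I. \<Sum>j\<in>I. cnj (v i) * (cnj (Y r i) * Y r j) * v j)"
    by (rule sum.swap)
  also have "\<dots> = (\<Sum>r\<in>R. cnj (\<Sum>j\<in>I. Y r j * v j) * (\<Sum>j\<in>I. Y r j * v j))"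
    unfolding cnj_sum sum_product by (intro sum.cong refl) (simp add: mult_ac)
  also have "\<dots> = of_real (\<Sum>r\<in>R. (cmod (\<Sum>j\<in>I. Y r j * v j))\<^sup>2)"
    unfolding of_real_sum by (intro sum.cong refl) (simp only: complex_norm_square mult.commute)
  finally show ?thesis .
qed

lemma gram_imp_psd:
  assumes "\<And>i j. i \<in> I \<Longrightarrow> j \<in> I \<Longrightarrow> G i j = (\<Sum>r\<in>R. cnj (Y r i) * Y r j)"
  shows "psd I G"
proof -
  have "qform I G v = of_real (\<Sum>r\<in>R. (cmod (\<Sum>j\<in>I. Y r j * v j))\<^sup>2)" for v
    by (rule qform_gram) (fact assms)
  then show ?thesis by (simp add: psd_def sum_nonneg)
qed

text \<open>
  If \<open>G = Y\<^sup>* Y\<close>, then the form at \<open>u\<close> is the squared norm of \<open>Y u\<close>.  All uses of the Cauchy-Schwarz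
  inequality below are instances of this degenerate case.
\<close>

lemma psd_kernel:
  assumes "finite I" "psd I G" "qform I G u = 0" "i \<in> I"
  shows "(\<Sum>j\<in>I. G i j * u j) = 0"
proof -
  obtain Y where Y: "G i j = (\<Sum>r\<in>I. cnj (Y r i) * Y r j)" if "i \<in> I" "j \<in> I" for i j
    using psd_imp_gram[OF assms(1,2)] by blast
  have "qform I G u = of_real (\<Sum>r\<in>I. (cmod (\<Sum>j\<in>I. Y r j * u j))\<^sup>2)"
    by (rule qform_gram) (rule Y)
  then have "(\<Sum>r\<in>I. (cmod (\<Sum>j\<in>I. Y r j * u j))\<^sup>2) = 0"
    unfolding assms(3) by (rule iffD1[OF of_real_eq_0_iff, OF sym])
  then have 0: "(\<Sum>j\<in>I. Y r j * u j) = 0" if "r \<in> I" for r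
    using that sum_nonneg_eq_0_iff[OF assms(1), of "\<lambda>r. (cmod (\<Sum>j\<in>I. Y r j * u j))\<^sup>2"] by simp
  have "(\<Sum>j\<in>I. G i j * u j) = (\<Sum>j\<in>I. \<Sum>r\<in>I. cnj (Y r i) * (Y r j * u j))"
    by (intro sum.cong refl) (simp add: Y assms(4) sum_distrib_left sum_distrib_right mult_ac)
  also have "\<dots> = (\<Sum>r\<in>I. cnj (Y r i) * (\<Sum>j\<in>I. Y r j * u j))"
    by (subst sum.swap) (simp add: sum_distrib_left)
  finally show ?thesis using 0 by simp
qed

lemma psd_imp_accretive: "psd I G \<Longrightarrow> accretive I G"
  unfolding psd_def accretive_def by simp

lemma psd_iff_accretive:
  "psd I G \<longleftrightarrow> accretive I G \<and> accretive I (\<lambda>i j. \<i> * G i j) \<and> accretive I (\<lambda>i j. - \<i> * G i j)"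
proof -
  have "(Im (qform I G v) = 0 \<and> 0 \<le> Re (qform I G v)) \<longleftrightarrow> 0 \<le> Re (qform I G v) \<and>
    0 \<le> Re (qform I (\<lambda>i j. \<i> * G i j) v) \<and> 0 \<le> Re (qform I (\<lambda>i j. - \<i> * G i j) v)" for v
    unfolding qform_scale by auto
  then show ?thesis unfolding psd_def accretive_def by blast
qed

lemma accretive_iff_psd: "accretive I G \<longleftrightarrow> psd I (\<lambda>i j. G i j + cnj (G j i))"
  unfolding accretive_def psd_def qform_add qform_adj by simp

lemma qform_bound:
  assumes "finite I"
  shows "cmod (qform I G v) \<le> (\<Sum>i\<in>I. \<Sum>j\<in>I. cmod (G i j)) * (\<Sum>i\<in>I. (cmod (v i))\<^sup>2)"
proof -
  let ?N = "\<Sum>i\<in>I. (cmod (v i))\<^sup>2"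
  have le: "(cmod (v i))\<^sup>2 \<le> ?N" if "i \<in> I" for i
    using that assms by (intro member_le_sum) auto
  have "cmod (v i) * cmod (v j) \<le> ?N" if "i \<in> I" "j \<in> I" for i j
  proof -
    have "2 * (cmod (v i) * cmod (v j)) \<le> (cmod (v i))\<^sup>2 + (cmod (v j))\<^sup>2"
      using sum_squares_bound[of "cmod (v i)" "cmod (v j)"] by simp
    then show ?thesis using le[OF that(1)] le[OF that(2)] by linarith
  qed
  then have "cmod (cnj (v i) * G i j * v j) \<le> cmod (G i j) * ?N" if "i \<in> I" "j \<in> I" for i j
    using that mult_left_mono[of "cmod (v i) * cmod (v j)" ?N "cmod (G i j)"] by (simp add: norm_mult mult_ac)
  then have "cmod (qform I G v) \<le> (\<Sum>i\<in>I. \<Sum>j\<in>I. cmod (G i j) * ?N)"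
    unfolding qform_def by (intro order_trans[OF norm_sum] sum_mono) auto
  then show ?thesis by (simp add: sum_distrib_right)
qed

section \<open>Positive functionals on order unit spaces\<close>

definition sublinear_on :: "(real \<Rightarrow> 'b \<Rightarrow> 'b) \<Rightarrow> 'b::ab_group_add set \<Rightarrow> ('b \<Rightarrow> real) \<Rightarrow> bool" where
  "sublinear_on scale E q \<longleftrightarrow>
     (\<forall>x\<in>E. \<forall>y\<in>E. q (x + y) \<le> q x + q y) \<and> (\<forall>r>0. \<forall>x\<in>E. q (scale r x) \<le> r * q x)"

definition linear_functional_on :: "(real \<Rightarrow> 'b \<Rightarrow> 'b) \<Rightarrow> 'b::ab_group_add set \<Rightarrow> ('b \<Rightarrow> real) \<Rightarrow> bool" where
  "linear_functional_on scale E g \<longleftrightarrow>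
     (\<forall>x\<in>E. \<forall>y\<in>E. g (x + y) = g x + g y) \<and> (\<forall>r. \<forall>x\<in>E. g (scale r x) = r * g x)"

lemma
  fixes scale :: "real \<Rightarrow> 'b::ab_group_add \<Rightarrow> 'b" and E :: "'b set"
  assumes vs: "vector_space scale" and E: "module.subspace scale E" and q: "sublinear_on scale E q"
  shows sublinear_on_zero: "q 0 = 0"
    and sublinear_on_scale_pos: "\<And>r x. r > 0 \<Longrightarrow> x \<in> E \<Longrightarrow> q (scale r x) = r * q x"
    and sublinear_on_minus: "\<And>x. x \<in> E \<Longrightarrow> - q (- x) \<le> q x"
proof -
  interpret vector_space scale by (fact vs)
  have le: "q (scale r x) \<le> r * q x" if "r > 0" "x \<in> E" for r x
    using q that unfolding sublinear_on_def by blast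
  have 0: "0 \<in> E" using E by (rule subspace_0)
  show q0: "q 0 = 0" using le[OF _ 0, of 2] le[OF _ 0, of "1/2"] by simp
  show "q (scale r x) = r * q x" if r: "r > 0" and x: "x \<in> E" for r x
  proof (rule antisym[OF le[OF r x]])
    have "scale r x \<in> E" using E x by (rule subspace_scale)
    from le[OF _ this, of "1 / r"] r show "r * q x \<le> q (scale r x)" by (simp add: field_simps)
  qed
  show "- q (- x) \<le> q x" if "x \<in> E" for x
  proof -
    have "- x \<in> E" using E that by (rule subspace_neg)
    then have "q (x + (- x)) \<le> q x + q (- x)" using q that unfolding sublinear_on_def by blast
    then show ?thesis using q0 by simp
  qed
qed

text \<open>
  Hahn-Banach in the form: a sublinear functional that is minimal below \<open>p\<close> is linear.  Working with
  minimal sublinear functionals on all of \<open>E\<close> avoids partially defined linear functionals.  Minimal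
  elements exist by Zorn's lemma, since the infimum of a chain is again sublinear.
\<close>

lemma sublinear_dominates_linear:
  fixes scale :: "real \<Rightarrow> 'b::ab_group_add \<Rightarrow> 'b" and E :: "'b set"
  assumes vs: "vector_space scale" and E: "module.subspace scale E" and p: "sublinear_on scale E p"
  shows "\<exists>g. linear_functional_on scale E g \<and> (\<forall>x\<in>E. g x \<le> p x)"
proof -
  interpret vector_space scale by (fact vs)
  note E0 = subspace_0[OF E] and Eadd = subspace_add[OF E] and Esc = subspace_scale[OF E] and Eneg = subspace_neg[OF E]
  define A where "A = {q. sublinear_on scale E q \<and> (\<forall>x\<in>E. q x \<le> p x) \<and> (\<forall>x. x \<notin> E \<longrightarrow> q x = 0)}"
  define P where "P = (\<lambda>q1 q2 :: 'b \<Rightarrow> real. \<forall>x. q2 x \<le> q1 x)"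
  have Ane: "(\<lambda>x. if x \<in> E then p x else 0) \<in> A"
    using p Eadd Esc unfolding A_def sublinear_on_def by auto
  have lower: "- p (- x) \<le> q x" if "q \<in> A" "x \<in> E" for q x
    using that sublinear_on_minus[OF vs E, of q x] Eneg[of x] unfolding A_def by force
  have "\<exists>m\<in>A. \<forall>a\<in>A. P m a \<longrightarrow> a = m"
  proof (rule predicate_Zorn)
    show "partial_order_on A (relation_of P A)"
      by (rule partial_order_on_relation_ofI)
        (auto simp: P_def fun_eq_iff intro: order_trans antisym)
    fix C assume C: "C \<in> Chains (relation_of P A)"
    have CA: "C \<subseteq> A" and tot: "\<And>q1 q2. q1 \<in> C \<Longrightarrow> q2 \<in> C \<Longrightarrow> P q1 q2 \<or> P q2 q1"
      using C unfolding Chains_def relation_of_def by auto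
    show "\<exists>u\<in>A. \<forall>a\<in>C. P a u"
    proof (cases "C = {}")
      case True
      then show ?thesis using Ane by auto
    next
      case False
      define u where "u x = (if x \<in> E then INF q\<in>C. q x else 0)" for x
      have bdd: "bdd_below ((\<lambda>q. q x) ` C)" if "x \<in> E" for x
        using lower[OF _ that] CA by (intro bdd_belowI[of _ "- p (- x)"]) auto
      have u_le: "u x \<le> q x" if "q \<in> C" "x \<in> E" for q x
        unfolding u_def using that bdd by (auto intro: cINF_lower)
      have u_approx: "\<exists>q\<in>C. q x < u x + \<epsilon>" if "\<epsilon> > 0" "x \<in> E" for x \<epsilon>
        using that False bdd[OF that(2)] cINF_less_iff[of C "\<lambda>q. q x" "u x + \<epsilon>"] by (auto simp: u_def)
      have sub: "q (x + y) \<le> q x + q y" "r > 0 \<Longrightarrow> q (scale r x) \<le> r * q x" if "q \<in> C" "x \<in> E" "y \<in> E" for q x y r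
        using that CA unfolding A_def sublinear_on_def by auto
      have "u (x + y) \<le> u x + u y" if xy: "x \<in> E" "y \<in> E" for x y
      proof (rule field_le_epsilon)
        fix \<epsilon> :: real assume "\<epsilon> > 0"
        then obtain q1 q2 where q: "q1 \<in> C" "q2 \<in> C" "q1 x < u x + \<epsilon> / 2" "q2 y < u y + \<epsilon> / 2"
          using u_approx[of "\<epsilon> / 2" x] u_approx[of "\<epsilon> / 2" y] xy by auto
        obtain q where "q \<in> C" "q x \<le> q1 x" "q y \<le> q2 y"
          using tot[OF q(1,2)] q(1,2) unfolding P_def by blast
        then show "u (x + y) \<le> u x + u y + \<epsilon>"
          using u_le[of q "x + y"] sub(1)[of q x y] q xy Eadd by fastforce
      qed
      moreover have "u (scale r x) \<le> r * u x" if r: "r > 0" and x: "x \<in> E" for r x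
      proof (rule field_le_epsilon)
        fix \<epsilon> :: real assume "\<epsilon> > 0"
        then obtain q where q: "q \<in> C" "q x < u x + \<epsilon> / r"
          using u_approx[of "\<epsilon> / r" x] r x by auto
        have "u (scale r x) \<le> r * q x"
          using u_le[OF q(1) Esc[OF x, of r]] sub(2)[OF q(1) x x r] by linarith
        also have "\<dots> \<le> r * (u x + \<epsilon> / r)" using q(2) r by simp
        also have "\<dots> = r * u x + \<epsilon>" using r by (simp add: distrib_left)
    finally show "u (scale r x) \<le> r * u x + \<epsilon>" .
      qed
      moreover have "u x \<le> p x" if "x \<in> E" for x
        using False u_le[OF _ that] that CA unfolding A_def by fastforce
      ultimately have "u \<in> A" unfolding A_def sublinear_on_def by (auto simp: u_def)
      moreover have "P a u" if "a \<in> C" for a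
        using u_le[OF that] that CA unfolding P_def A_def u_def by auto
      ultimately show ?thesis by blast
    qed
  qed
  then obtain m where m: "m \<in> A" and min: "\<And>a. a \<in> A \<Longrightarrow> P m a \<Longrightarrow> a = m" by blast
  have m_sub: "sublinear_on scale E m" and m_le: "\<And>x. x \<in> E \<Longrightarrow> m x \<le> p x" and m_out: "\<And>x. x \<notin> E \<Longrightarrow> m x = 0"
    using m unfolding A_def by auto
  have m_add: "m (x + y) \<le> m x + m y" if "x \<in> E" "y \<in> E" for x y
    using m_sub that unfolding sublinear_on_def by blast
  note m_scale = sublinear_on_scale_pos[OF vs E m_sub] and m0 = sublinear_on_zero[OF vs E m_sub]
  have m_add_ge: "m x + m y \<le> m (x + y)" if x: "x \<in> E" and y: "y \<in> E" for x y
  proof -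
    \<comment> \<open>Lowering \<open>m\<close> along the direction \<open>y\<close> gives a sublinear functional, which is \<open>m\<close> by minimality.\<close>
    define h where "h x t = m (x + scale t y) - t * m y" for x t
    have m_scale0: "m (scale t z) = t * m z" if "t \<ge> 0" "z \<in> E" for t z
      using that m_scale m0 by (cases "t = 0") auto
    have h_lower: "- m (- x) \<le> h x t" if "x \<in> E" "t \<ge> 0" for x t
      using m_add[of "x + scale t y" "- x"] m_scale0[OF that(2) y] that y Eadd Esc Eneg
      unfolding h_def by (simp add: algebra_simps)
    define n where "n x = (if x \<in> E then INF t\<in>{0..}. h x t else 0)" for x
    have bdd: "bdd_below (h x ` {0..})" if "x \<in> E" for x
      using h_lower[OF that] by (intro bdd_belowI[of _ "- m (- x)"]) auto
    have n_le: "n x \<le> h x t" if "x \<in> E" "t \<ge> 0" for x t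
      unfolding n_def using that bdd by (auto intro: cINF_lower)
    have n_approx: "\<exists>t\<ge>0. h x t < n x + \<epsilon>" if "\<epsilon> > 0" "x \<in> E" for x \<epsilon>
      using that bdd[OF that(2)] cINF_less_iff[of "{0..}" "h x" "n x + \<epsilon>"] by (auto simp: n_def)
    have "n (x + x') \<le> n x + n x'" if xx: "x \<in> E" "x' \<in> E" for x x'
    proof (rule field_le_epsilon)
      fix \<epsilon> :: real assume "\<epsilon> > 0"
      then obtain t t' where t: "t \<ge> 0" "t' \<ge> 0" "h x t < n x + \<epsilon> / 2" "h x' t' < n x' + \<epsilon> / 2"
        using n_approx[of "\<epsilon> / 2" x] n_approx[of "\<epsilon> / 2" x'] xx by auto
      have "h (x + x') (t + t') \<le> h x t + h x' t'"
        using m_add[of "x + scale t y" "x' + scale t' y"] xx y Eadd Esc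
        unfolding h_def by (simp add: algebra_simps)
      then show "n (x + x') \<le> n x + n x' + \<epsilon>"
        using n_le[of "x + x'" "t + t'"] t xx Eadd by fastforce
    qed
    moreover have "n (scale r x) \<le> r * n x" if r: "r > 0" and x: "x \<in> E" for r x
    proof (rule field_le_epsilon)
      fix \<epsilon> :: real assume "\<epsilon> > 0"
      then obtain t where t: "t \<ge> 0" "h x t < n x + \<epsilon> / r"
        using n_approx[of "\<epsilon> / r" x] r x by auto
      have "h (scale r x) (r * t) = r * h x t"
        using m_scale[OF r, of "x + scale t y"] x y Eadd Esc unfolding h_def by (simp add: algebra_simps)
      then have "n (scale r x) \<le> r * h x t"
        using n_le[of "scale r x" "r * t"] r t x Esc by simp
      also have "\<dots> \<le> r * (n x + \<epsilon> / r)" using t(2) r by simp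
      also have "\<dots> = r * n x + \<epsilon>" using r by (simp add: distrib_left)
    finally show "n (scale r x) \<le> r * n x + \<epsilon>" .
    qed
    moreover have nm: "n x \<le> m x" if "x \<in> E" for x
      using n_le[OF that, of 0] unfolding h_def by simp
    ultimately have "n \<in> A" unfolding A_def sublinear_on_def
      using m_le order_trans by (fastforce simp: n_def)
    moreover have "P m n" unfolding P_def using nm m_out by (auto simp: n_def)
    ultimately have "n = m" by (rule min)
    then show ?thesis using n_le[OF x, of 1] unfolding h_def by simp
  qed
  have add: "m (x + y) = m x + m y" if "x \<in> E" "y \<in> E" for x y
    using m_add[OF that] m_add_ge[OF that] by simp
  have neg: "m (- x) = - m x" if "x \<in> E" for x
    using add[OF that Eneg[OF that]] m0 by simp
  have "m (scale r x) = r * m x" if x: "x \<in> E" for r x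
  proof (cases r "0::real" rule: linorder_cases)
    case less
    have "m (scale r x) = m (- scale (- r) x)" by simp
    also have "\<dots> = r * m x" using neg[OF Esc[OF x]] m_scale[OF _ x, of "- r"] less by simp
    finally show ?thesis .
  qed (use m0 m_scale x in auto)
  then have "linear_functional_on scale E m" unfolding linear_functional_on_def using add by blast
  then show ?thesis using m_le by blast
qed

text \<open>
  The infimum \<open>p x\<close> of all \<open>t\<close> with \<open>x \<le> t e\<close>, in the order given by \<open>K\<close>, is sublinear; a linear functional
  below it is positive and equals \<open>1\<close> at \<open>e\<close>.
\<close>

theorem order_unit_functional:
  fixes scale :: "real \<Rightarrow> 'b::ab_group_add \<Rightarrow> 'b" and E :: "'b set"
  assumes vs: "vector_space scale" and E: "module.subspace scale E"
    and K_add: "\<And>x y. x \<in> K \<Longrightarrow> y \<in> K \<Longrightarrow> x + y \<in> K"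
    and K_scale: "\<And>r x. r > 0 \<Longrightarrow> x \<in> K \<Longrightarrow> scale r x \<in> K"
    and K_zero: "0 \<in> K"
    and e: "e \<in> E" and unit: "\<And>x. x \<in> E \<Longrightarrow> \<exists>t. scale t e - x \<in> K"
    and neg: "- e \<notin> K"
  shows "\<exists>g. linear_functional_on scale E g \<and> (\<forall>x\<in>E \<inter> K. 0 \<le> g x) \<and> g e = 1"
proof -
  interpret vector_space scale by (fact vs)
  define p where "p x = Inf {t. scale t e - x \<in> K}" for x
  have nonneg: "t \<ge> 0" if "scale t e \<in> K" for t
  proof (rule ccontr)
    assume "\<not> t \<ge> 0"
    then show False using K_scale[OF _ that, of "1 / (- t)"] neg by simp
  qed
  have bdd: "bdd_below {t. scale t e - x \<in> K}" if x: "x \<in> E" for x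
  proof -
    obtain s where s: "scale s e - (- x) \<in> K" using unit[OF subspace_neg[OF E x]] by blast
    have "- s \<le> t" if "scale t e - x \<in> K" for t
      using nonneg[of "t + s"] K_add[OF that s] by (simp add: scale_left_distrib)
    then show ?thesis by (intro bdd_belowI[of _ "- s"]) auto
  qed
  have p_le: "p x \<le> t" if "x \<in> E" "scale t e - x \<in> K" for x t
    unfolding p_def using that bdd by (auto intro: cInf_lower)
  have p_approx: "\<exists>t. scale t e - x \<in> K \<and> t < p x + \<epsilon>" if "\<epsilon> > 0" "x \<in> E" for x \<epsilon>
    using that unit[OF that(2)] bdd[OF that(2)] cInf_less_iff[of "{t. scale t e - x \<in> K}" "p x + \<epsilon>"]
    by (auto simp: p_def)
  have "p (x + y) \<le> p x + p y" if xy: "x \<in> E" "y \<in> E" for x y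
  proof (rule field_le_epsilon)
    fix \<epsilon> :: real assume "\<epsilon> > 0"
    then obtain t s where t: "scale t e - x \<in> K" "scale s e - y \<in> K" "t < p x + \<epsilon> / 2" "s < p y + \<epsilon> / 2"
      using p_approx[of "\<epsilon> / 2" x] p_approx[of "\<epsilon> / 2" y] xy by auto
    have "scale (t + s) e - (x + y) \<in> K" using K_add[OF t(1,2)] by (simp add: algebra_simps)
    then show "p (x + y) \<le> p x + p y + \<epsilon>"
      using p_le[of "x + y" "t + s"] t subspace_add[OF E xy] by linarith
  qed
  moreover have "p (scale r x) \<le> r * p x" if r: "r > 0" and x: "x \<in> E" for r x
  proof (rule field_le_epsilon)
    fix \<epsilon> :: real assume "\<epsilon> > 0"
    then obtain t where t: "scale t e - x \<in> K" "t < p x + \<epsilon> / r"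
      using p_approx[of "\<epsilon> / r" x] r x by auto
    have "scale (r * t) e - scale r x \<in> K"
      using K_scale[OF r t(1)] by (simp add: scale_right_diff_distrib)
    then have "p (scale r x) \<le> r * t" using p_le subspace_scale[OF E x] by blast
    also have "\<dots> \<le> r * (p x + \<epsilon> / r)" using t(2) r by simp
    also have "\<dots> = r * p x + \<epsilon>" using r by (simp add: distrib_left)
    finally show "p (scale r x) \<le> r * p x + \<epsilon>" .
  qed
  ultimately have "sublinear_on scale E p" unfolding sublinear_on_def by blast
  from sublinear_dominates_linear[OF vs E this] obtain g
    where g: "linear_functional_on scale E g" and gp: "\<And>x. x \<in> E \<Longrightarrow> g x \<le> p x" by blast
  have g_scale: "g (scale r x) = r * g x" if "x \<in> E" for r x
    using g that unfolding linear_functional_on_def by blast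
  have g_neg: "g (- x) = - g x" if "x \<in> E" for x
    using g_scale[OF that, of "- 1"] by simp
  have "0 \<le> g x" if "x \<in> E" "x \<in> K" for x
    using gp[OF subspace_neg[OF E that(1)]] p_le[OF subspace_neg[OF E that(1)], of 0] that g_neg by simp
  moreover have "g e = 1"
    using gp[OF e] gp[OF subspace_neg[OF E e]] g_neg[OF e] p_le[OF e, of 1]
      p_le[OF subspace_neg[OF E e], of "- 1"] K_zero by simp
  ultimately show ?thesis using g by blast
qed

section \<open>Matrices, their operator norm, and bounded families\<close>

text \<open>
  Vectors of length \<open>d\<close> are represented by functions of which only the values below \<open>d\<close> matter, so that no
  dimension constraints have to be carried along.
\<close>

definition l2 :: "nat \<Rightarrow> (nat \<Rightarrow> complex) \<Rightarrow> real" where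
  "l2 d v = L2_set (\<lambda>i. cmod (v i)) {..<d}"

definition sform :: "nat \<Rightarrow> complex mat \<Rightarrow> (nat \<Rightarrow> complex) \<Rightarrow> (nat \<Rightarrow> complex) \<Rightarrow> complex" where
  "sform d X u v = (\<Sum>a<d. \<Sum>b<d. cnj (u a) * X $$ (a, b) * v b)"

definition mapply :: "nat \<Rightarrow> complex mat \<Rightarrow> (nat \<Rightarrow> complex) \<Rightarrow> nat \<Rightarrow> complex" where
  "mapply d X v a = (\<Sum>b<d. X $$ (a, b) * v b)"

definition op_bounded :: "nat \<Rightarrow> complex mat \<Rightarrow> real \<Rightarrow> bool" where
  "op_bounded d X C \<longleftrightarrow> (\<forall>u v. cmod (sform d X u v) \<le> C * l2 d u * l2 d v)"

lemma l2_nonneg [simp]: "0 \<le> l2 d v"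
  by (simp add: l2_def)

lemma l2_sq: "(l2 d v)\<^sup>2 = (\<Sum>a<d. (cmod (v a))\<^sup>2)"
  by (simp add: l2_def L2_set_def sum_nonneg)

lemma l2_scale: "l2 d (\<lambda>a. c * v a) = cmod c * l2 d v"
  using L2_set_right_distrib[of "cmod c" "\<lambda>a. cmod (v a)" "{..<d}"] by (simp add: l2_def norm_mult)

lemma cmod_le_l2: "a < d \<Longrightarrow> cmod (v a) \<le> l2 d v"
  unfolding l2_def by (intro member_le_L2_set) auto

lemma l2_cauchy_schwarz: "cmod (\<Sum>a<d. cnj (u a) * w a) \<le> l2 d u * l2 d w"
proof -
  have "cmod (\<Sum>a<d. cnj (u a) * w a) \<le> (\<Sum>a<d. \<bar>cmod (u a)\<bar> * \<bar>cmod (w a)\<bar>)"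
    by (intro order_trans[OF norm_sum] sum_mono) (simp add: norm_mult)
  also have "\<dots> \<le> l2 d u * l2 d w" unfolding l2_def by (rule L2_set_mult_ineq)
  finally show ?thesis .
qed

lemma l2_unit: "a < d \<Longrightarrow> l2 d ((\<lambda>_. 0)(a := c)) = cmod c"
proof -
  assume a: "a < d"
  have "(\<Sum>b<d. (cmod (((\<lambda>_. 0)(a := c)) b))\<^sup>2) = (\<Sum>b\<in>{a}. (cmod c)\<^sup>2)"
    using a by (intro sum.mono_neutral_cong_right) auto
  then show ?thesis by (simp add: l2_def L2_set_def)
qed

lemma sform_mapply: "sform d X u v = (\<Sum>a<d. cnj (u a) * mapply d X v a)"
  by (simp add: sform_def mapply_def sum_distrib_left mult.assoc)

lemma sform_unit:
  assumes "a < d" "b < d"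
  shows "sform d X ((\<lambda>_. 0)(a := x)) ((\<lambda>_. 0)(b := y)) = cnj x * X $$ (a, b) * y"
proof -
  have "mapply d X ((\<lambda>_. 0)(b := y)) a = X $$ (a, b) * y" for a
    unfolding mapply_def using assms(2)
    by (subst sum.mono_neutral_cong_right[of "{..<d}" "{b}" _ "\<lambda>b. X $$ (a, b) * y"]) auto
  then show ?thesis unfolding sform_mapply using assms(1)
    by (subst sum.mono_neutral_cong_right[of "{..<d}" "{a}" _ "\<lambda>a. cnj x * (X $$ (a, b) * y)"]) auto
qed

lemma sform_qform: "sform d X v v = qform {..<d} (\<lambda>a b. X $$ (a, b)) v"
  by (simp add: sform_def qform_def)

lemma mapply_mult:
  assumes "X \<in> carrier_mat d d" "Y \<in> carrier_mat d d" "a < d"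
  shows "mapply d (X * Y) v a = mapply d X (mapply d Y v) a"
proof -
  have "mapply d (X * Y) v a = (\<Sum>b<d. \<Sum>c<d. X $$ (a, c) * Y $$ (c, b) * v b)"
    unfolding mapply_def using assms
    by (intro sum.cong refl) (auto simp: scalar_prod_def sum_distrib_right lessThan_atLeast0)
  also have "\<dots> = (\<Sum>c<d. X $$ (a, c) * mapply d Y v c)"
    unfolding mapply_def by (subst sum.swap) (simp add: sum_distrib_left mult.assoc)
  finally show ?thesis by (simp add: mapply_def)
qed

lemma sform_mult:
  assumes "X \<in> carrier_mat d d" "Y \<in> carrier_mat d d"
  shows "sform d (X * Y) u v = sform d X u (mapply d Y v)"
  unfolding sform_mapply using mapply_mult[OF assms] by (intro sum.cong refl) simp

lemma mat_adjoint_index [simp]: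
  "i < dim_col A \<Longrightarrow> j < dim_row A \<Longrightarrow> mat_adjoint A $$ (i, j) = cnj (A $$ (j, i))" for A :: "complex mat"
  unfolding mat_adjoint_def by (simp add: mat_of_rows_def conjugate_complex_def)

lemma mat_adjoint_dim [simp]:
  "dim_row (mat_adjoint A) = dim_col A" "dim_col (mat_adjoint A) = dim_row A" for A :: "complex mat"
  unfolding mat_adjoint_def by auto

lemma mat_adjoint_carrier [simp, intro]: "A \<in> carrier_mat n m \<Longrightarrow> mat_adjoint A \<in> carrier_mat m n" for A :: "complex mat"
  unfolding carrier_mat_def by simp

lemma mat_adjoint_adjoint [simp]: "mat_adjoint (mat_adjoint A) = A" for A :: "complex mat"
  by (rule eq_matI) auto

lemma mat_adjoint_mult:
  fixes A B :: "complex mat"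
  assumes "A \<in> carrier_mat n m" "B \<in> carrier_mat m p"
  shows "mat_adjoint (A * B) = mat_adjoint B * mat_adjoint A"
  using assms by (intro eq_matI) (auto simp: scalar_prod_def intro!: sum.cong)

lemma mat_adjoint_add:
  fixes A B :: "complex mat"
  assumes "A \<in> carrier_mat n m" "B \<in> carrier_mat n m"
  shows "mat_adjoint (A + B) = mat_adjoint A + mat_adjoint B"
  using assms by (intro eq_matI) auto

lemma mat_adjoint_smult: "mat_adjoint (c \<cdot>\<^sub>m A) = cnj c \<cdot>\<^sub>m mat_adjoint A" for A :: "complex mat"
  by (intro eq_matI) auto

lemma mat_adjoint_one [simp]: "mat_adjoint (1\<^sub>m n) = (1\<^sub>m n :: complex mat)"
  by (intro eq_matI) auto

lemma sform_adjoint: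
  assumes "X \<in> carrier_mat d d"
  shows "sform d (mat_adjoint X) u v = cnj (sform d X v u)"
  unfolding sform_def cnj_sum by (subst sum.swap) (use assms in \<open>auto intro!: sum.cong\<close>)

lemma sform_add:
  assumes "X \<in> carrier_mat d d" "Y \<in> carrier_mat d d"
  shows "sform d (X + Y) u v = sform d X u v + sform d Y u v"
proof -
  have "sform d (X + Y) u v = (\<Sum>a<d. \<Sum>b<d. cnj (u a) * X $$ (a, b) * v b + cnj (u a) * Y $$ (a, b) * v b)"
    unfolding sform_def using assms by (intro sum.cong refl) (auto simp: algebra_simps)
  then show ?thesis by (simp add: sform_def sum.distrib)
qed

lemma sform_smult:
  assumes "X \<in> carrier_mat d d"
  shows "sform d (c \<cdot>\<^sub>m X) u v = c * sform d X u v"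
  unfolding sform_def sum_distrib_left using assms by (intro sum.cong refl) auto

lemma sform_one: "sform d (1\<^sub>m d) u v = (\<Sum>a<d. cnj (u a) * v a)"
proof -
  have "mapply d (1\<^sub>m d) v a = v a" if "a < d" for a
    unfolding mapply_def using that
    by (subst sum.mono_neutral_cong_right[of "{..<d}" "{a}" _ v]) auto
  then show ?thesis unfolding sform_mapply by (intro sum.cong refl) auto
qed

lemma sform_one_self: "sform d (1\<^sub>m d) v v = of_real ((l2 d v)\<^sup>2)"
  unfolding sform_one l2_sq of_real_sum complex_norm_square by (intro sum.cong refl) (rule mult.commute)

lemma op_boundedD: "op_bounded d X C \<Longrightarrow> cmod (sform d X u v) \<le> C * l2 d u * l2 d v"
  by (simp add: op_bounded_def)

lemma op_bounded_mono: "op_bounded d X C \<Longrightarrow> C \<le> D \<Longrightarrow> op_bounded d X D"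
  unfolding op_bounded_def by (meson l2_nonneg mult_right_mono order_trans)

lemma op_bounded_add:
  assumes "X \<in> carrier_mat d d" "Y \<in> carrier_mat d d" "op_bounded d X C" "op_bounded d Y D"
  shows "op_bounded d (X + Y) (C + D)"
  unfolding op_bounded_def
proof (intro allI)
  fix u v
  show "cmod (sform d (X + Y) u v) \<le> (C + D) * l2 d u * l2 d v"
    using op_boundedD[OF assms(3), of u v] op_boundedD[OF assms(4), of u v]
      norm_triangle_ineq[of "sform d X u v" "sform d Y u v"]
    unfolding sform_add[OF assms(1,2)] by (simp add: algebra_simps)
qed

lemma op_bounded_smult:
  assumes "X \<in> carrier_mat d d" "op_bounded d X C"
  shows "op_bounded d (c \<cdot>\<^sub>m X) (cmod c * C)"
  unfolding op_bounded_def sform_smult[OF assms(1)] norm_mult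
  using op_boundedD[OF assms(2)] by (auto simp: mult.assoc intro!: mult_left_mono)

lemma op_bounded_adjoint:
  assumes "X \<in> carrier_mat d d" "op_bounded d X C"
  shows "op_bounded d (mat_adjoint X) C"
  unfolding op_bounded_def sform_adjoint[OF assms(1)] complex_mod_cnj
  using op_boundedD[OF assms(2)] by (metis mult.assoc mult.commute)

lemma op_bounded_zero: "op_bounded d (0\<^sub>m d d) 0"
  by (simp add: op_bounded_def sform_def)

lemma op_bounded_one: "op_bounded d (1\<^sub>m d) 1"
  unfolding op_bounded_def sform_one using l2_cauchy_schwarz by simp

lemma op_bounded_imp_l2:
  assumes "op_bounded d X C" "C \<ge> 0"
  shows "l2 d (mapply d X v) \<le> C * l2 d v"
proof -
  let ?w = "mapply d X v"
  have "sform d X ?w v = of_real ((l2 d ?w)\<^sup>2)"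
    unfolding sform_mapply using sform_one_self[of d ?w] unfolding sform_one .
  then have "(l2 d ?w)\<^sup>2 \<le> C * l2 d ?w * l2 d v"
    using op_boundedD[OF assms(1), of ?w v] by (simp add: norm_power)
  then have *: "l2 d ?w * l2 d ?w \<le> l2 d ?w * (C * l2 d v)"
    by (simp add: power2_eq_square mult_ac)
  show ?thesis
  proof (cases "l2 d ?w = 0")
    case True
    then show ?thesis using assms(2) by simp
  next
    case False
    then have "0 < l2 d ?w" using l2_nonneg[of d ?w] by linarith
    then show ?thesis using * mult_le_cancel_left_pos by blast
  qed
qed

lemma op_boundedI_l2:
  assumes "\<And>v. l2 d (mapply d X v) \<le> C * l2 d v"
  shows "op_bounded d X C"
  unfolding op_bounded_def
proof (intro allI)
  fix u v
  have "cmod (sform d X u v) \<le> l2 d u * l2 d (mapply d X v)"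
    unfolding sform_mapply by (rule l2_cauchy_schwarz)
  also have "\<dots> \<le> l2 d u * (C * l2 d v)" using assms by (intro mult_left_mono) auto
  finally show "cmod (sform d X u v) \<le> C * l2 d u * l2 d v" by (simp add: mult_ac)
qed

lemma op_bounded_mult:
  assumes "X \<in> carrier_mat d d" "Y \<in> carrier_mat d d" "op_bounded d X C" "op_bounded d Y D" "C \<ge> 0" "D \<ge> 0"
  shows "op_bounded d (X * Y) (C * D)"
proof (rule op_boundedI_l2)
  fix v
  have "l2 d (mapply d (X * Y) v) = l2 d (mapply d X (mapply d Y v))"
    unfolding l2_def L2_set_def using mapply_mult[OF assms(1,2)] by simp
  also have "\<dots> \<le> C * l2 d (mapply d Y v)" using op_bounded_imp_l2 assms by blast
  also have "\<dots> \<le> C * (D * l2 d v)" using op_bounded_imp_l2 assms by (intro mult_left_mono) blast+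
  finally show "l2 d (mapply d (X * Y) v) \<le> C * D * l2 d v" by (simp add: mult_ac)
qed

lemma op_bounded_entry:
  assumes "op_bounded d X C" "a < d" "b < d"
  shows "cmod (X $$ (a, b)) \<le> C"
  using op_boundedD[OF assms(1), of "(\<lambda>_. 0)(a := 1)" "(\<lambda>_. 0)(b := 1)"]
  unfolding sform_unit[OF assms(2,3)] l2_unit[OF assms(2)] l2_unit[OF assms(3)] by simp

lemma op_bounded_entries: "op_bounded d X (\<Sum>a<d. \<Sum>b<d. cmod (X $$ (a, b)))"
  unfolding op_bounded_def
proof (intro allI)
  fix u v
  have "cmod (sform d X u v) \<le> (\<Sum>a<d. \<Sum>b<d. cmod (X $$ (a, b)) * (l2 d u * l2 d v))"
    unfolding sform_def
    by (intro order_trans[OF norm_sum] sum_mono)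
      (auto simp: norm_mult mult_ac intro!: mult_mono mult_left_mono cmod_le_l2)
  then show "cmod (sform d X u v) \<le> (\<Sum>a<d. \<Sum>b<d. cmod (X $$ (a, b))) * l2 d u * l2 d v"
    by (simp add: sum_distrib_right mult.assoc)
qed

lemma vec_l2_norm_eq: "v \<in> carrier_vec d \<Longrightarrow> vec_l2_norm v = l2 d (\<lambda>a. v $ a)"
  unfolding vec_l2_norm_def l2_def L2_set_def
  by (auto simp: scalar_prod_def conjugate_complex_def complex_mult_cnj cmod_power2 lessThan_atLeast0)

lemma mat_op_norm_set:
  assumes "X \<in> carrier_mat d d"
  shows "{vec_l2_norm (X *\<^sub>v v) | v. v \<in> carrier_vec (dim_col X) \<and> vec_l2_norm v \<le> 1}
    = {l2 d (mapply d X v) | v. l2 d v \<le> 1}"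
proof -
  have 1: "vec_l2_norm (X *\<^sub>v v) = l2 d (mapply d X (\<lambda>a. v $ a))" if "v \<in> carrier_vec d" for v
  proof -
    have "X *\<^sub>v v \<in> carrier_vec d" using assms that by auto
    moreover have "(X *\<^sub>v v) $ a = mapply d X (\<lambda>a. v $ a) a" if "a < d" for a
      using that assms \<open>v \<in> carrier_vec d\<close> by (auto simp: mapply_def scalar_prod_def lessThan_atLeast0)
    ultimately show ?thesis by (simp add: vec_l2_norm_eq l2_def L2_set_def)
  qed
  have 2: "l2 d (\<lambda>a. vec d v $ a) = l2 d v" "mapply d X (\<lambda>a. vec d v $ a) = mapply d X v" for v
    by (auto simp: l2_def L2_set_def mapply_def fun_eq_iff)
  show ?thesis
  proof (intro equalityI subsetI)
    fix x assume "x \<in> {vec_l2_norm (X *\<^sub>v v) | v. v \<in> carrier_vec (dim_col X) \<and> vec_l2_norm v \<le> 1}"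
    then show "x \<in> {l2 d (mapply d X v) | v. l2 d v \<le> 1}"
      using assms 1 vec_l2_norm_eq[of _ d] by auto
  next
    fix x assume "x \<in> {l2 d (mapply d X v) | v. l2 d v \<le> 1}"
    then obtain v where "x = l2 d (mapply d X v)" "l2 d v \<le> 1" by blast
    then show "x \<in> {vec_l2_norm (X *\<^sub>v v) | v. v \<in> carrier_vec (dim_col X) \<and> vec_l2_norm v \<le> 1}"
      using assms 1[of "vec d v"] vec_l2_norm_eq[of "vec d v" d] 2[of v] by (auto intro!: exI[of _ "vec d v"])
  qed
qed

text \<open>
  Together with \<open>op_bounded_mat_op_norm\<close>, this makes \<open>mat_op_norm X\<close> the least \<open>C \<ge> 0\<close> with \<open>op_bounded d X C\<close>.
\<close>

lemma mat_op_norm_le: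
  assumes "X \<in> carrier_mat d d" "op_bounded d X C" "C \<ge> 0"
  shows "mat_op_norm X \<le> C"
  unfolding mat_op_norm_def mat_op_norm_set[OF assms(1)]
proof (rule cSup_least)
  show "{l2 d (mapply d X v) |v. l2 d v \<le> 1} \<noteq> {}"
    by (auto intro!: exI[of _ "\<lambda>_. 0"] simp: l2_def L2_set_def)
  fix x assume "x \<in> {l2 d (mapply d X v) |v. l2 d v \<le> 1}"
  then obtain v where "x = l2 d (mapply d X v)" "l2 d v \<le> 1" by blast
  then show "x \<le> C" using op_bounded_imp_l2[OF assms(2,3), of v] mult_left_mono[of "l2 d v" 1 C] assms(3) by simp
qed

lemma op_bounded_mat_op_norm:
  assumes "X \<in> carrier_mat d d"
  shows "op_bounded d X (mat_op_norm X)" "0 \<le> mat_op_norm X"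
proof -
  let ?S = "{l2 d (mapply d X v) |v. l2 d v \<le> 1}"
  let ?C = "\<Sum>a<d. \<Sum>b<d. cmod (X $$ (a, b))"
  have C: "?C \<ge> 0" by (auto intro!: sum_nonneg)
  have bdd: "bdd_above ?S"
  proof (rule bdd_aboveI[of _ ?C])
    fix x assume "x \<in> ?S"
    then obtain v where "x = l2 d (mapply d X v)" "l2 d v \<le> 1" by blast
    then show "x \<le> ?C"
      using op_bounded_imp_l2[OF op_bounded_entries C, of v] mult_left_mono[OF _ C, of "l2 d v" 1] by simp
  qed
  have le: "l2 d (mapply d X v) \<le> mat_op_norm X" if "l2 d v \<le> 1" for v
    unfolding mat_op_norm_def mat_op_norm_set[OF assms] by (rule cSup_upper[OF _ bdd]) (use that in auto)
  have "0 \<le> l2 d (mapply d X (\<lambda>_. 0))" by simp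
  also have "\<dots> \<le> mat_op_norm X" by (rule le) (simp add: l2_def L2_set_def)
  finally show "0 \<le> mat_op_norm X" .
  show "op_bounded d X (mat_op_norm X)"
  proof (rule op_boundedI_l2)
    fix v
    show "l2 d (mapply d X v) \<le> mat_op_norm X * l2 d v"
    proof (cases "l2 d v = 0")
      case True
      then show ?thesis using op_bounded_imp_l2[OF op_bounded_entries C, of v] by simp
    next
      case False
      then have pos: "l2 d v > 0" using l2_nonneg[of d v] by linarith
      let ?c = "complex_of_real (1 / l2 d v)"
      have "mapply d X (\<lambda>a. ?c * v a) = (\<lambda>a. ?c * mapply d X v a)"
        by (auto simp: mapply_def sum_distrib_left mult_ac fun_eq_iff)
      then have "l2 d (mapply d X (\<lambda>a. ?c * v a)) = cmod ?c * l2 d (mapply d X v)"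
        by (simp only: l2_scale)
      moreover have "cmod ?c = 1 / l2 d v" using pos by (simp add: norm_divide)
      moreover have "l2 d (\<lambda>a. ?c * v a) = 1" unfolding l2_scale using calculation(2) pos by simp
      ultimately have "1 / l2 d v * l2 d (mapply d X v) \<le> mat_op_norm X"
        using le[of "\<lambda>a. ?c * v a"] by (simp only: order_refl)
      then show ?thesis using pos by (simp add: pos_divide_le_eq)
    qed
  qed
qed

section \<open>Matrix algebras and their bounded sums\<close>

lemma mat_alg_simps [simp]:
  "carrier (mat_alg d) = carrier_mat d d"
  "X \<otimes>\<^bsub>mat_alg d\<^esub> Y = X * Y" "\<one>\<^bsub>mat_alg d\<^esub> = 1\<^sub>m d" "\<zero>\<^bsub>mat_alg d\<^esub> = 0\<^sub>m d d"
  "X \<oplus>\<^bsub>mat_alg d\<^esub> Y = X + Y" "c \<odot>\<^bsub>mat_alg d\<^esub> X = c \<cdot>\<^sub>m X"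
  "adj (mat_alg d) = mat_adjoint" "nrm (mat_alg d) = mat_op_norm"
  by (simp_all add: mat_alg_def)

lemma mat_sum_simps [simp]:
  "X \<otimes>\<^bsub>mat_sum J k\<^esub> Y = (\<lambda>j\<in>J. X j * Y j)" "\<one>\<^bsub>mat_sum J k\<^esub> = (\<lambda>j\<in>J. 1\<^sub>m (k j))"
  "\<zero>\<^bsub>mat_sum J k\<^esub> = (\<lambda>j\<in>J. 0\<^sub>m (k j) (k j))"
  "X \<oplus>\<^bsub>mat_sum J k\<^esub> Y = (\<lambda>j\<in>J. X j + Y j)" "c \<odot>\<^bsub>mat_sum J k\<^esub> X = (\<lambda>j\<in>J. c \<cdot>\<^sub>m X j)"
  "adj (mat_sum J k) X = (\<lambda>j\<in>J. mat_adjoint (X j))"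
  by (simp_all add: mat_sum_def linf_sum_def)

lemma mat_sum_nrm: "nrm (mat_sum J k) X = Sup (insert 0 ((\<lambda>j. mat_op_norm (X j)) ` J))"
  by (simp add: mat_sum_def linf_sum_def)

lemma mat_sum_carrier_iff:
  "X \<in> carrier (mat_sum J k) \<longleftrightarrow>
     X \<in> extensional J \<and> (\<forall>j\<in>J. X j \<in> carrier_mat (k j) (k j)) \<and>
     (\<exists>C\<ge>0. \<forall>j\<in>J. op_bounded (k j) (X j) C)"
proof (cases "X \<in> extensional J \<and> (\<forall>j\<in>J. X j \<in> carrier_mat (k j) (k j))")
  case True
  have "bdd_above ((\<lambda>j. mat_op_norm (X j)) ` J) \<longleftrightarrow> (\<exists>C\<ge>0. \<forall>j\<in>J. op_bounded (k j) (X j) C)"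
  proof
    assume "bdd_above ((\<lambda>j. mat_op_norm (X j)) ` J)"
    then obtain C where "\<forall>j\<in>J. mat_op_norm (X j) \<le> C" by (auto simp: bdd_above_def)
    then have "\<forall>j\<in>J. op_bounded (k j) (X j) (max C 0)"
      using True op_bounded_mat_op_norm(1) op_bounded_mono by (metis max.coboundedI1)
    then show "\<exists>C\<ge>0. \<forall>j\<in>J. op_bounded (k j) (X j) C" by (intro exI[of _ "max C 0"]) auto
  next
    assume "\<exists>C\<ge>0. \<forall>j\<in>J. op_bounded (k j) (X j) C"
    then obtain C where "C \<ge> 0" "\<forall>j\<in>J. op_bounded (k j) (X j) C" by blast
    then show "bdd_above ((\<lambda>j. mat_op_norm (X j)) ` J)"
      using True by (intro bdd_aboveI2[of J _ C] mat_op_norm_le) auto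
  qed
  then show ?thesis using True by (auto simp: mat_sum_def linf_sum_def PiE_iff)
next
  case False
  then show ?thesis by (auto simp: mat_sum_def linf_sum_def PiE_iff)
qed

lemma mat_sum_carrierI:
  assumes "X \<in> extensional J" "\<And>j. j \<in> J \<Longrightarrow> X j \<in> carrier_mat (k j) (k j)"
    "\<And>j. j \<in> J \<Longrightarrow> op_bounded (k j) (X j) C" "0 \<le> C"
  shows "X \<in> carrier (mat_sum J k)"
  unfolding mat_sum_carrier_iff using assms by blast

lemma mat_sum_carrierD:
  assumes "X \<in> carrier (mat_sum J k)" "j \<in> J"
  shows "X j \<in> carrier_mat (k j) (k j)"
  using assms unfolding mat_sum_carrier_iff by blast

lemma mat_sum_dim [simp]:
  assumes "X \<in> carrier (mat_sum J k)" "j \<in> J"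
  shows "dim_row (X j) = k j" "dim_col (X j) = k j"
  using mat_sum_carrierD[OF assms] by auto

lemma mat_sum_bounded:
  assumes "X \<in> carrier (mat_sum J k)"
  obtains C where "0 \<le> C" "\<And>j. j \<in> J \<Longrightarrow> op_bounded (k j) (X j) C"
  using assms unfolding mat_sum_carrier_iff by blast

lemma mat_sum_extensional: "X \<in> carrier (mat_sum J k) \<Longrightarrow> X \<in> extensional J"
  unfolding mat_sum_carrier_iff by blast

lemma mat_sum_eqI:
  assumes "X \<in> carrier (mat_sum J k)" "Y \<in> carrier (mat_sum J k)"
    "\<And>j a b. j \<in> J \<Longrightarrow> a < k j \<Longrightarrow> b < k j \<Longrightarrow> X j $$ (a, b) = Y j $$ (a, b)"
  shows "X = Y"
  using assms by (intro extensionalityI[of _ J] eq_matI) (auto dest: mat_sum_extensional)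

lemma mat_sum_add_closed:
  assumes "X \<in> carrier (mat_sum J k)" "Y \<in> carrier (mat_sum J k)"
  shows "(\<lambda>j\<in>J. X j + Y j) \<in> carrier (mat_sum J k)"
proof -
  obtain C D where "0 \<le> C" "\<And>j. j \<in> J \<Longrightarrow> op_bounded (k j) (X j) C"
    "0 \<le> D" "\<And>j. j \<in> J \<Longrightarrow> op_bounded (k j) (Y j) D"
    using mat_sum_bounded assms by metis
  then show ?thesis using assms
    by (intro mat_sum_carrierI[where C = "C + D"]) (auto intro!: op_bounded_add dest: mat_sum_carrierD)
qed

lemma mat_sum_mult_closed:
  assumes "X \<in> carrier (mat_sum J k)" "Y \<in> carrier (mat_sum J k)"
  shows "(\<lambda>j\<in>J. X j * Y j) \<in> carrier (mat_sum J k)"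
proof -
  obtain C D where "0 \<le> C" "\<And>j. j \<in> J \<Longrightarrow> op_bounded (k j) (X j) C"
    "0 \<le> D" "\<And>j. j \<in> J \<Longrightarrow> op_bounded (k j) (Y j) D"
    using mat_sum_bounded assms by metis
  then show ?thesis using assms
    by (intro mat_sum_carrierI[where C = "C * D"])
      (auto intro!: op_bounded_mult mult_carrier_mat dest: mat_sum_carrierD)
qed

lemma mat_sum_smult_closed:
  assumes "X \<in> carrier (mat_sum J k)"
  shows "(\<lambda>j\<in>J. c \<cdot>\<^sub>m X j) \<in> carrier (mat_sum J k)"
proof -
  obtain C where "0 \<le> C" "\<And>j. j \<in> J \<Longrightarrow> op_bounded (k j) (X j) C"
    using mat_sum_bounded assms by metis
  then show ?thesis using assms
    by (intro mat_sum_carrierI[where C = "cmod c * C"]) (auto intro!: op_bounded_smult dest: mat_sum_carrierD)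
qed

lemma mat_sum_adj_closed:
  assumes "X \<in> carrier (mat_sum J k)"
  shows "(\<lambda>j\<in>J. mat_adjoint (X j)) \<in> carrier (mat_sum J k)"
proof -
  obtain C where "0 \<le> C" "\<And>j. j \<in> J \<Longrightarrow> op_bounded (k j) (X j) C"
    using mat_sum_bounded assms by metis
  then show ?thesis using assms
    by (intro mat_sum_carrierI[where C = "C"]) (auto intro!: op_bounded_adjoint dest: mat_sum_carrierD)
qed

lemma mat_sum_one_closed: "(\<lambda>j\<in>J. 1\<^sub>m (k j)) \<in> carrier (mat_sum J k)"
  by (rule mat_sum_carrierI[where C = 1]) (auto intro: op_bounded_one)

lemma mat_sum_zero_closed: "(\<lambda>j\<in>J. 0\<^sub>m (k j) (k j)) \<in> carrier (mat_sum J k)"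
  by (rule mat_sum_carrierI[where C = 0]) (auto intro: op_bounded_zero)

lemma mat_sum_upd_closed:
  assumes "X \<in> carrier (mat_sum J k)" "l \<in> J" "M \<in> carrier_mat (k l) (k l)"
  shows "X(l := M) \<in> carrier (mat_sum J k)"
proof -
  obtain C where C: "0 \<le> C" "\<And>j. j \<in> J \<Longrightarrow> op_bounded (k j) (X j) C"
    using mat_sum_bounded assms(1) by metis
  define D where "D = max C (mat_op_norm M)"
  have "op_bounded (k j) ((X(l := M)) j) D" if "j \<in> J" for j
    using C(2)[OF that] op_bounded_mat_op_norm(1)[OF assms(3)] unfolding D_def
    by (auto elim: op_bounded_mono)
  then show ?thesis using assms C(1)
    by (intro mat_sum_carrierI[where C = D])
      (auto simp: D_def extensional_def dest: mat_sum_carrierD mat_sum_extensional)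
qed

lemma mat_sum_restrict_closed:
  assumes "X \<in> carrier (mat_sum J k)" "J' \<subseteq> J"
  shows "restrict X J' \<in> carrier (mat_sum J' k)"
proof -
  obtain C where "0 \<le> C" "\<And>j. j \<in> J \<Longrightarrow> op_bounded (k j) (X j) C"
    using mat_sum_bounded assms(1) by metis
  then show ?thesis using assms by (intro mat_sum_carrierI[where C = C]) (auto dest: mat_sum_carrierD)
qed

lemmas mat_sum_closed = mat_sum_add_closed mat_sum_mult_closed mat_sum_smult_closed
  mat_sum_adj_closed mat_sum_one_closed mat_sum_zero_closed

lemma mat_sum_nrm_bound:
  assumes "X \<in> carrier (mat_sum J k)"
  shows "j \<in> J \<Longrightarrow> op_bounded (k j) (X j) (nrm (mat_sum J k) X)" "0 \<le> nrm (mat_sum J k) X"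
proof -
  obtain C where C: "0 \<le> C" "\<And>j. j \<in> J \<Longrightarrow> op_bounded (k j) (X j) C"
    using mat_sum_bounded assms by metis
  have bdd: "bdd_above (insert 0 ((\<lambda>j. mat_op_norm (X j)) ` J))"
    using C mat_op_norm_le[OF mat_sum_carrierD[OF assms] C(2) C(1)] by (intro bdd_aboveI[of _ C]) auto
  show "0 \<le> nrm (mat_sum J k) X" unfolding mat_sum_nrm by (rule cSup_upper[OF _ bdd]) simp
  assume j: "j \<in> J"
  have "mat_op_norm (X j) \<le> nrm (mat_sum J k) X"
    unfolding mat_sum_nrm by (rule cSup_upper[OF _ bdd]) (use j in simp)
  then show "op_bounded (k j) (X j) (nrm (mat_sum J k) X)"
    using op_bounded_mat_op_norm(1)[OF mat_sum_carrierD[OF assms j]] op_bounded_mono by blast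
qed

lemma abelian_group_mat_alg: "abelian_group (mat_alg d)"
proof (rule abelian_groupI)
  fix x assume x: "x \<in> carrier (mat_alg d)"
  then show "\<exists>y\<in>carrier (mat_alg d). y \<oplus>\<^bsub>mat_alg d\<^esub> x = \<zero>\<^bsub>mat_alg d\<^esub>"
    by (intro bexI[of _ "- x"]) (auto intro!: eq_matI)
qed (auto intro!: eq_matI)

lemma abelian_group_mat_sum: "abelian_group (mat_sum J k)"
proof (rule abelian_groupI)
  fix x assume x: "x \<in> carrier (mat_sum J k)"
  show "\<exists>y\<in>carrier (mat_sum J k). y \<oplus>\<^bsub>mat_sum J k\<^esub> x = \<zero>\<^bsub>mat_sum J k\<^esub>"
  proof (intro bexI)
    show "(\<lambda>j\<in>J. (- 1) \<cdot>\<^sub>m x j) \<oplus>\<^bsub>mat_sum J k\<^esub> x = \<zero>\<^bsub>mat_sum J k\<^esub>"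
      using x by (auto intro!: restrict_ext eq_matI)
  qed (rule mat_sum_smult_closed[OF x])
next
  fix x assume x: "x \<in> carrier (mat_sum J k)"
  then show "\<zero>\<^bsub>mat_sum J k\<^esub> \<oplus>\<^bsub>mat_sum J k\<^esub> x = x"
    using mat_sum_add_closed[OF mat_sum_zero_closed x] by (intro mat_sum_eqI[of _ J k]) auto
next
  fix x y assume "x \<in> carrier (mat_sum J k)" "y \<in> carrier (mat_sum J k)"
  then show "x \<oplus>\<^bsub>mat_sum J k\<^esub> y \<in> carrier (mat_sum J k)" by (simp add: mat_sum_add_closed)
qed (auto simp: mat_sum_zero_closed intro!: restrict_ext eq_matI)

lemma mat_sum_minus:
  assumes x: "x \<in> carrier (mat_sum J k)" and y: "y \<in> carrier (mat_sum J k)"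
  shows "x \<ominus>\<^bsub>mat_sum J k\<^esub> y = (\<lambda>j\<in>J. x j + (- 1) \<cdot>\<^sub>m y j)"
proof -
  interpret abelian_group "mat_sum J k" by (rule abelian_group_mat_sum)
  have "\<ominus>\<^bsub>mat_sum J k\<^esub> y = (\<lambda>j\<in>J. (- 1) \<cdot>\<^sub>m y j)"
  proof (rule minus_equality)
    show "(\<lambda>j\<in>J. (- 1) \<cdot>\<^sub>m y j) \<oplus>\<^bsub>mat_sum J k\<^esub> y = \<zero>\<^bsub>mat_sum J k\<^esub>"
      using y by (auto intro!: restrict_ext eq_matI)
  qed (use y mat_sum_smult_closed[OF y] in auto)
  then show ?thesis unfolding a_minus_def by (simp cong: restrict_cong)
qed

lemma mat_alg_finsum:
  fixes n :: nat
  assumes "\<And>r. r < n \<Longrightarrow> F r \<in> carrier_mat d d"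
  shows "finsum (mat_alg d) F {..<n} \<in> carrier_mat d d"
    "a < d \<Longrightarrow> b < d \<Longrightarrow> finsum (mat_alg d) F {..<n} $$ (a, b) = (\<Sum>r<n. F r $$ (a, b))"
proof -
  interpret abelian_group "mat_alg d" by (rule abelian_group_mat_alg)
  have closed: "finsum (mat_alg d) F {..<m} \<in> carrier_mat d d" if "m \<le> n" for m
    using finsum_closed[of F "{..<m}"] assms that by auto
  from closed show "finsum (mat_alg d) F {..<n} \<in> carrier_mat d d" by simp
  assume ab: "a < d" "b < d"
  have "finsum (mat_alg d) F {..<m} $$ (a, b) = (\<Sum>r<m. F r $$ (a, b))" if "m \<le> n" for m
    using that
  proof (induction m)
    case 0
    then show ?case using ab by simp
  next
    case (Suc m)
    have "finsum (mat_alg d) F (insert m {..<m}) = F m + finsum (mat_alg d) F {..<m}"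
      using assms Suc.prems by (subst finsum_insert) auto
    then show ?case using Suc closed[of m] ab by (simp add: lessThan_Suc)
  qed
  then show "finsum (mat_alg d) F {..<n} $$ (a, b) = (\<Sum>r<n. F r $$ (a, b))" by simp
qed

lemma mat_sum_finsum:
  fixes n :: nat
  assumes "\<And>r. r < n \<Longrightarrow> F r \<in> carrier (mat_sum J k)"
  shows "finsum (mat_sum J k) F {..<n} \<in> carrier (mat_sum J k)"
    "j \<in> J \<Longrightarrow> a < k j \<Longrightarrow> b < k j \<Longrightarrow> finsum (mat_sum J k) F {..<n} j $$ (a, b) = (\<Sum>r<n. F r j $$ (a, b))"
proof -
  interpret abelian_group "mat_sum J k" by (rule abelian_group_mat_sum)
  have closed: "finsum (mat_sum J k) F {..<m} \<in> carrier (mat_sum J k)" if "m \<le> n" for m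
    using finsum_closed[of F "{..<m}"] assms that by auto
  from closed show "finsum (mat_sum J k) F {..<n} \<in> carrier (mat_sum J k)" by simp
  assume jab: "j \<in> J" "a < k j" "b < k j"
  have "finsum (mat_sum J k) F {..<m} j $$ (a, b) = (\<Sum>r<m. F r j $$ (a, b))" if "m \<le> n" for m
    using that
  proof (induction m)
    case 0
    then show ?case using jab by simp
  next
    case (Suc m)
    have "finsum (mat_sum J k) F (insert m {..<m}) = (\<lambda>j\<in>J. F m j + finsum (mat_sum J k) F {..<m} j)"
      using assms Suc.prems by (subst finsum_insert) auto
    then show ?case using Suc closed[of m] jab by (simp add: lessThan_Suc)
  qed
  then show "finsum (mat_sum J k) F {..<n} j $$ (a, b) = (\<Sum>r<n. F r j $$ (a, b))" by simp
qed

section \<open>Matrix positivity in terms of quadratic forms\<close>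

text \<open>
  An \<open>n \<times> n\<close> matrix of \<open>d \<times> d\<close> matrices as one scalar matrix indexed by pairs.
\<close>

definition block :: "(nat \<Rightarrow> nat \<Rightarrow> complex mat) \<Rightarrow> nat \<times> nat \<Rightarrow> nat \<times> nat \<Rightarrow> complex" where
  "block X i j = X (fst i) (fst j) $$ (snd i, snd j)"

abbreviation block_index :: "nat \<Rightarrow> nat \<Rightarrow> (nat \<times> nat) set" where
  "block_index n d \<equiv> {..<n} \<times> {..<d}"

lemma sum_block_index: "(\<Sum>i\<in>block_index n d. f i) = (\<Sum>p<n. \<Sum>a<d. f (p, a))"
  by (simp add: sum.cartesian_product)

lemma qform_block:
  "qform (block_index n d) (block X) v = (\<Sum>p<n. \<Sum>q<n. sform d (X p q) (\<lambda>a. v (p, a)) (\<lambda>b. v (q, b)))"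
proof -
  have "qform (block_index n d) (block X) v =
    (\<Sum>p<n. \<Sum>a<d. \<Sum>q<n. \<Sum>b<d. cnj (v (p, a)) * X p q $$ (a, b) * v (q, b))"
    unfolding qform_def sum_block_index by (simp add: block_def)
  also have "\<dots> = (\<Sum>p<n. \<Sum>q<n. sform d (X p q) (\<lambda>a. v (p, a)) (\<lambda>b. v (q, b)))"
    unfolding sform_def by (intro sum.cong refl sum.swap)
  finally show ?thesis .
qed

lemma gram_entry:
  assumes "A \<in> carrier_mat d d" "B \<in> carrier_mat d d" "a < d" "b < d"
  shows "(mat_adjoint A * B) $$ (a, b) = (\<Sum>c<d. cnj (A $$ (c, a)) * B $$ (c, b))"
  using assms by (auto simp: scalar_prod_def lessThan_atLeast0)

lemma matrix_positive_mat_alg: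
  assumes X: "\<And>p q. p < n \<Longrightarrow> q < n \<Longrightarrow> X p q \<in> carrier_mat d d"
  shows "matrix_positive (mat_alg d) n X \<longleftrightarrow> psd (block_index n d) (block X)"
proof
  assume "matrix_positive (mat_alg d) n X"
  then obtain Y where Y: "Y \<in> matrices_over n (carrier (mat_alg d))"
    and XY: "\<forall>p<n. \<forall>q<n. X p q = (\<Oplus>\<^bsub>mat_alg d\<^esub>r\<in>{..<n}. adj (mat_alg d) (Y r p) \<otimes>\<^bsub>mat_alg d\<^esub> Y r q)"
    unfolding matrix_positive_def by blast
  have Y: "Y p q \<in> carrier_mat d d" if "p < n" "q < n" for p q
    using Y that by (simp add: matrices_over_def)
  have XY: "X p q = finsum (mat_alg d) (\<lambda>r. mat_adjoint (Y r p) * Y r q) {..<n}" if "p < n" "q < n" for p q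
    using XY that by simp
  show "psd (block_index n d) (block X)"
  proof (rule gram_imp_psd[where R = "block_index n d" and Y = "block Y"])
    fix i j assume ij: "i \<in> block_index n d" "j \<in> block_index n d"
    then obtain p a q b where [simp]: "i = (p, a)" "j = (q, b)" and lt: "p < n" "a < d" "q < n" "b < d" by auto
    have "block X i j = (\<Sum>r<n. (mat_adjoint (Y r p) * Y r q) $$ (a, b))"
      unfolding block_def using lt Y by (simp add: XY) (subst mat_alg_finsum(2), auto intro!: mult_carrier_mat[of _ d d])
    also have "\<dots> = (\<Sum>r<n. \<Sum>c<d. cnj (Y r p $$ (c, a)) * Y r q $$ (c, b))"
      using lt Y by (intro sum.cong refl gram_entry) auto
    finally show "block X i j = (\<Sum>r\<in>block_index n d. cnj (block Y r i) * block Y r j)"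
      unfolding sum_block_index by (simp add: block_def)
  qed
next
  assume "psd (block_index n d) (block X)"
  from psd_imp_gram[OF _ this] obtain Z
    where Z: "\<And>i j. i \<in> block_index n d \<Longrightarrow> j \<in> block_index n d \<Longrightarrow>
      block X i j = (\<Sum>r\<in>block_index n d. cnj (Z r i) * Z r j)" by auto
  define Y where "Y r p = mat d d (\<lambda>(c, a). Z (r, c) (p, a))" for r p
  have Yc: "Y r p \<in> carrier_mat d d" for r p by (simp add: Y_def)
  show "matrix_positive (mat_alg d) n X"
    unfolding matrix_positive_def matrices_over_def
  proof (intro bexI allI impI)
    fix p q assume pq: "p < n" "q < n"
    show "X p q = (\<Oplus>\<^bsub>mat_alg d\<^esub>r\<in>{..<n}. adj (mat_alg d) (Y r p) \<otimes>\<^bsub>mat_alg d\<^esub> Y r q)"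
    proof (rule eq_matI)
      have c: "finsum (mat_alg d) (\<lambda>r. mat_adjoint (Y r p) * Y r q) {..<n} \<in> carrier_mat d d"
        using Yc by (intro mat_alg_finsum(1)) (meson mat_adjoint_carrier mult_carrier_mat)
      then show "dim_row (X p q) = dim_row (\<Oplus>\<^bsub>mat_alg d\<^esub>r\<in>{..<n}. adj (mat_alg d) (Y r p) \<otimes>\<^bsub>mat_alg d\<^esub> Y r q)"
        "dim_col (X p q) = dim_col (\<Oplus>\<^bsub>mat_alg d\<^esub>r\<in>{..<n}. adj (mat_alg d) (Y r p) \<otimes>\<^bsub>mat_alg d\<^esub> Y r q)"
        using X[OF pq] by auto
      fix a b assume "a < dim_row (\<Oplus>\<^bsub>mat_alg d\<^esub>r\<in>{..<n}. adj (mat_alg d) (Y r p) \<otimes>\<^bsub>mat_alg d\<^esub> Y r q)"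
        "b < dim_col (\<Oplus>\<^bsub>mat_alg d\<^esub>r\<in>{..<n}. adj (mat_alg d) (Y r p) \<otimes>\<^bsub>mat_alg d\<^esub> Y r q)"
      then have ab: "a < d" "b < d" using c by auto
      have "X p q $$ (a, b) = (\<Sum>r<n. \<Sum>c<d. cnj (Z (r, c) (p, a)) * Z (r, c) (q, b))"
        using Z[of "(p, a)" "(q, b)"] pq ab unfolding sum_block_index by (simp add: block_def)
      also have "\<dots> = (\<Sum>r<n. (mat_adjoint (Y r p) * Y r q) $$ (a, b))"
        using Yc ab by (intro sum.cong refl) (subst gram_entry[of _ d], auto simp: Y_def)
      also have "\<dots> = finsum (mat_alg d) (\<lambda>r. mat_adjoint (Y r p) * Y r q) {..<n} $$ (a, b)"
        using Yc ab by (subst mat_alg_finsum(2)) (auto intro: mult_carrier_mat[of _ d d])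
      finally show "X p q $$ (a, b) = (\<Oplus>\<^bsub>mat_alg d\<^esub>r\<in>{..<n}. adj (mat_alg d) (Y r p) \<otimes>\<^bsub>mat_alg d\<^esub> Y r q) $$ (a, b)"
        by simp
    qed
  qed (use Yc in auto)
qed

text \<open>
  Only the uniform boundedness of the blockwise square roots needs an argument: the column \<open>p\<close> of the
  factor \<open>Y\<close> has its norm controlled by the diagonal entry \<open>X p p\<close>.
\<close>

lemma matrix_positive_mat_sum:
  assumes X: "\<And>p q. p < n \<Longrightarrow> q < n \<Longrightarrow> X p q \<in> carrier (mat_sum J k)"
  shows "matrix_positive (mat_sum J k) n X \<longleftrightarrow>
    (\<forall>j\<in>J. psd (block_index n (k j)) (block (\<lambda>p q. X p q j)))"
proof
  assume "matrix_positive (mat_sum J k) n X"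
  then obtain Y where Y: "Y \<in> matrices_over n (carrier (mat_sum J k))"
    and XY: "\<forall>p<n. \<forall>q<n. X p q = (\<Oplus>\<^bsub>mat_sum J k\<^esub>r\<in>{..<n}. adj (mat_sum J k) (Y r p) \<otimes>\<^bsub>mat_sum J k\<^esub> Y r q)"
    unfolding matrix_positive_def by blast
  have Y: "Y p q \<in> carrier (mat_sum J k)" if "p < n" "q < n" for p q
    using Y that by (simp add: matrices_over_def)
  have XY: "X p q = finsum (mat_sum J k) (\<lambda>r. \<lambda>j\<in>J. mat_adjoint (Y r p j) * Y r q j) {..<n}" if "p < n" "q < n" for p q
    using XY that by (simp cong: restrict_cong)
  show "\<forall>j\<in>J. psd (block_index n (k j)) (block (\<lambda>p q. X p q j))"
  proof
    fix j assume j: "j \<in> J"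
    show "psd (block_index n (k j)) (block (\<lambda>p q. X p q j))"
    proof (rule gram_imp_psd[where R = "block_index n (k j)" and Y = "block (\<lambda>p q. Y p q j)"])
      fix i i' assume ij: "i \<in> block_index n (k j)" "i' \<in> block_index n (k j)"
      then obtain p a q b where [simp]: "i = (p, a)" "i' = (q, b)" and lt: "p < n" "a < k j" "q < n" "b < k j" by auto
      have cl: "(\<lambda>j\<in>J. mat_adjoint (Y r p j) * Y r q j) \<in> carrier (mat_sum J k)" if "r < n" for r
        using mat_sum_mult_closed[OF mat_sum_adj_closed[OF Y[OF that lt(1)]] Y[OF that lt(3)]]
        by (simp cong: restrict_cong)
      have "block (\<lambda>p q. X p q j) i i' = (\<Sum>r<n. (mat_adjoint (Y r p j) * Y r q j) $$ (a, b))"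
        unfolding block_def using mat_sum_finsum(2)[of n, OF cl j lt(2,4)] lt j by (simp add: XY)
      also have "\<dots> = (\<Sum>r<n. \<Sum>c<k j. cnj (Y r p j $$ (c, a)) * Y r q j $$ (c, b))"
        using lt Y j by (intro sum.cong refl gram_entry) (auto dest: mat_sum_carrierD)
      finally show "block (\<lambda>p q. X p q j) i i' =
        (\<Sum>r\<in>block_index n (k j). cnj (block (\<lambda>p q. Y p q j) r i) * block (\<lambda>p q. Y p q j) r i')"
        unfolding sum_block_index by (simp add: block_def)
    qed
  qed
next
  assume "\<forall>j\<in>J. psd (block_index n (k j)) (block (\<lambda>p q. X p q j))"
  then have "\<forall>j\<in>J. \<exists>Z. \<forall>i\<in>block_index n (k j). \<forall>i'\<in>block_index n (k j).
      block (\<lambda>p q. X p q j) i i' = (\<Sum>r\<in>block_index n (k j). cnj (Z r i) * Z r i')"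
    by (intro ballI psd_imp_gram) auto
  from bchoice[OF this] obtain Z where Z: "block (\<lambda>p q. X p q j) i i' = (\<Sum>r\<in>block_index n (k j). cnj (Z j r i) * Z j r i')"
    if "j \<in> J" "i \<in> block_index n (k j)" "i' \<in> block_index n (k j)" for j i i'
    by blast
  define Y where "Y r p = (\<lambda>j\<in>J. mat (k j) (k j) (\<lambda>(c, a). Z j (r, c) (p, a)))" for r p
  have Y_gram: "X p q j $$ (a, b) = (\<Sum>r<n. \<Sum>c<k j. cnj (Y r p j $$ (c, a)) * Y r q j $$ (c, b))"
    if "p < n" "q < n" "j \<in> J" "a < k j" "b < k j" for p q j a b
    using Z[of j "(p, a)" "(q, b)"] that unfolding sum_block_index by (simp add: block_def Y_def)
  have Yc: "Y r p \<in> carrier (mat_sum J k)" if rp: "r < n" "p < n" for r p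
  proof -
    obtain C where C: "0 \<le> C" "\<And>j. j \<in> J \<Longrightarrow> op_bounded (k j) (X p p j) C"
      using mat_sum_bounded[OF X[OF rp(2) rp(2)]] by metis
    have "op_bounded (k j) (Y r p j) (sqrt C)" if j: "j \<in> J" for j
    proof (rule op_boundedI_l2)
      fix v
      have "qform {..<k j} (\<lambda>a b. X p p j $$ (a, b)) v =
        of_real (\<Sum>(r, c)\<in>block_index n (k j). (cmod (\<Sum>b<k j. Y r p j $$ (c, b) * v b))\<^sup>2)"
        unfolding case_prod_beta
        by (rule qform_gram) (simp add: Y_gram[OF rp(2) rp(2) j] sum_block_index)
      then have "cmod (sform (k j) (X p p j) v v) = (\<Sum>r<n. (l2 (k j) (mapply (k j) (Y r p j) v))\<^sup>2)"
        unfolding sform_qform l2_sq mapply_def case_prod_beta sum_block_index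
        by (simp add: sum_nonneg flip: of_real_sum of_real_power)
      moreover have "(l2 (k j) (mapply (k j) (Y r p j) v))\<^sup>2 \<le> (\<Sum>r<n. (l2 (k j) (mapply (k j) (Y r p j) v))\<^sup>2)"
        using rp by (intro member_le_sum) auto
      ultimately have "(l2 (k j) (mapply (k j) (Y r p j) v))\<^sup>2 \<le> C * l2 (k j) v * l2 (k j) v"
        using op_boundedD[OF C(2)[OF j], of v v] by linarith
      also have "\<dots> = (sqrt C * l2 (k j) v)\<^sup>2" using C(1) by (simp add: power_mult_distrib power2_eq_square)
      finally show "l2 (k j) (mapply (k j) (Y r p j) v) \<le> sqrt C * l2 (k j) v"
        by (rule power2_le_imp_le) (simp add: C(1))
    qed
    moreover have "Y r p \<in> extensional J" "\<And>j. j \<in> J \<Longrightarrow> Y r p j \<in> carrier_mat (k j) (k j)" by (simp_all add: Y_def)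
    ultimately show ?thesis using C(1) real_sqrt_ge_zero mat_sum_carrierI by metis
  qed
  show "matrix_positive (mat_sum J k) n X"
    unfolding matrix_positive_def matrices_over_def
  proof (intro bexI allI impI)
    fix p q assume pq: "p < n" "q < n"
    define F where "F r = (\<lambda>j\<in>J. mat_adjoint (Y r p j) * Y r q j)" for r
    have F: "F r \<in> carrier (mat_sum J k)" if "r < n" for r
      using mat_sum_mult_closed[OF mat_sum_adj_closed[OF Yc[OF that pq(1)]] Yc[OF that pq(2)]]
      by (simp add: F_def cong: restrict_cong)
    have "X p q = finsum (mat_sum J k) F {..<n}"
    proof (rule mat_sum_eqI[OF X[OF pq] mat_sum_finsum(1)[of n, OF F]])
      fix j a b assume jab: "j \<in> J" "a < k j" "b < k j"
      have "(\<Sum>c<k j. cnj (Y r p j $$ (c, a)) * Y r q j $$ (c, b)) = F r j $$ (a, b)" if "r < n" for r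
        using gram_entry[OF mat_sum_carrierD[OF Yc[OF that pq(1)] jab(1)] mat_sum_carrierD[OF Yc[OF that pq(2)] jab(1)] jab(2,3)]
        unfolding F_def using jab(1) by simp
      then have "X p q j $$ (a, b) = (\<Sum>r<n. F r j $$ (a, b))"
        unfolding Y_gram[OF pq jab] by (intro sum.cong) auto
      then show "X p q j $$ (a, b) = finsum (mat_sum J k) F {..<n} j $$ (a, b)"
        using mat_sum_finsum(2)[of n, OF F jab] by simp
    qed auto
    then show "X p q = (\<Oplus>\<^bsub>mat_sum J k\<^esub>r\<in>{..<n}. adj (mat_sum J k) (Y r p) \<otimes>\<^bsub>mat_sum J k\<^esub> Y r q)"
      by (simp add: F_def[abs_def] cong: restrict_cong)
  qed (use Yc in auto)
qed

section \<open>Completely positive maps into a matrix algebra\<close>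

text \<open>
  The two instances needed are operator systems and the whole algebra.
\<close>

definition star_subspace :: "nat set \<Rightarrow> (nat \<Rightarrow> nat) \<Rightarrow> (nat \<Rightarrow> complex mat) set \<Rightarrow> bool" where
  "star_subspace J k S \<longleftrightarrow> S \<subseteq> carrier (mat_sum J k) \<and> (\<lambda>j\<in>J. 1\<^sub>m (k j)) \<in> S \<and>
     (\<forall>x\<in>S. \<forall>y\<in>S. (\<lambda>j\<in>J. x j + y j) \<in> S) \<and> (\<forall>c. \<forall>x\<in>S. (\<lambda>j\<in>J. c \<cdot>\<^sub>m x j) \<in> S) \<and>
     (\<forall>x\<in>S. (\<lambda>j\<in>J. mat_adjoint (x j)) \<in> S)"

lemma star_subspaceD:
  assumes "star_subspace J k S"
  shows "x \<in> S \<Longrightarrow> x \<in> carrier (mat_sum J k)" "(\<lambda>j\<in>J. 1\<^sub>m (k j)) \<in> S"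
    "x \<in> S \<Longrightarrow> y \<in> S \<Longrightarrow> (\<lambda>j\<in>J. x j + y j) \<in> S" "x \<in> S \<Longrightarrow> (\<lambda>j\<in>J. c \<cdot>\<^sub>m x j) \<in> S"
    "x \<in> S \<Longrightarrow> (\<lambda>j\<in>J. mat_adjoint (x j)) \<in> S"
  using assms unfolding star_subspace_def by auto

lemma star_subspace_carrier: "star_subspace J k (carrier (mat_sum J k))"
  unfolding star_subspace_def by (auto intro: mat_sum_closed)

lemma op_sys_mat_sum:
  "op_sys (mat_sum J k) T =
     {(\<lambda>j\<in>J. a \<cdot>\<^sub>m 1\<^sub>m (k j) + b \<cdot>\<^sub>m T j + c \<cdot>\<^sub>m mat_adjoint (T j)) | a b c. True}"
  unfolding op_sys_def by (auto cong: restrict_cong)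

lemma star_subspace_op_sys:
  assumes T: "T \<in> carrier (mat_sum J k)"
  shows "star_subspace J k (op_sys (mat_sum J k) T)"
proof -
  have d: "dim_row (T j) = k j" "dim_col (T j) = k j" if "j \<in> J" for j
    using mat_sum_dim[OF T that] by auto
  define el where "el a b c = (\<lambda>j\<in>J. a \<cdot>\<^sub>m 1\<^sub>m (k j) + b \<cdot>\<^sub>m T j + c \<cdot>\<^sub>m mat_adjoint (T j))" for a b c
  have S: "op_sys (mat_sum J k) T = {el a b c | a b c. True}"
    unfolding op_sys_mat_sum el_def ..
  have in_S: "x \<in> op_sys (mat_sum J k) T" if "x = el a b c" for x a b c
    unfolding S using that by blast
  have "el a b c \<in> carrier (mat_sum J k)" for a b c
    using mat_sum_add_closed[OF mat_sum_add_closed[OF mat_sum_smult_closed[OF mat_sum_one_closed, of a]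
          mat_sum_smult_closed[OF T, of b]] mat_sum_smult_closed[OF mat_sum_adj_closed[OF T], of c]]
    by (simp add: el_def cong: restrict_cong)
  then have 1: "op_sys (mat_sum J k) T \<subseteq> carrier (mat_sum J k)" unfolding S by auto
  have 2: "(\<lambda>j\<in>J. 1\<^sub>m (k j)) \<in> op_sys (mat_sum J k) T"
    by (rule in_S[of _ 1 0 0]) (auto simp: el_def d intro!: restrict_ext eq_matI)
  have 3: "(\<lambda>j\<in>J. x j + y j) \<in> op_sys (mat_sum J k) T"
    if xy: "x \<in> op_sys (mat_sum J k) T" "y \<in> op_sys (mat_sum J k) T" for x y
  proof -
    obtain a b c a' b' c' where "x = el a b c" "y = el a' b' c'" using xy unfolding S by blast
    then show ?thesis
      by (intro in_S[of _ "a + a'" "b + b'" "c + c'"])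
        (auto simp: el_def d algebra_simps intro!: restrict_ext eq_matI)
  qed
  have 4: "(\<lambda>j\<in>J. s \<cdot>\<^sub>m x j) \<in> op_sys (mat_sum J k) T" if x: "x \<in> op_sys (mat_sum J k) T" for s x
  proof -
    obtain a b c where "x = el a b c" using x unfolding S by blast
    then show ?thesis
      by (intro in_S[of _ "s * a" "s * b" "s * c"])
        (auto simp: el_def d algebra_simps intro!: restrict_ext eq_matI)
  qed
  have 5: "(\<lambda>j\<in>J. mat_adjoint (x j)) \<in> op_sys (mat_sum J k) T" if x: "x \<in> op_sys (mat_sum J k) T" for x
  proof -
    obtain a b c where "x = el a b c" using x unfolding S by blast
    then show ?thesis
      by (intro in_S[of _ "cnj a" "cnj c" "cnj b"])
        (auto simp: el_def d algebra_simps intro!: restrict_ext eq_matI)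
  qed
  show ?thesis unfolding star_subspace_def using 1 2 3 4 5 by blast
qed

lemma gen_in_op_sys:
  assumes "T \<in> carrier (mat_sum J k)"
  shows "T \<in> op_sys (mat_sum J k) T"
proof -
  have "T = (\<lambda>j\<in>J. 0 \<cdot>\<^sub>m 1\<^sub>m (k j) + 1 \<cdot>\<^sub>m T j + 0 \<cdot>\<^sub>m mat_adjoint (T j))"
  proof (rule extensionalityI[of _ J])
    fix j assume "j \<in> J"
    then show "T j = (\<lambda>j\<in>J. 0 \<cdot>\<^sub>m 1\<^sub>m (k j) + 1 \<cdot>\<^sub>m T j + 0 \<cdot>\<^sub>m mat_adjoint (T j)) j"
      using mat_sum_dim[OF assms \<open>j \<in> J\<close>] by (auto intro!: eq_matI)
  qed (use mat_sum_extensional[OF assms] in auto)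
  then show ?thesis unfolding op_sys_mat_sum by blast
qed

lemma linear_map_onD:
  assumes "linear_map_on (mat_sum J k) S (mat_alg d) \<phi>"
  shows "x \<in> S \<Longrightarrow> \<phi> x \<in> carrier_mat d d"
    "x \<in> S \<Longrightarrow> y \<in> S \<Longrightarrow> \<phi> (\<lambda>j\<in>J. x j + y j) = \<phi> x + \<phi> y"
    "x \<in> S \<Longrightarrow> \<phi> (\<lambda>j\<in>J. c \<cdot>\<^sub>m x j) = c \<cdot>\<^sub>m \<phi> x"
  using assms unfolding linear_map_on_def by auto

lemma ucpD:
  assumes "ucp (mat_sum J k) S (mat_alg d) \<phi>"
  shows "linear_map_on (mat_sum J k) S (mat_alg d) \<phi>" "\<phi> (\<lambda>j\<in>J. 1\<^sub>m (k j)) = 1\<^sub>m d"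
  using assms unfolding ucp_def by auto

definition block_accretive :: "nat set \<Rightarrow> (nat \<Rightarrow> nat) \<Rightarrow> nat \<Rightarrow> (nat \<Rightarrow> nat \<Rightarrow> nat \<Rightarrow> complex mat) \<Rightarrow> bool" where
  "block_accretive J k n X \<longleftrightarrow> (\<forall>j\<in>J. accretive (block_index n (k j)) (block (\<lambda>p q. X p q j)))"

lemma ucp_psd:
  assumes \<phi>: "ucp (mat_sum J k) S (mat_alg d) \<phi>" and S: "S \<subseteq> carrier (mat_sum J k)"
    and X: "\<And>p q. p < n \<Longrightarrow> q < n \<Longrightarrow> X p q \<in> S"
    and pos: "\<And>j. j \<in> J \<Longrightarrow> psd (block_index n (k j)) (block (\<lambda>p q. X p q j))"
  shows "psd (block_index n d) (block (\<lambda>p q. \<phi> (X p q)))"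
proof -
  have "matrix_positive (mat_sum J k) n X"
    using X S pos by (subst matrix_positive_mat_sum) auto
  moreover have "X \<in> matrices_over n S" using X by (auto simp: matrices_over_def)
  ultimately have "matrix_positive (mat_alg d) n (\<lambda>p q. \<phi> (X p q))"
    using \<phi> unfolding ucp_def by blast
  then show ?thesis
    using X linear_map_onD(1)[OF ucpD(1)[OF \<phi>]] by (subst (asm) matrix_positive_mat_alg) auto
qed

lemma sum_lessThan_2: "(\<Sum>p<(2::nat). f p) = f 0 + (f 1 :: 'a :: comm_monoid_add)"
  by (simp add: numeral_2_eq_2)

text \<open>
  The matrix with rows \<open>(C, x)\<close> and \<open>(x\<^sup>*, C)\<close> is positive when \<open>C\<close> bounds the norm of \<open>x\<close>.  Positivity of
  its image shows at once that \<open>\<phi>\<close> commutes with the adjoint and that \<open>\<phi>\<close> is contractive.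
\<close>

lemma ucp_two_by_two:
  assumes \<phi>: "ucp (mat_sum J k) S (mat_alg d) \<phi>" and S: "star_subspace J k S" and x: "x \<in> S"
    and C: "\<And>j. j \<in> J \<Longrightarrow> op_bounded (k j) (x j) C"
  shows "psd (block_index 2 d) (block (\<lambda>p q. if p = q then of_real C \<cdot>\<^sub>m 1\<^sub>m d
     else if p < q then \<phi> x else \<phi> (\<lambda>j\<in>J. mat_adjoint (x j))))"
proof -
  define X where "X p q = (if p = q then (\<lambda>j\<in>J. of_real C \<cdot>\<^sub>m (\<lambda>j\<in>J. 1\<^sub>m (k j)) j)
    else if p < q then x else (\<lambda>j\<in>J. mat_adjoint (x j)))" for p q :: nat
  note cl = star_subspaceD[OF S]
  have "psd (block_index 2 d) (block (\<lambda>p q. \<phi> (X p q)))"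
  proof (rule ucp_psd[OF \<phi>])
    show "S \<subseteq> carrier (mat_sum J k)" using cl(1) by blast
    show "X p q \<in> S" for p q
      unfolding X_def using cl(4)[OF cl(2), of "of_real C"] cl(5)[OF x] x by simp
    fix j assume j: "j \<in> J"
    have xj: "x j \<in> carrier_mat (k j) (k j)" using mat_sum_carrierD[OF cl(1)[OF x] j] .
    have "Im (qform (block_index 2 (k j)) (block (\<lambda>p q. X p q j)) v) = 0 \<and>
          0 \<le> Re (qform (block_index 2 (k j)) (block (\<lambda>p q. X p q j)) v)" for v
    proof -
      define s where "s = l2 (k j) (\<lambda>a. v (0, a))"
      define t where "t = l2 (k j) (\<lambda>a. v (1, a))"
      define z where "z = sform (k j) (x j) (\<lambda>a. v (0, a)) (\<lambda>a. v (1, a))"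
      have q: "qform (block_index 2 (k j)) (block (\<lambda>p q. X p q j)) v =
         of_real (C * s\<^sup>2) + z + (cnj z + of_real (C * t\<^sup>2))"
        unfolding qform_block sum_lessThan_2 X_def s_def t_def z_def using j xj
        by (simp add: sform_smult[of _ "k j"] sform_one_self sform_adjoint)
      have "cmod z \<le> C * s * t" unfolding z_def s_def t_def by (rule op_boundedD[OF C[OF j]])
      moreover have "- cmod z \<le> Re z" using abs_Re_le_cmod[of z] by linarith
      moreover have "2 * (C * s * t) \<le> C * s\<^sup>2 + C * t\<^sup>2"
      proof (cases "C \<ge> 0")
        case True
        have "2 * (s * t) \<le> s\<^sup>2 + t\<^sup>2" using sum_squares_bound[of s t] by simp
        from mult_left_mono[OF this True] show ?thesis by (simp add: algebra_simps)
      next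
        case False
        have "0 \<le> C * s * s" "0 \<le> C * t * t"
          using order_trans[OF norm_ge_zero op_boundedD[OF C[OF j]]] unfolding s_def t_def by blast+
        moreover have "C * s * t \<le> 0" using False unfolding s_def t_def by (simp add: mult_nonpos_nonneg)
        ultimately show ?thesis by (simp add: power2_eq_square mult.assoc)
      qed
      ultimately show ?thesis unfolding q by simp
    qed
    then show "psd (block_index 2 (k j)) (block (\<lambda>p q. X p q j))" unfolding psd_def by blast
  qed
  moreover have "\<phi> (\<lambda>j\<in>J. of_real C \<cdot>\<^sub>m (\<lambda>j\<in>J. 1\<^sub>m (k j)) j) = of_real C \<cdot>\<^sub>m 1\<^sub>m d"
    using linear_map_onD(3)[OF ucpD(1)[OF \<phi>] cl(2)] ucpD(2)[OF \<phi>] by simp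
  ultimately show ?thesis
    by (subst psd_cong[where H = "block (\<lambda>p q. \<phi> (X p q))"]) (auto simp: block_def X_def)
qed

lemma ucp_adjoint:
  assumes \<phi>: "ucp (mat_sum J k) S (mat_alg d) \<phi>" and S: "star_subspace J k S" and x: "x \<in> S"
  shows "\<phi> (\<lambda>j\<in>J. mat_adjoint (x j)) = mat_adjoint (\<phi> x)"
proof -
  obtain C where C: "\<And>j. j \<in> J \<Longrightarrow> op_bounded (k j) (x j) C"
    using mat_sum_bounded[OF star_subspaceD(1)[OF S x]] by metis
  have c: "\<phi> x \<in> carrier_mat d d" "\<phi> (\<lambda>j\<in>J. mat_adjoint (x j)) \<in> carrier_mat d d"
    using linear_map_onD(1)[OF ucpD(1)[OF \<phi>]] x star_subspaceD(5)[OF S x] by auto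
  show ?thesis
  proof (rule eq_matI)
    fix a b assume "a < dim_row (mat_adjoint (\<phi> x))" "b < dim_col (mat_adjoint (\<phi> x))"
    then have ab: "a < d" "b < d" using c by auto
    show "\<phi> (\<lambda>j\<in>J. mat_adjoint (x j)) $$ (a, b) = mat_adjoint (\<phi> x) $$ (a, b)"
      using psd_hermitian[OF _ ucp_two_by_two[OF \<phi> S x C], of "(0, b)" "(1, a)"] ab c
      by (simp add: block_def)
  qed (use c in auto)
qed

lemma ucp_entry_bound:
  assumes \<phi>: "ucp (mat_sum J k) S (mat_alg d) \<phi>" and S: "star_subspace J k S" and x: "x \<in> S"
    and C: "\<And>j. j \<in> J \<Longrightarrow> op_bounded (k j) (x j) C" and ab: "a < d" "b < d"
  shows "cmod (\<phi> x $$ (a, b)) \<le> C"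
proof -
  define z where "z = \<phi> x $$ (a, b)"
  define y where "y = (if z = 0 then 1 else - cnj z / of_real (cmod z))"
  have c: "\<phi> x \<in> carrier_mat d d"
    using linear_map_onD(1)[OF ucpD(1)[OF \<phi>]] x by auto
  have "cmod y = 1" by (simp add: y_def norm_divide)
  then have y: "cnj y * y = 1" using complex_norm_square[of y] by (simp add: mult.commute)
  have zy: "z * y = - of_real (cmod z)"
    by (auto simp: y_def complex_norm_square[symmetric] field_simps power2_eq_square)
  define B where "B = block (\<lambda>p q. if p = q then of_real C \<cdot>\<^sub>m 1\<^sub>m d
     else if p < q then \<phi> x else \<phi> (\<lambda>j\<in>J. mat_adjoint (x j)))"
  have "psd (block_index 2 d) B"
    unfolding B_def by (rule ucp_two_by_two[OF \<phi> S x]) (rule C)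
  then have "0 \<le> Re (qform (block_index 2 d) B ((\<lambda>_. 0)((0, a) := 1, (1, b) := y)))" by (rule psdD(2))
  moreover have "qform (block_index 2 d) B ((\<lambda>_. 0)((0, a) := 1, (1, b) := y)) =
      of_real C + z * y + cnj (z * y) + of_real C * (cnj y * y)"
    using ab c by (subst qform_pair) (auto simp: B_def ucp_adjoint[OF \<phi> S x] block_def z_def algebra_simps)
  ultimately have "0 \<le> Re (of_real C + z * y + cnj (z * y) + of_real C * (cnj y * y))" by simp
  then show ?thesis unfolding y zy by (simp add: z_def)
qed

text \<open>
  An accretive matrix has a positive sum with its adjoint, and \<open>\<phi>\<close> commutes with adjoints.
\<close>

lemma ucp_accretive:
  assumes \<phi>: "ucp (mat_sum J k) S (mat_alg d) \<phi>" and S: "star_subspace J k S"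
    and X: "\<And>p q. p < n \<Longrightarrow> q < n \<Longrightarrow> X p q \<in> S" and acc: "block_accretive J k n X"
  shows "accretive (block_index n d) (block (\<lambda>p q. \<phi> (X p q)))"
proof -
  note cl = star_subspaceD[OF S] and lin = linear_map_onD[OF ucpD(1)[OF \<phi>]]
  define Y where "Y p q = (\<lambda>j\<in>J. X p q j + (\<lambda>j\<in>J. mat_adjoint (X q p j)) j)" for p q
  have "psd (block_index n d) (block (\<lambda>p q. \<phi> (Y p q)))"
  proof (rule ucp_psd[OF \<phi>])
    show "S \<subseteq> carrier (mat_sum J k)" using cl(1) by blast
    show "Y p q \<in> S" if "p < n" "q < n" for p q
      unfolding Y_def using X that cl(3,5) by blast
    fix j assume j: "j \<in> J"
    have "psd (block_index n (k j)) (\<lambda>i i'. block (\<lambda>p q. X p q j) i i' + cnj (block (\<lambda>p q. X p q j) i' i))"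
      using acc j unfolding block_accretive_def accretive_iff_psd by blast
    then show "psd (block_index n (k j)) (block (\<lambda>p q. Y p q j))"
      using mat_sum_dim[OF cl(1)[OF X] j] j
      by (subst psd_cong[where H = "\<lambda>i i'. block (\<lambda>p q. X p q j) i i' + cnj (block (\<lambda>p q. X p q j) i' i)"])
        (auto simp: block_def Y_def)
  qed
  moreover have "\<phi> (Y p q) = \<phi> (X p q) + mat_adjoint (\<phi> (X q p))" if "p < n" "q < n" for p q
    unfolding Y_def using lin(2)[OF X cl(5)[OF X]] ucp_adjoint[OF \<phi> S X] that by simp
  moreover have "dim_row (\<phi> (X p q)) = d" "dim_col (\<phi> (X p q)) = d" if "p < n" "q < n" for p q
    using lin(1)[OF X[OF that]] by auto
  ultimately show ?thesis unfolding accretive_iff_psd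
    by (subst psd_cong[where H = "block (\<lambda>p q. \<phi> (Y p q))"]) (auto simp: block_def)
qed

text \<open>
  A scalar matrix is positive iff it stays accretive under multiplication by \<open>1\<close>, \<open>\<i>\<close> and \<open>- \<i>\<close>, and complex
  linear maps commute with these multiplications.
\<close>

lemma ucpI:
  assumes S: "star_subspace J k S"
    and lin: "linear_map_on (mat_sum J k) S (mat_alg d) \<phi>" and one: "\<phi> (\<lambda>j\<in>J. 1\<^sub>m (k j)) = 1\<^sub>m d"
    and acc: "\<And>n X. (\<And>p q. p < n \<Longrightarrow> q < n \<Longrightarrow> X p q \<in> S) \<Longrightarrow> block_accretive J k n X \<Longrightarrow>
      accretive (block_index n d) (block (\<lambda>p q. \<phi> (X p q)))"
  shows "ucp (mat_sum J k) S (mat_alg d) \<phi>"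
  unfolding ucp_def
proof (intro conjI allI ballI impI lin)
  show "\<phi> \<one>\<^bsub>mat_sum J k\<^esub> = \<one>\<^bsub>mat_alg d\<^esub>" using one by simp
  fix n X assume "X \<in> matrices_over n S" and pos: "matrix_positive (mat_sum J k) n X"
  then have X: "X p q \<in> S" if "p < n" "q < n" for p q using that by (auto simp: matrices_over_def)
  note cl = star_subspaceD[OF S] and lin = linear_map_onD[OF lin]
  have pos: "psd (block_index n (k j)) (block (\<lambda>p q. X p q j))" if "j \<in> J" for j
    using pos that cl(1)[OF X] by (subst (asm) matrix_positive_mat_sum) auto
  have rot: "accretive (block_index n d) (\<lambda>i i'. c * block (\<lambda>p q. \<phi> (X p q)) i i')"
    if c: "\<And>j. j \<in> J \<Longrightarrow> accretive (block_index n (k j)) (\<lambda>i i'. c * block (\<lambda>p q. X p q j) i i')" for c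
  proof -
    have "accretive (block_index n d) (block (\<lambda>p q. \<phi> (\<lambda>j\<in>J. c \<cdot>\<^sub>m X p q j)))"
    proof (rule acc)
      show "block_accretive J k n (\<lambda>p q. \<lambda>j\<in>J. c \<cdot>\<^sub>m X p q j)"
        unfolding block_accretive_def
      proof
        fix j assume j: "j \<in> J"
        show "accretive (block_index n (k j)) (block (\<lambda>p q. (\<lambda>j\<in>J. c \<cdot>\<^sub>m X p q j) j))"
          using c[OF j] mat_sum_dim[OF cl(1)[OF X] j] j
          by (subst accretive_cong[where H = "\<lambda>i i'. c * block (\<lambda>p q. X p q j) i i'"]) (auto simp: block_def)
      qed
    qed (use cl(4)[OF X] in auto)
    moreover have "dim_row (\<phi> (X p q)) = d" "dim_col (\<phi> (X p q)) = d" if "p < n" "q < n" for p q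
      using lin(1)[OF X[OF that]] by auto
    ultimately show ?thesis using lin(3)[OF X]
      by (subst accretive_cong[where H = "block (\<lambda>p q. \<phi> (\<lambda>j\<in>J. c \<cdot>\<^sub>m X p q j))"]) (auto simp: block_def)
  qed
  have "psd (block_index n d) (block (\<lambda>p q. \<phi> (X p q)))"
    unfolding psd_iff_accretive
    using rot[of 1] rot[of \<i>] rot[of "- \<i>"] pos unfolding psd_iff_accretive by simp
  then show "matrix_positive (mat_alg d) n (\<lambda>p q. \<phi> (X p q))"
    using lin(1)[OF X] by (subst matrix_positive_mat_alg) auto
qed

lemma ucp_projection:
  assumes l: "l \<in> J"
  shows "ucp (mat_sum J k) (carrier (mat_sum J k)) (mat_alg (k l)) (\<lambda>X. X l)"
proof (rule ucpI[OF star_subspace_carrier])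
  show "linear_map_on (mat_sum J k) (carrier (mat_sum J k)) (mat_alg (k l)) (\<lambda>X. X l)"
    using l by (auto simp: linear_map_on_def dest: mat_sum_carrierD)
qed (use l in \<open>auto simp: block_accretive_def\<close>)

section \<open>Arveson's extension theorem\<close>

definition complex_linear_on :: "('i \<Rightarrow> complex) set \<Rightarrow> (('i \<Rightarrow> complex) \<Rightarrow> complex) \<Rightarrow> bool" where
  "complex_linear_on E f \<longleftrightarrow>
     (\<forall>G\<in>E. \<forall>H\<in>E. f (\<lambda>i. G i + H i) = f G + f H) \<and> (\<forall>c. \<forall>G\<in>E. f (\<lambda>i. c * G i) = c * f G)"

definition complex_subspace :: "('i \<Rightarrow> complex) set \<Rightarrow> bool" where
  "complex_subspace E \<longleftrightarrow> (\<lambda>_. 0) \<in> E \<and>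
     (\<forall>G\<in>E. \<forall>H\<in>E. (\<lambda>i. G i + H i) \<in> E) \<and> (\<forall>c. \<forall>G\<in>E. (\<lambda>i. c * G i) \<in> E)"

lemma complex_subspaceD:
  assumes "complex_subspace E"
  shows "G \<in> E \<Longrightarrow> H \<in> E \<Longrightarrow> (\<lambda>i. G i + H i) \<in> E" "G \<in> E \<Longrightarrow> (\<lambda>i. c * G i) \<in> E"
  using assms unfolding complex_subspace_def by blast+

lemma complex_linear_sum:
  assumes E: "complex_subspace E" and f: "complex_linear_on E f" and "finite I" "\<And>i. i \<in> I \<Longrightarrow> G i \<in> E"
  shows "(\<lambda>x. \<Sum>i\<in>I. c i * G i x) \<in> E \<and> f (\<lambda>x. \<Sum>i\<in>I. c i * G i x) = (\<Sum>i\<in>I. c i * f (G i))"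
  using assms(3,4)
proof (induction I rule: finite_induct)
  case empty
  have "f (\<lambda>i. c * G i) = c * f G" if "G \<in> E" for c G
    using f that unfolding complex_linear_on_def by blast
  from this[of "\<lambda>_. 0" 0] show ?case using E by (simp add: complex_subspace_def)
next
  case (insert a I)
  have 1: "(\<lambda>x. c a * G a x) \<in> E" "f (\<lambda>x. c a * G a x) = c a * f (G a)"
    using E f insert.prems unfolding complex_subspace_def complex_linear_on_def by auto
  have 2: "(\<lambda>x. \<Sum>i\<in>I. c i * G i x) \<in> E" "f (\<lambda>x. \<Sum>i\<in>I. c i * G i x) = (\<Sum>i\<in>I. c i * f (G i))"
    using insert.IH insert.prems by auto
  have "(\<lambda>i. H i + H' i) \<in> E" if "H \<in> E" "H' \<in> E" for H H'
    using E that unfolding complex_subspace_def by blast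
  from this[OF 1(1) 2(1)] have "(\<lambda>x. c a * G a x + (\<Sum>i\<in>I. c i * G i x)) \<in> E" .
  moreover have "f (\<lambda>x. c a * G a x + (\<Sum>i\<in>I. c i * G i x)) = c a * f (G a) + (\<Sum>i\<in>I. c i * f (G i))"
  proof -
    have "f (\<lambda>i. H i + H' i) = f H + f H'" if "H \<in> E" "H' \<in> E" for H H'
      using f that unfolding complex_linear_on_def by blast
    from this[OF 1(1) 2(1)] show ?thesis unfolding 1(2) 2(2) .
  qed
  ultimately show ?case using insert.hyps by simp
qed

text \<open>
  The complexification \<open>g G - \<i> g (\<i> G)\<close> of the real functional \<open>g\<close> from \<open>order_unit_functional\<close>.
\<close>

theorem order_unit_complex_functional:
  fixes E :: "('i \<Rightarrow> complex) set"
  assumes E: "complex_subspace E"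
    and K_add: "\<And>G H. G \<in> K \<Longrightarrow> H \<in> K \<Longrightarrow> (\<lambda>i. G i + H i) \<in> K"
    and K_scale: "\<And>r G. (r::real) > 0 \<Longrightarrow> G \<in> K \<Longrightarrow> (\<lambda>i. of_real r * G i) \<in> K"
    and K_zero: "(\<lambda>_. 0) \<in> K"
    and e: "e \<in> E" and unit: "\<And>G. G \<in> E \<Longrightarrow> \<exists>t::real. (\<lambda>i. of_real t * e i - G i) \<in> K"
    and neg: "(\<lambda>i. - e i) \<notin> K"
  shows "\<exists>f. complex_linear_on E f \<and> (\<forall>G\<in>E \<inter> K. 0 \<le> Re (f G)) \<and> Re (f e) = 1"
proof -
  define sc where "sc r G = (\<lambda>i. complex_of_real r * G i)" for r and G :: "'i \<Rightarrow> complex"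
  have vs: "vector_space sc"
    by unfold_locales (auto simp: sc_def fun_eq_iff algebra_simps)
  interpret vector_space sc by (fact vs)
  have plus: "(\<lambda>i. G i + H i) = G + H" for G H :: "'i \<Rightarrow> complex" by (auto simp: fun_eq_iff)
  have zero: "(\<lambda>_. 0) = (0 :: 'i \<Rightarrow> complex)" by (auto simp: fun_eq_iff)
  have cl: "G + H \<in> E" "(\<lambda>i. c * G i) \<in> E" if "G \<in> E" "H \<in> E" for G H c
    using E that unfolding complex_subspace_def plus[symmetric] by auto
  have sub: "subspace E"
    using E cl by (intro subspaceI) (auto simp: complex_subspace_def sc_def zero)
  have "\<exists>g. linear_functional_on sc E g \<and> (\<forall>x\<in>E \<inter> K. 0 \<le> g x) \<and> g e = 1"
  proof (rule order_unit_functional[OF vs sub _ _ _ e])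
    show "\<exists>t. sc t e - G \<in> K" if G: "G \<in> E" for G
    proof -
      obtain t where "(\<lambda>i. of_real t * e i - G i) \<in> K" using unit[OF G] by blast
      moreover have "sc t e - G = (\<lambda>i. of_real t * e i - G i)" by (auto simp: sc_def fun_eq_iff)
      ultimately show ?thesis by metis
    qed
    have "- e = (\<lambda>i. - e i)" by (auto simp: fun_eq_iff)
    then show "- e \<notin> K" using neg by simp
  qed (use K_add K_scale K_zero in \<open>auto simp: plus sc_def zero\<close>)
  then obtain g where g: "linear_functional_on sc E g" "\<And>G. G \<in> E \<Longrightarrow> G \<in> K \<Longrightarrow> 0 \<le> g G" "g e = 1" by blast
  have g_add: "g (G + H) = g G + g H" if "G \<in> E" "H \<in> E" for G H
    using g(1) that unfolding linear_functional_on_def by blast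
  have g_sc: "g (sc r G) = r * g G" if "G \<in> E" for r G
    using g(1) that unfolding linear_functional_on_def by blast
  define f where "f G = Complex (g G) (- g (\<lambda>i. \<i> * G i))" for G
  have f_add: "f (G + H) = f G + f H" if "G \<in> E" "H \<in> E" for G H
  proof -
    have "(\<lambda>i. \<i> * (G + H) i) = (\<lambda>i. \<i> * G i) + (\<lambda>i. \<i> * H i)" by (auto simp: fun_eq_iff algebra_simps)
    then show ?thesis unfolding f_def using g_add that cl by (simp add: complex_eq_iff)
  qed
  have f_scale: "f (\<lambda>i. c * G i) = c * f G" if G: "G \<in> E" for c G
  proof -
    have iG: "(\<lambda>i. \<i> * G i) \<in> E" using cl(2)[OF G G] .
    have 1: "(\<lambda>i. c * G i) = sc (Re c) G + sc (Im c) (\<lambda>i. \<i> * G i)"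
      by (auto simp: fun_eq_iff sc_def complex_eq_iff)
    have 2: "(\<lambda>i. \<i> * (c * G i)) = sc (Re c) (\<lambda>i. \<i> * G i) + sc (- Im c) G"
      by (auto simp: fun_eq_iff sc_def complex_eq_iff)
    have "g (\<lambda>i. c * G i) = Re c * g G + Im c * g (\<lambda>i. \<i> * G i)"
      unfolding 1 using g_add[OF subspace_scale[OF sub G] subspace_scale[OF sub iG]] g_sc[OF G] g_sc[OF iG] by metis
    moreover have "g (\<lambda>i. \<i> * (c * G i)) = Re c * g (\<lambda>i. \<i> * G i) + (- Im c) * g G"
      unfolding 2 using g_add[OF subspace_scale[OF sub iG] subspace_scale[OF sub G]] g_sc[OF G] g_sc[OF iG] by metis
    ultimately show ?thesis
      unfolding f_def by (simp add: complex_eq_iff)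
  qed
  have "complex_linear_on E f" unfolding complex_linear_on_def plus using f_add f_scale by blast
  moreover have "Re (f G) = g G" for G by (simp add: f_def)
  ultimately show ?thesis using g(2,3) by (intro exI[of _ f]) auto
qed

lemma accretive_add: "accretive I G \<Longrightarrow> accretive I H \<Longrightarrow> accretive I (\<lambda>i j. G i j + H i j)"
  unfolding accretive_def qform_add by simp

lemma accretive_scale: "accretive I G \<Longrightarrow> 0 \<le> r \<Longrightarrow> accretive I (\<lambda>i j. of_real r * G i j)"
  unfolding accretive_def qform_scale by simp

lemma sum_block_sq: "(\<Sum>i\<in>block_index n d. (cmod (v i))\<^sup>2) = (\<Sum>p<n. (l2 d (\<lambda>a. v (p, a)))\<^sup>2)"
  by (simp add: sum_block_index l2_sq)

text \<open>
  The bound is uniform over the blocks of a bounded family, in contrast to the entrywise bound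
  \<open>qform_bound\<close>, which grows with \<open>d\<close>.
\<close>

lemma qform_block_bound:
  assumes "\<And>p q. p < n \<Longrightarrow> q < n \<Longrightarrow> op_bounded d (X p q) C" "0 \<le> C"
  shows "cmod (qform (block_index n d) (block X) v) \<le> (real n)\<^sup>2 * C * (\<Sum>i\<in>block_index n d. (cmod (v i))\<^sup>2)"
proof -
  let ?l = "\<lambda>p. l2 d (\<lambda>a. v (p, a))"
  let ?N = "\<Sum>p<n. (?l p)\<^sup>2"
  have le: "(?l p)\<^sup>2 \<le> ?N" if "p < n" for p
    using that member_le_sum[of p "{..<n}" "\<lambda>p. (?l p)\<^sup>2"] by simp
  have "cmod (sform d (X p q) (\<lambda>a. v (p, a)) (\<lambda>b. v (q, b))) \<le> C * ?N" if pq: "p < n" "q < n" for p q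
  proof -
    have "2 * (?l p * ?l q) \<le> (?l p)\<^sup>2 + (?l q)\<^sup>2" using sum_squares_bound[of "?l p" "?l q"] by simp
    then have "?l p * ?l q \<le> ?N" using le[OF pq(1)] le[OF pq(2)] by linarith
    then have "C * (?l p * ?l q) \<le> C * ?N" using assms(2) by (intro mult_left_mono)
    then show ?thesis using op_boundedD[OF assms(1)[OF pq], of "\<lambda>a. v (p, a)" "\<lambda>b. v (q, b)"] by (simp add: mult.assoc)
  qed
  then have "cmod (qform (block_index n d) (block X) v) \<le> (\<Sum>p<n. \<Sum>q<n. C * ?N)"
    unfolding qform_block by (intro order_trans[OF norm_sum] sum_mono) auto
  also have "\<dots> = (real n)\<^sup>2 * C * ?N" by (simp add: power2_eq_square)
  finally show ?thesis unfolding sum_block_sq .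
qed

text \<open>
  A map \<open>\<phi>\<close> into \<open>M\<^sub>d\<close> corresponds to the functional \<open>\<sigma>\<close> on \<open>M\<^sub>d(S)\<close> that sends a matrix \<open>(x\<^sub>p\<^sub>q)\<close> to the sum of the
  scalars \<open>\<phi>(x\<^sub>p\<^sub>q)\<^sub>p\<^sub>q\<close>, and \<open>\<sigma>\<close> is positive when \<open>\<phi>\<close> is completely positive.  A positive functional on
  \<open>M\<^sub>d(A)\<close> that extends \<open>\<sigma>\<close> is obtained from the cone \<open>K\<close> of all elements that dominate some \<open>H\<close> in \<open>M\<^sub>d(S)\<close> with
  \<open>Re \<sigma>(H) \<ge> 0\<close>: a functional that is nonnegative on \<open>K\<close> is proportional to \<open>\<sigma>\<close> on \<open>M\<^sub>d(S)\<close>.  The factor \<open>d\<close>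
  below is the value of \<open>\<sigma>\<close> at the unit.  Reading off the values of the functional on the elements with a
  single nonzero entry gives the map \<open>\<psi>\<close>.
\<close>

theorem arveson_extension:
  assumes \<phi>: "ucp (mat_sum J k) S (mat_alg d) \<phi>" and S: "star_subspace J k S" and d: "d > 0"
  shows "\<exists>\<psi>. ucp (mat_sum J k) (carrier (mat_sum J k)) (mat_alg d) \<psi> \<and> (\<forall>x\<in>S. \<psi> x = \<phi> x)"
proof -
  let ?A = "carrier (mat_sum J k)"
  note cl = star_subspaceD[OF S] and lin = linear_map_onD[OF ucpD(1)[OF \<phi>]]
  have zero_S: "(\<lambda>j\<in>J. 0\<^sub>m (k j) (k j)) \<in> S" and \<phi>_zero: "\<phi> (\<lambda>j\<in>J. 0\<^sub>m (k j) (k j)) = 0\<^sub>m d d"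
  proof -
    have "(\<lambda>j\<in>J. 0 \<cdot>\<^sub>m (\<lambda>j\<in>J. 1\<^sub>m (k j)) j) = (\<lambda>j\<in>J. 0\<^sub>m (k j) (k j) :: complex mat)"
      by (auto intro!: restrict_ext eq_matI)
    then show "(\<lambda>j\<in>J. 0\<^sub>m (k j) (k j)) \<in> S" "\<phi> (\<lambda>j\<in>J. 0\<^sub>m (k j) (k j)) = 0\<^sub>m d d"
      using cl(4)[OF cl(2), of 0] lin(3)[OF cl(2), of 0] lin(1)[OF cl(2)] by (auto intro!: eq_matI)
  qed
  \<comment> \<open>\<open>G\<close> encodes the element of \<open>M\<^sub>d(A)\<close> whose \<open>(p, q)\<close> entry is \<open>mk G p q\<close>.\<close>
  define mk where "mk G p q = (\<lambda>j\<in>J. mat (k j) (k j) (\<lambda>(a, b). G (j, (p, a), (q, b))))"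
    for G :: "nat \<times> (nat \<times> nat) \<times> (nat \<times> nat) \<Rightarrow> complex" and p q
  have mk_add: "mk (\<lambda>i. G i + H i) p q = (\<lambda>j\<in>J. mk G p q j + mk H p q j)" for G H p q
    by (auto simp: mk_def intro!: restrict_ext eq_matI)
  have mk_scale: "mk (\<lambda>i. c * G i) p q = (\<lambda>j\<in>J. c \<cdot>\<^sub>m mk G p q j)" for c G p q
    by (auto simp: mk_def intro!: restrict_ext eq_matI)
  have mk_zero: "mk (\<lambda>_. 0) p q = (\<lambda>j\<in>J. 0\<^sub>m (k j) (k j))" for p q
    by (auto simp: mk_def intro!: restrict_ext eq_matI)
  define E where "E = {G. \<forall>p<d. \<forall>q<d. mk G p q \<in> ?A}"
  define U where "U = {G. \<forall>p<d. \<forall>q<d. mk G p q \<in> S}"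
  have E: "complex_subspace E" and U: "complex_subspace U"
    unfolding complex_subspace_def E_def U_def
    using zero_S cl(3,4) mat_sum_closed by (auto simp: mk_add mk_scale mk_zero)
  have UE: "U \<subseteq> E" unfolding U_def E_def using cl(1) by blast
  define \<sigma> where "\<sigma> G = (\<Sum>p<d. \<Sum>q<d. \<phi> (mk G p q) $$ (p, q))" for G
  have \<phi>_dim: "dim_row (\<phi> (mk G p q)) = d" "dim_col (\<phi> (mk G p q)) = d" if "G \<in> U" "p < d" "q < d" for G p q
    using that lin(1) unfolding U_def by auto
  have \<sigma>_add: "\<sigma> (\<lambda>i. G i + H i) = \<sigma> G + \<sigma> H" if "G \<in> U" "H \<in> U" for G H
  proof -
    have "\<phi> (mk (\<lambda>i. G i + H i) p q) $$ (p, q) = \<phi> (mk G p q) $$ (p, q) + \<phi> (mk H p q) $$ (p, q)"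
      if "p < d" "q < d" for p q
      unfolding mk_add using lin(2)[of "mk G p q" "mk H p q"] \<phi>_dim[OF _ that] that \<open>G \<in> U\<close> \<open>H \<in> U\<close>
      by (auto simp: U_def)
    then show ?thesis by (simp add: \<sigma>_def sum.distrib)
  qed
  have \<sigma>_scale: "\<sigma> (\<lambda>i. c * G i) = c * \<sigma> G" if "G \<in> U" for c G
  proof -
    have "\<phi> (mk (\<lambda>i. c * G i) p q) $$ (p, q) = c * \<phi> (mk G p q) $$ (p, q)" if "p < d" "q < d" for p q
      unfolding mk_scale using lin(3)[of "mk G p q"] \<phi>_dim[OF _ that] that \<open>G \<in> U\<close>
      by (auto simp: U_def)
    then show ?thesis by (simp add: \<sigma>_def sum_distrib_left)
  qed
  define P where "P G \<longleftrightarrow> block_accretive J k d (mk G)" for G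
  have P_iff: "P G \<longleftrightarrow> (\<forall>j\<in>J. accretive (block_index d (k j)) (\<lambda>i i'. G (j, i, i')))" for G
    unfolding P_def block_accretive_def
    by (intro ball_cong refl accretive_cong) (auto simp: block_def mk_def)
  have \<sigma>_pos: "0 \<le> Re (\<sigma> G)" if G: "G \<in> U" "P G" for G
  proof -
    have "accretive (block_index d d) (block (\<lambda>p q. \<phi> (mk G p q)))"
      using ucp_accretive[OF \<phi> S, of d "mk G"] G unfolding U_def P_def by auto
    then have "0 \<le> Re (qform (block_index d d) (block (\<lambda>p q. \<phi> (mk G p q))) (\<lambda>(p, a). if p = a then 1 else 0))"
      unfolding accretive_def by blast
    moreover have "sform d X (\<lambda>a. if p = a then 1 else 0) (\<lambda>a. if q = a then 1 else 0) = X $$ (p, q)"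
      if "p < d" "q < d" for X p q
    proof -
      have "(\<lambda>a. if p = a then 1 else 0 :: complex) = (\<lambda>_. 0)(p := 1)" for p :: nat by auto
      then show ?thesis using sform_unit[OF that, of X 1 1] by simp
    qed
    ultimately show ?thesis unfolding qform_block \<sigma>_def by simp
  qed
  define e where "e = (\<lambda>(j :: nat, i :: nat \<times> nat, i' :: nat \<times> nat). if i = i' then 1 else 0 :: complex)"
  have mk_e: "mk e p q = (if p = q then (\<lambda>j\<in>J. 1\<^sub>m (k j)) else (\<lambda>j\<in>J. 0\<^sub>m (k j) (k j)))" for p q
    by (auto simp: mk_def e_def intro!: restrict_ext eq_matI)
  have eU: "e \<in> U" unfolding U_def using cl(2) zero_S by (simp add: mk_e)
  have \<sigma>_e: "\<sigma> e = of_nat d"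
    unfolding \<sigma>_def mk_e using ucpD(2)[OF \<phi>] \<phi>_zero by (simp add: if_distrib if_distribR cong: if_cong)
  have qform_e: "qform (block_index d (k j)) (\<lambda>i i'. e (j, i, i')) v = of_real (\<Sum>i\<in>block_index d (k j). (cmod (v i))\<^sup>2)"
    for j v
    unfolding qform_def of_real_sum complex_norm_square
    by (intro sum.cong refl) (simp add: e_def if_distrib if_distribR mult.commute cong: if_cong)
  define K where "K = {G \<in> E. \<exists>H\<in>U. P (\<lambda>i. G i - H i) \<and> 0 \<le> Re (\<sigma> H)}"
  have P_zero: "P (\<lambda>i. 0)" unfolding P_iff accretive_def qform_def by simp
  have P_in_K: "G \<in> K" if "G \<in> E" "P G" for G
  proof -
    have "(\<lambda>i. 0) \<in> U" using U by (simp add: complex_subspace_def)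
    moreover have "\<sigma> (\<lambda>i. 0) = 0" using \<sigma>_scale[OF eU, of 0] by simp
    ultimately show ?thesis unfolding K_def using that by (auto intro!: bexI[of _ "\<lambda>i. 0"])
  qed
  have U_in_K: "G \<in> K" if "G \<in> U" "0 \<le> Re (\<sigma> G)" for G
    unfolding K_def using that UE P_zero by (auto intro!: bexI[of _ G])
  have "\<exists>f. complex_linear_on E f \<and> (\<forall>G\<in>E \<inter> K. 0 \<le> Re (f G)) \<and> Re (f e) = 1"
  proof (rule order_unit_complex_functional[OF E])
    show "(\<lambda>i. G i + H i) \<in> K" if GH: "G \<in> K" "H \<in> K" for G H
    proof -
      obtain G' H' where G': "G' \<in> U" "P (\<lambda>i. G i - G' i)" "0 \<le> Re (\<sigma> G')"
        and H': "H' \<in> U" "P (\<lambda>i. H i - H' i)" "0 \<le> Re (\<sigma> H')" using GH unfolding K_def by blast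
      have "P (\<lambda>i. (G i - G' i) + (H i - H' i))"
        using G'(2) H'(2) unfolding P_iff by (auto intro: accretive_add)
      then have "P (\<lambda>i. (G i + H i) - (G' i + H' i))" by (simp add: algebra_simps)
      moreover have "(\<lambda>i. G' i + H' i) \<in> U" "(\<lambda>i. G i + H i) \<in> E"
        using U E G' H' GH unfolding complex_subspace_def K_def by auto
      ultimately show ?thesis
        unfolding K_def using \<sigma>_add[OF G'(1) H'(1)] G'(3) H'(3) by (auto intro!: bexI[of _ "\<lambda>i. G' i + H' i"])
    qed
    show "(\<lambda>i. of_real r * G i) \<in> K" if r: "r > 0" and G: "G \<in> K" for r :: real and G
    proof -
      obtain H where H: "H \<in> U" "P (\<lambda>i. G i - H i)" "0 \<le> Re (\<sigma> H)" using G unfolding K_def by blast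
      have "P (\<lambda>i. of_real r * (G i - H i))"
        using H(2) r unfolding P_iff by (auto intro!: accretive_scale)
      then have "P (\<lambda>i. of_real r * G i - of_real r * H i)" by (simp add: algebra_simps)
      moreover have "(\<lambda>i. of_real r * H i) \<in> U" "(\<lambda>i. of_real r * G i) \<in> E"
        using U E H G unfolding complex_subspace_def K_def by auto
      ultimately show ?thesis
        unfolding K_def using \<sigma>_scale[OF H(1), of "of_real r"] H(3) r by (auto intro!: bexI[of _ "\<lambda>i. of_real r * H i"])
    qed
    show "(\<lambda>_. 0) \<in> K" using P_in_K P_zero E by (auto simp: complex_subspace_def)
    show "e \<in> E" using eU UE by blast
    show "\<exists>t::real. (\<lambda>i. of_real t * e i - G i) \<in> K" if G: "G \<in> E" for G
    proof -
      define C where "C p q = nrm (mat_sum J k) (mk G p q)" for p q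
      have C: "C p q \<ge> 0" "\<And>j. j \<in> J \<Longrightarrow> op_bounded (k j) (mk G p q j) (C p q)" if "p < d" "q < d" for p q
        using G that mat_sum_nrm_bound[of "mk G p q" J k] unfolding E_def C_def by auto
      define D where "D = (\<Sum>p<d. \<Sum>q<d. C p q)"
      have CD: "C p q \<le> D" if "p < d" "q < d" for p q
      proof -
        have "C p q \<le> (\<Sum>q<d. C p q)" using that C(1) by (intro member_le_sum) auto
        also have "\<dots> \<le> D" unfolding D_def using that C(1)
          by (intro member_le_sum[of p "{..<d}" "\<lambda>p. \<Sum>q<d. C p q"] sum_nonneg) auto
        finally show ?thesis .
      qed
      have D: "D \<ge> 0" unfolding D_def using C(1) by (auto intro!: sum_nonneg)
      define t where "t = (real d)\<^sup>2 * D"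
      have "P (\<lambda>i. of_real t * e i - G i)"
        unfolding P_iff accretive_def
      proof (intro ballI allI)
        fix j v assume j: "j \<in> J"
        let ?N = "\<Sum>i\<in>block_index d (k j). (cmod (v i))\<^sup>2"
        have "op_bounded (k j) (mk G p q j) D" if "p < d" "q < d" for p q
          using C(2)[OF that j] CD[OF that] op_bounded_mono by blast
        then have "cmod (qform (block_index d (k j)) (block (\<lambda>p q. mk G p q j)) v) \<le> t * ?N"
          unfolding t_def using D by (intro qform_block_bound) auto
        moreover have "qform (block_index d (k j)) (block (\<lambda>p q. mk G p q j)) v =
           qform (block_index d (k j)) (\<lambda>i i'. G (j, i, i')) v"
          using j by (intro qform_cong) (auto simp: block_def mk_def)
        ultimately have "Re (qform (block_index d (k j)) (\<lambda>i i'. G (j, i, i')) v) \<le> t * ?N"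
          using order_trans[OF complex_Re_le_cmod[of "qform (block_index d (k j)) (block (\<lambda>p q. mk G p q j)) v"]] by simp
        then show "0 \<le> Re (qform (block_index d (k j)) (\<lambda>i i'. of_real t * e (j, i, i') - G (j, i, i')) v)"
          unfolding qform_diff qform_scale qform_e by (simp flip: of_real_mult)
      qed
      moreover have "(\<lambda>i. of_real t * e i + (- 1) * G i) \<in> E"
        using complex_subspaceD(1)[OF E complex_subspaceD(2)[OF E] complex_subspaceD(2)[OF E G]] eU UE by blast
      ultimately show ?thesis using P_in_K by auto
    qed
    show "(\<lambda>i. - e i) \<notin> K"
    proof
      assume "(\<lambda>i. - e i) \<in> K"
      then obtain H where H: "H \<in> U" "P (\<lambda>i. - e i - H i)" "0 \<le> Re (\<sigma> H)" unfolding K_def by blast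
      have eH: "(\<lambda>i. e i + H i) \<in> U" using U eU H(1) by (simp add: complex_subspace_def)
      have "(\<lambda>i. (- 1) * (e i + H i)) \<in> U" by (rule complex_subspaceD(2)[OF U eH])
      moreover have "(\<lambda>i. - e i - H i) = (\<lambda>i. (- 1) * (e i + H i))" by auto
      ultimately have "0 \<le> Re (\<sigma> (\<lambda>i. (- 1) * (e i + H i)))" using \<sigma>_pos H(2) by metis
      then show False using \<sigma>_scale[OF eH, of "- 1"] \<sigma>_add[OF eU H(1)] \<sigma>_e H(3) d by simp
    qed
  qed
  then obtain f where f: "complex_linear_on E f" and f_pos: "\<And>G. G \<in> E \<Longrightarrow> G \<in> K \<Longrightarrow> 0 \<le> Re (f G)"
    and f_e: "Re (f e) = 1" by blast
  have f_add: "f (\<lambda>i. G i + H i) = f G + f H" if "G \<in> E" "H \<in> E" for G H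
    using f that unfolding complex_linear_on_def by blast
  have f_scale: "f (\<lambda>i. c * G i) = c * f G" if "G \<in> E" for c G
    using f that unfolding complex_linear_on_def by blast
  have Re_f: "of_nat d * Re (f H) = Re (\<sigma> H)" if H: "H \<in> U" for H
  proof -
    define s where "s = Re (\<sigma> H) / d"
    have e': "(\<lambda>i. (- of_real s) * e i) \<in> U" by (rule complex_subspaceD(2)[OF U eU])
    \<comment> \<open>The value of \<open>\<sigma>\<close> at \<open>H'\<close> has real part \<open>0\<close>, so both \<open>H'\<close> and its negative lie in the cone.\<close>
    define H' where "H' = (\<lambda>i. H i + (- of_real s) * e i)"
    have H': "H' \<in> U" unfolding H'_def by (rule complex_subspaceD(1)[OF U H e'])
    have nH': "(\<lambda>i. (- 1) * H' i) \<in> U" by (rule complex_subspaceD(2)[OF U H'])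
    have "Re (\<sigma> H') = 0"
      unfolding H'_def using \<sigma>_add[OF H e'] \<sigma>_scale[OF eU, of "- of_real s"] \<sigma>_e d by (simp add: s_def)
    then have "0 \<le> Re (f H')" "0 \<le> Re (f (\<lambda>i. (- 1) * H' i))"
      using f_pos U_in_K H' nH' UE \<sigma>_scale[OF H', of "- 1"] by auto
    then have "Re (f H') = 0" using f_scale[of H' "- 1"] H' UE by auto
    moreover have "f H' = f H + (- of_real s) * f e"
      unfolding H'_def f_add[OF subsetD[OF UE H] subsetD[OF UE e']] f_scale[OF subsetD[OF UE eU]] ..
    ultimately have "Re (f H) = s" using f_e by simp
    then show ?thesis using d by (simp add: s_def)
  qed
  have f_\<sigma>: "of_nat d * f H = \<sigma> H" if H: "H \<in> U" for H
  proof -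
    have "(\<lambda>i. \<i> * H i) \<in> U" by (rule complex_subspaceD(2)[OF U H])
    from Re_f[OF this] Re_f[OF H] show ?thesis
      using f_scale[of H \<i>] \<sigma>_scale[OF H, of \<i>] H UE by (auto simp: complex_eq_iff)
  qed
  define emb where "emb x p q = (\<lambda>(j, i, i'). if fst i = p \<and> fst i' = q \<and> j \<in> J \<and> snd i < k j \<and> snd i' < k j
     then x j $$ (snd i, snd i') else 0)" for x :: "nat \<Rightarrow> complex mat" and p q :: nat
  have mk_emb: "mk (emb x p q) p' q' = (if p' = p \<and> q' = q then x else (\<lambda>j\<in>J. 0\<^sub>m (k j) (k j)))"
    if "x \<in> ?A" for x p q p' q'
  proof (cases "p' = p \<and> q' = q")
    case True
    then show ?thesis using mat_sum_dim[OF that] mat_sum_extensional[OF that]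
      by (auto simp: mk_def emb_def intro!: extensionalityI[of _ J] eq_matI)
  next
    case False
    then show ?thesis by (auto simp: mk_def emb_def intro!: restrict_ext eq_matI)
  qed
  have emb_E: "emb x p q \<in> E" if "x \<in> ?A" for x p q
    unfolding E_def using mk_emb[OF that] that mat_sum_zero_closed by auto
  have emb_add: "emb (\<lambda>j\<in>J. x j + y j) p q = (\<lambda>i. emb x p q i + emb y p q i)" if "x \<in> ?A" "y \<in> ?A" for x y p q
    using mat_sum_dim[OF that(1)] mat_sum_dim[OF that(2)] by (auto simp: emb_def fun_eq_iff)
  have emb_scale: "emb (\<lambda>j\<in>J. c \<cdot>\<^sub>m x j) p q = (\<lambda>i. c * emb x p q i)" if "x \<in> ?A" for c x p q
    using mat_sum_dim[OF that(1)] by (auto simp: emb_def fun_eq_iff)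
  define \<psi> where "\<psi> x = mat d d (\<lambda>(p, q). of_nat d * f (emb x p q))" for x
  have \<psi>S: "\<psi> x = \<phi> x" if x: "x \<in> S" for x
  proof (rule eq_matI)
    have c: "\<phi> x \<in> carrier_mat d d" using lin(1)[OF x] .
    then show "dim_row (\<psi> x) = dim_row (\<phi> x)" "dim_col (\<psi> x) = dim_col (\<phi> x)" by (auto simp: \<psi>_def)
    fix p q assume "p < dim_row (\<phi> x)" "q < dim_col (\<phi> x)"
    then have pq: "p < d" "q < d" using c by auto
    have "emb x p q \<in> U" unfolding U_def using mk_emb[OF cl(1)[OF x]] x zero_S by auto
    then have "of_nat d * f (emb x p q) = \<sigma> (emb x p q)" by (rule f_\<sigma>)
    also have "\<dots> = (\<Sum>p'<d. \<Sum>q'<d. if p' = p \<and> q' = q then \<phi> x $$ (p, q) else 0)"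
      unfolding \<sigma>_def mk_emb[OF cl(1)[OF x]] using \<phi>_zero by (intro sum.cong refl) auto
    also have "\<dots> = (\<Sum>p'<d. if p' = p then \<phi> x $$ (p, q) else 0)"
      using pq by (intro sum.cong refl) auto
    also have "\<dots> = \<phi> x $$ (p, q)" using pq by simp
    finally show "\<psi> x $$ (p, q) = \<phi> x $$ (p, q)" using pq by (simp add: \<psi>_def)
  qed
  have "ucp (mat_sum J k) ?A (mat_alg d) \<psi>"
  proof (rule ucpI[OF star_subspace_carrier])
    show "linear_map_on (mat_sum J k) ?A (mat_alg d) \<psi>"
      unfolding linear_map_on_def using emb_add emb_scale f_add f_scale emb_E
      by (auto simp: \<psi>_def algebra_simps intro!: eq_matI)
    show "\<psi> (\<lambda>j\<in>J. 1\<^sub>m (k j)) = 1\<^sub>m d" using \<psi>S[OF cl(2)] ucpD(2)[OF \<phi>] by simp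
    fix n X assume X: "\<And>p q. p < n \<Longrightarrow> q < n \<Longrightarrow> X p q \<in> ?A" and acc: "block_accretive J k n X"
    show "accretive (block_index n d) (block (\<lambda>p q. \<psi> (X p q)))"
      unfolding accretive_def
    proof
      fix v :: "nat \<times> nat \<Rightarrow> complex"
      let ?R = "block_index n d"
      define c where "c ii = cnj (v (fst ii)) * v (snd ii)" for ii
      define G where "G ii = emb (X (fst (fst ii)) (fst (snd ii))) (snd (fst ii)) (snd (snd ii))" for ii
      define H where "H = (\<lambda>x. \<Sum>ii\<in>?R \<times> ?R. c ii * G ii x)"
      have "G ii \<in> E" if "ii \<in> ?R \<times> ?R" for ii
        unfolding G_def using that by (intro emb_E X) auto
      from complex_linear_sum[OF E f _ this, of "?R \<times> ?R" "\<lambda>ii. ii" c]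
      have H: "H \<in> E" "f H = (\<Sum>ii\<in>?R \<times> ?R. c ii * f (G ii))" unfolding H_def by auto
      have "qform ?R (block (\<lambda>p q. \<psi> (X p q))) v = (\<Sum>i\<in>?R. \<Sum>i'\<in>?R. of_nat d * (c (i, i') * f (G (i, i'))))"
        unfolding qform_def by (intro sum.cong refl) (auto simp: block_def \<psi>_def c_def G_def)
      also have "\<dots> = of_nat d * f H"
        unfolding H(2) sum.cartesian_product by (simp add: sum_distrib_left case_prod_beta)
      finally have q: "qform ?R (block (\<lambda>p q. \<psi> (X p q))) v = of_nat d * f H" .
      have H_eq: "H (j, (p, a), (q, b)) = (\<Sum>r<n. \<Sum>s<n. cnj (v (r, p)) * X r s j $$ (a, b) * v (s, q))"
        if "j \<in> J" "p < d" "q < d" "a < k j" "b < k j" for j p a q b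
      proof -
        have "H (j, (p, a), (q, b)) = (\<Sum>i\<in>?R. \<Sum>i'\<in>?R. c (i, i') * G (i, i') (j, (p, a), (q, b)))"
          unfolding H_def sum.cartesian_product by (simp add: case_prod_beta)
        also have "\<dots> = (\<Sum>r<n. \<Sum>p'<d. \<Sum>s<n. \<Sum>q'<d.
            if p' = p \<and> q' = q then cnj (v (r, p)) * X r s j $$ (a, b) * v (s, q) else 0)"
          unfolding sum_block_index using that
          by (intro sum.cong refl) (auto simp: c_def G_def emb_def)
        also have "\<dots> = (\<Sum>r<n. \<Sum>p'<d. \<Sum>s<n. if p' = p then cnj (v (r, p)) * X r s j $$ (a, b) * v (s, q) else 0)"
          using that by (intro sum.cong refl) auto
        also have "\<dots> = (\<Sum>r<n. \<Sum>p'<d. if p' = p then \<Sum>s<n. cnj (v (r, p)) * X r s j $$ (a, b) * v (s, q) else 0)"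
          by (intro sum.cong refl) auto
        finally show ?thesis using that by simp
      qed
      have "P H" unfolding P_iff accretive_def
      proof (intro ballI allI)
        fix j and w :: "nat \<times> nat \<Rightarrow> complex" assume j: "j \<in> J"
        define u where "u = (\<lambda>(s, b). \<Sum>q<d. v (s, q) * w (q, b))"
        define F where "F p a q b r s = cnj (v (r, p) * w (p, a)) * X r s j $$ (a, b) * (v (s, q) * w (q, b))"
          for p a q b r s
        have "qform (block_index d (k j)) (\<lambda>i i'. H (j, i, i')) w = (\<Sum>p<d. \<Sum>a<k j. \<Sum>q<d. \<Sum>b<k j. \<Sum>r<n. \<Sum>s<n. F p a q b r s)"
          unfolding qform_def sum_block_index using H_eq[OF j]
          by (intro sum.cong refl) (auto simp: F_def sum_distrib_left sum_distrib_right mult_ac intro!: sum.cong)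
        also have "\<dots> = (\<Sum>p<d. \<Sum>a<k j. \<Sum>q<d. \<Sum>r<n. \<Sum>b<k j. \<Sum>s<n. F p a q b r s)"
          by (intro sum.cong refl sum.swap)
        also have "\<dots> = (\<Sum>p<d. \<Sum>a<k j. \<Sum>r<n. \<Sum>q<d. \<Sum>b<k j. \<Sum>s<n. F p a q b r s)"
          by (intro sum.cong refl sum.swap)
        also have "\<dots> = (\<Sum>p<d. \<Sum>r<n. \<Sum>a<k j. \<Sum>q<d. \<Sum>b<k j. \<Sum>s<n. F p a q b r s)"
          by (intro sum.cong refl sum.swap)
        also have "\<dots> = (\<Sum>r<n. \<Sum>p<d. \<Sum>a<k j. \<Sum>q<d. \<Sum>b<k j. \<Sum>s<n. F p a q b r s)"
          by (intro sum.cong refl sum.swap)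
        also have "\<dots> = (\<Sum>r<n. \<Sum>p<d. \<Sum>a<k j. \<Sum>q<d. \<Sum>s<n. \<Sum>b<k j. F p a q b r s)"
          by (intro sum.cong refl sum.swap)
        also have "\<dots> = (\<Sum>r<n. \<Sum>p<d. \<Sum>a<k j. \<Sum>s<n. \<Sum>q<d. \<Sum>b<k j. F p a q b r s)"
          by (intro sum.cong refl sum.swap)
        also have "\<dots> = (\<Sum>r<n. \<Sum>p<d. \<Sum>a<k j. \<Sum>s<n. \<Sum>b<k j. \<Sum>q<d. F p a q b r s)"
          by (intro sum.cong refl sum.swap)
        also have "\<dots> = (\<Sum>r<n. \<Sum>a<k j. \<Sum>p<d. \<Sum>s<n. \<Sum>b<k j. \<Sum>q<d. F p a q b r s)"
          by (intro sum.cong refl sum.swap)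
        also have "\<dots> = (\<Sum>r<n. \<Sum>a<k j. \<Sum>s<n. \<Sum>p<d. \<Sum>b<k j. \<Sum>q<d. F p a q b r s)"
          by (intro sum.cong refl sum.swap)
        also have "\<dots> = (\<Sum>r<n. \<Sum>a<k j. \<Sum>s<n. \<Sum>b<k j. \<Sum>p<d. \<Sum>q<d. F p a q b r s)"
          by (intro sum.cong refl sum.swap)
        also have "\<dots> = qform (block_index n (k j)) (block (\<lambda>p q. X p q j)) u"
          unfolding qform_def sum_block_index u_def block_def F_def
          by (simp add: sum_distrib_left sum_distrib_right mult_ac)
        finally show "0 \<le> Re (qform (block_index d (k j)) (\<lambda>i i'. H (j, i, i')) w)"
          using acc j unfolding block_accretive_def accretive_def by simp
      qed
      then have "0 \<le> Re (f H)" using f_pos P_in_K H(1) by blast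
      then show "0 \<le> Re (qform ?R (block (\<lambda>p q. \<psi> (X p q))) v)" unfolding q by simp
    qed
  qed
  then show ?thesis using \<psi>S by blast
qed

section \<open>Deleting a block\<close>

lemma ucp_restrict:
  assumes \<psi>: "ucp (mat_sum J' k) (carrier (mat_sum J' k)) (mat_alg d) \<psi>" and J': "J' \<subseteq> J"
  shows "ucp (mat_sum J k) (carrier (mat_sum J k)) (mat_alg d) (\<lambda>X. \<psi> (restrict X J'))"
proof (rule ucpI[OF star_subspace_carrier])
  note lin = linear_map_onD[OF ucpD(1)[OF \<psi>]]
  have res: "restrict X J' \<in> carrier (mat_sum J' k)" if "X \<in> carrier (mat_sum J k)" for X
    using mat_sum_restrict_closed[OF that J'] .
  have eqs: "restrict (\<lambda>j\<in>J. X j + Y j) J' = (\<lambda>j\<in>J'. restrict X J' j + restrict Y J' j)"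
    "restrict (\<lambda>j\<in>J. c \<cdot>\<^sub>m X j) J' = (\<lambda>j\<in>J'. c \<cdot>\<^sub>m restrict X J' j)" for c and X Y :: "nat \<Rightarrow> complex mat"
    using J' by (auto simp: restrict_def fun_eq_iff)
  have "\<psi> (restrict (\<lambda>j\<in>J. X j + Y j) J') = \<psi> (restrict X J') + \<psi> (restrict Y J')"
    if "X \<in> carrier (mat_sum J k)" "Y \<in> carrier (mat_sum J k)" for X Y
    unfolding eqs by (rule lin(2)[OF res[OF that(1)] res[OF that(2)]])
  moreover have "\<psi> (restrict (\<lambda>j\<in>J. c \<cdot>\<^sub>m X j) J') = c \<cdot>\<^sub>m \<psi> (restrict X J')"
    if "X \<in> carrier (mat_sum J k)" for c X
    unfolding eqs by (rule lin(3)[OF res[OF that]])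
  ultimately show "linear_map_on (mat_sum J k) (carrier (mat_sum J k)) (mat_alg d) (\<lambda>X. \<psi> (restrict X J'))"
    unfolding linear_map_on_def mat_sum_simps mat_alg_simps using lin(1) res by blast
  have "restrict (\<lambda>j\<in>J. 1\<^sub>m (k j)) J' = (\<lambda>j\<in>J'. 1\<^sub>m (k j) :: complex mat)"
    using J' by (auto simp: restrict_def fun_eq_iff)
  then show "\<psi> (restrict (\<lambda>j\<in>J. 1\<^sub>m (k j)) J') = 1\<^sub>m d" using ucpD(2)[OF \<psi>] by simp
  fix n X assume "\<And>p q. p < n \<Longrightarrow> q < n \<Longrightarrow> X p q \<in> carrier (mat_sum J k)" "block_accretive J k n X"
  then show "accretive (block_index n d) (block (\<lambda>p q. \<psi> (restrict (X p q) J')))"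
    using res J' by (intro ucp_accretive[OF \<psi> star_subspace_carrier]) (auto simp: block_accretive_def)
qed

lemma op_sys_restrict:
  assumes J': "J' \<subseteq> J" and x: "x \<in> op_sys (mat_sum J k) (restrict T J)"
  shows "restrict x J' \<in> op_sys (mat_sum J' k) (restrict T J')"
proof -
  obtain a b c where "x = (\<lambda>j\<in>J. a \<cdot>\<^sub>m 1\<^sub>m (k j) + b \<cdot>\<^sub>m restrict T J j + c \<cdot>\<^sub>m mat_adjoint (restrict T J j))"
    using x unfolding op_sys_mat_sum by blast
  then have "restrict x J' = (\<lambda>j\<in>J'. a \<cdot>\<^sub>m 1\<^sub>m (k j) + b \<cdot>\<^sub>m restrict T J' j + c \<cdot>\<^sub>m mat_adjoint (restrict T J' j))"
    using J' by (auto simp: restrict_def fun_eq_iff)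
  then show ?thesis unfolding op_sys_mat_sum by blast
qed

lemma op_sys_restrict_surj:
  assumes J': "J' \<subseteq> J" and z: "z \<in> op_sys (mat_sum J' k) (restrict T J')"
  shows "\<exists>x\<in>op_sys (mat_sum J k) (restrict T J). restrict x J' = z"
proof -
  obtain a b c where "z = (\<lambda>j\<in>J'. a \<cdot>\<^sub>m 1\<^sub>m (k j) + b \<cdot>\<^sub>m restrict T J' j + c \<cdot>\<^sub>m mat_adjoint (restrict T J' j))"
    using z unfolding op_sys_mat_sum by blast
  then have "z = restrict (\<lambda>j\<in>J. a \<cdot>\<^sub>m 1\<^sub>m (k j) + b \<cdot>\<^sub>m restrict T J j + c \<cdot>\<^sub>m mat_adjoint (restrict T J j)) J'"
    using J' by (auto simp: restrict_def fun_eq_iff)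
  then show ?thesis unfolding op_sys_mat_sum by blast
qed

lemma ucp_op_sys_value:
  assumes \<phi>: "ucp (mat_sum J k) S (mat_alg d) \<phi>" and S: "star_subspace J k S" and T: "T \<in> S"
  shows "\<phi> (\<lambda>j\<in>J. a \<cdot>\<^sub>m 1\<^sub>m (k j) + b \<cdot>\<^sub>m T j + c \<cdot>\<^sub>m mat_adjoint (T j)) =
    a \<cdot>\<^sub>m 1\<^sub>m d + b \<cdot>\<^sub>m \<phi> T + c \<cdot>\<^sub>m mat_adjoint (\<phi> T)"
proof -
  note cl = star_subspaceD[OF S] and lin = linear_map_onD[OF ucpD(1)[OF \<phi>]]
  define x where "x = (\<lambda>j\<in>J. a \<cdot>\<^sub>m (\<lambda>j\<in>J. 1\<^sub>m (k j)) j)"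
  define y where "y = (\<lambda>j\<in>J. b \<cdot>\<^sub>m T j)"
  define z where "z = (\<lambda>j\<in>J. c \<cdot>\<^sub>m (\<lambda>j\<in>J. mat_adjoint (T j)) j)"
  have xyz: "x \<in> S" "y \<in> S" "z \<in> S"
    unfolding x_def y_def z_def using cl(2,4,5) T by blast+
  have "(\<lambda>j\<in>J. a \<cdot>\<^sub>m 1\<^sub>m (k j) + b \<cdot>\<^sub>m T j + c \<cdot>\<^sub>m mat_adjoint (T j)) = (\<lambda>j\<in>J. (\<lambda>j\<in>J. x j + y j) j + z j)"
    by (auto simp: x_def y_def z_def restrict_def fun_eq_iff)
  then have "\<phi> (\<lambda>j\<in>J. a \<cdot>\<^sub>m 1\<^sub>m (k j) + b \<cdot>\<^sub>m T j + c \<cdot>\<^sub>m mat_adjoint (T j)) = \<phi> x + \<phi> y + \<phi> z"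
    using lin(2)[OF cl(3)[OF xyz(1,2)] xyz(3)] lin(2)[OF xyz(1,2)] by simp
  moreover have "\<phi> x = a \<cdot>\<^sub>m 1\<^sub>m d" unfolding x_def using lin(3)[OF cl(2)] ucpD(2)[OF \<phi>] by simp
  moreover have "\<phi> y = b \<cdot>\<^sub>m \<phi> T" unfolding y_def using lin(3)[OF T] .
  moreover have "\<phi> z = c \<cdot>\<^sub>m mat_adjoint (\<phi> T)"
    unfolding z_def using lin(3)[OF cl(5)[OF T]] ucp_adjoint[OF \<phi> S T] by simp
  ultimately show ?thesis by simp
qed

text \<open>
  The map that witnesses the failure of uniqueness ignores the \<open>l\<close>-th block, hence kills the unit of that
  block, which the projection does not.
\<close>

lemma matrix_range_imp_not_boundary:
  assumes T: "restrict T J \<in> carrier (mat_sum J k)"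
    and gen: "cstar_gen (mat_sum J k) (restrict T J) = carrier (mat_sum J k)"
    and l: "l \<in> J" and kl: "k l \<ge> 1"
    and range: "T l \<in> matrix_range (k l) (mat_sum (J - {l}) k) (restrict T (J - {l}))"
  shows "\<not> boundary_representation (mat_sum J k) (restrict T J) (k l) (\<lambda>X. X l)"
proof
  assume boundary: "boundary_representation (mat_sum J k) (restrict T J) (k l) (\<lambda>X. X l)"
  let ?J' = "J - {l}" and ?d = "k l"
  have T': "restrict T ?J' \<in> carrier (mat_sum ?J' k)"
    using mat_sum_restrict_closed[OF T, of ?J'] by (simp add: Int_absorb1)
  note S' = star_subspace_op_sys[OF T']
  obtain \<phi> where \<phi>: "ucp (mat_sum ?J' k) (op_sys (mat_sum ?J' k) (restrict T ?J')) (mat_alg ?d) \<phi>"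
    and \<phi>T: "\<phi> (restrict T ?J') = T l"
    using range unfolding matrix_range_def by auto
  obtain \<psi> where \<psi>: "ucp (mat_sum ?J' k) (carrier (mat_sum ?J' k)) (mat_alg ?d) \<psi>"
    and \<psi>\<phi>: "\<And>x. x \<in> op_sys (mat_sum ?J' k) (restrict T ?J') \<Longrightarrow> \<psi> x = \<phi> x"
    using arveson_extension[OF \<phi> S'] kl by auto
  define \<Psi> where "\<Psi> X = \<psi> (restrict X ?J')" for X
  have \<Psi>: "ucp (mat_sum J k) (carrier (mat_sum J k)) (mat_alg ?d) \<Psi>"
    unfolding \<Psi>_def by (rule ucp_restrict[OF \<psi>]) auto
  have T_in: "restrict T J \<in> op_sys (mat_sum J k) (restrict T J)" by (rule gen_in_op_sys[OF T])
  have "restrict (restrict T J) ?J' = restrict T ?J'" by (auto simp: restrict_def)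
  then have \<Psi>T: "\<Psi> (restrict T J) = T l"
    unfolding \<Psi>_def using \<psi>\<phi>[OF gen_in_op_sys[OF T']] \<phi>T by simp
  have "\<Psi> x = x l" if x: "x \<in> op_sys (mat_sum J k) (restrict T J)" for x
  proof -
    obtain a b c where "x = (\<lambda>j\<in>J. a \<cdot>\<^sub>m 1\<^sub>m (k j) + b \<cdot>\<^sub>m restrict T J j + c \<cdot>\<^sub>m mat_adjoint (restrict T J j))"
      using x unfolding op_sys_mat_sum by blast
    then show ?thesis using ucp_op_sys_value[OF \<Psi> star_subspace_carrier T, of a b c] \<Psi>T l by simp
  qed
  then have eq: "\<Psi> x = x l" if "x \<in> carrier (mat_sum J k)" for x
    using boundary \<Psi> that unfolding boundary_representation_def gen by blast
  define e where "e = (\<lambda>j\<in>J. 0\<^sub>m (k j) (k j))(l := 1\<^sub>m ?d :: complex mat)"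
  have e: "e \<in> carrier (mat_sum J k)"
    unfolding e_def by (rule mat_sum_upd_closed[OF mat_sum_zero_closed l]) simp
  have "restrict e ?J' = (\<lambda>j\<in>?J'. 0 \<cdot>\<^sub>m (\<lambda>j\<in>?J'. 1\<^sub>m (k j)) j)"
    by (auto simp: e_def restrict_def fun_eq_iff intro!: eq_matI)
  then have "\<Psi> e = 0 \<cdot>\<^sub>m 1\<^sub>m ?d"
    unfolding \<Psi>_def using linear_map_onD(3)[OF ucpD(1)[OF \<psi>] mat_sum_one_closed] ucpD(2)[OF \<psi>] by simp
  then have "0 \<cdot>\<^sub>m 1\<^sub>m ?d = (1\<^sub>m ?d :: complex mat)" using eq[OF e] by (simp add: e_def)
  then have "(0 \<cdot>\<^sub>m 1\<^sub>m ?d :: complex mat) $$ (0, 0) = 1\<^sub>m ?d $$ (0, 0)" by simp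
  then show False using kl by simp
qed

section \<open>Maps that strictly increase a block\<close>

lemma qform_zero_imp_zero:
  assumes "finite I" "\<And>v. qform I G v = 0" "i \<in> I" "j \<in> I"
  shows "G i j = 0"
proof -
  have "psd I G" unfolding psd_def using assms(2) by simp
  from psd_kernel[OF assms(1) this assms(2) assms(3), of "(\<lambda>_. 0)(j := 1)"]
  show ?thesis using assms(1,4) by (subst (asm) sum.mono_neutral_right[of I "{j}"]) auto
qed

lemma accretive_rotations_imp_zero:
  assumes "finite I" "\<And>c. accretive I (\<lambda>i j. c * G i j)" "i \<in> I" "j \<in> I"
  shows "G i j = 0"
proof (rule qform_zero_imp_zero[OF assms(1) _ assms(3,4)])
  fix v
  have "0 \<le> Re (c * qform I G v)" for c using assms(2)[of c] unfolding accretive_def qform_scale by blast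
  from this[of 1] this[of "- 1"] this[of \<i>] this[of "- \<i>"] show "qform I G v = 0"
    by (simp add: complex_eq_iff)
qed

lemma qform_block_diag:
  "qform (block_index n d) (block (\<lambda>p q. if p = q then Z else 0\<^sub>m d d)) v = (\<Sum>p<n. sform d Z (\<lambda>a. v (p, a)) (\<lambda>a. v (p, a)))"
proof -
  have "sform d (0\<^sub>m d d) u w = 0" for u w by (simp add: sform_def)
  then have "(\<Sum>q<n. sform d (if p = q then Z else 0\<^sub>m d d) (\<lambda>a. v (p, a)) (\<lambda>b. v (q, b)))
      = (\<Sum>q<n. if p = q then sform d Z (\<lambda>a. v (p, a)) (\<lambda>a. v (p, a)) else 0)" for p
    by (intro sum.cong refl) auto
  then show ?thesis unfolding qform_block by simp
qed

text \<open>
  Suppose that \<open>\<psi> X \<ge> X\<^sub>l + 1\<close> for some \<open>X\<close>.  Then \<open>g = (C + 1) - X\<close>, where \<open>C\<close> bounds \<open>X\<close>, satisfies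
  \<open>1 \<le> g\<close>, \<open>g\<^sub>l \<le> 2 C + 2\<close> and \<open>\<psi> g \<le> g\<^sub>l - 1 \<le> r g\<^sub>l\<close> with \<open>r = 1 - 1 / (2 C + 2)\<close>.  Because \<open>\<psi>\<close> reproduces \<open>Y\<^sub>l\<close>,
  each application of \<open>\<psi>\<close> improves a lower bound \<open>Y\<^sub>l \<ge> - s g\<^sub>l\<close> by the factor \<open>r\<close>.
\<close>

lemma strict_gain_imp_accretive:
  assumes \<psi>: "ucp (mat_sum J k) (carrier (mat_sum J k)) (mat_alg (k l)) \<psi>" and l: "l \<in> J"
    and S: "S \<subseteq> carrier (mat_sum J k)" and fix_S: "\<And>x. x \<in> S \<Longrightarrow> \<psi> x = x l"
    and X: "X \<in> carrier (mat_sum J k)"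
    and gain: "accretive {..<k l} (\<lambda>a b. \<psi> X $$ (a, b) - X l $$ (a, b) - 1\<^sub>m (k l) $$ (a, b))"
    and Y: "\<And>p q. p < n \<Longrightarrow> q < n \<Longrightarrow> Y p q \<in> S" and acc: "block_accretive (J - {l}) k n Y"
  shows "accretive (block_index n (k l)) (block (\<lambda>p q. Y p q l))"
proof -
  let ?A = "carrier (mat_sum J k)" and ?d = "k l"
  note lin = linear_map_onD[OF ucpD(1)[OF \<psi>]]
  obtain C where C: "0 \<le> C" "\<And>j. j \<in> J \<Longrightarrow> op_bounded (k j) (X j) C"
    using mat_sum_bounded[OF X] by metis
  \<comment> \<open>A strictly positive element that \<open>\<psi>\<close> strictly decreases on the \<open>l\<close>-th block.\<close>
  define one where "one = (\<lambda>j\<in>J. 1\<^sub>m (k j) :: complex mat)"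
  define g where "g = (\<lambda>j\<in>J. (\<lambda>j\<in>J. of_real (C + 1) \<cdot>\<^sub>m one j) j + (\<lambda>j\<in>J. (- 1) \<cdot>\<^sub>m X j) j)"
  have one_A: "one \<in> ?A" unfolding one_def by (rule mat_sum_one_closed)
  have g_A: "g \<in> ?A" unfolding g_def by (intro mat_sum_add_closed mat_sum_smult_closed one_A X)
  have g_form: "Re (sform (k j) (g j) v v) = (C + 1) * (l2 (k j) v)\<^sup>2 - Re (sform (k j) (X j) v v)"
    if j: "j \<in> J" for j v
    using j mat_sum_carrierD[OF X j]
    by (simp add: g_def one_def sform_add[of _ "k j"] sform_smult[of _ "k j"] sform_one_self)
  have \<psi>g: "\<psi> g = of_real (C + 1) \<cdot>\<^sub>m 1\<^sub>m ?d + (- 1) \<cdot>\<^sub>m \<psi> X"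
    unfolding g_def using lin(2)[OF mat_sum_smult_closed[OF one_A] mat_sum_smult_closed[OF X]]
      lin(3)[OF one_A] lin(3)[OF X] ucpD(2)[OF \<psi>] by (simp add: one_def)
  have X_bound: "\<bar>Re (sform (k j) (X j) v v)\<bar> \<le> C * (l2 (k j) v)\<^sup>2" if "j \<in> J" for j v
    using order_trans[OF abs_Re_le_cmod op_boundedD[OF C(2)[OF that], of v v]]
    by (simp add: power2_eq_square mult.assoc)
  have g_ge: "(l2 (k j) v)\<^sup>2 \<le> Re (sform (k j) (g j) v v)" if "j \<in> J" for j v
    using X_bound[OF that, of v] unfolding g_form[OF that] by (simp add: algebra_simps)
  have g_le: "Re (sform ?d (g l) v v) \<le> (2 * C + 2) * (l2 ?d v)\<^sup>2" for v
  proof -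
    have "(2 * C + 2) * (l2 ?d v)\<^sup>2 = (C + 1) * (l2 ?d v)\<^sup>2 + C * (l2 ?d v)\<^sup>2 + (l2 ?d v)\<^sup>2"
      by (simp add: algebra_simps)
    then show ?thesis
      using X_bound[OF l, of v] zero_le_power2[of "l2 ?d v"] unfolding g_form[OF l] by linarith
  qed
  define r where "r = 1 - 1 / (2 * C + 2)"
  have r: "0 \<le> r" "r < 1" using C(1) by (auto simp: r_def field_simps)
  have \<psi>g_le: "Re (sform ?d (\<psi> g) v v) \<le> r * Re (sform ?d (g l) v v)" for v
  proof -
    have q: "qform {..<?d} (\<lambda>a b. \<psi> X $$ (a, b) - X l $$ (a, b) - 1\<^sub>m ?d $$ (a, b)) v =
       sform ?d (\<psi> X) v v - sform ?d (X l) v v - of_real ((l2 ?d v)\<^sup>2)"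
      unfolding qform_diff sform_qform[symmetric] sform_one_self ..
    have "0 \<le> Re (qform {..<?d} (\<lambda>a b. \<psi> X $$ (a, b) - X l $$ (a, b) - 1\<^sub>m ?d $$ (a, b)) v)"
      using gain unfolding accretive_def by blast
    then have "(l2 ?d v)\<^sup>2 \<le> Re (sform ?d (\<psi> X) v v) - Re (sform ?d (X l) v v)"
      unfolding q minus_complex.sel Re_complex_of_real by simp
    moreover have "Re (sform ?d (\<psi> g) v v) = (C + 1) * (l2 ?d v)\<^sup>2 - Re (sform ?d (\<psi> X) v v)"
      unfolding \<psi>g using lin(1)[OF X]
      by (simp add: sform_add[of _ ?d] sform_smult[of _ ?d] sform_one_self)
    ultimately have "Re (sform ?d (\<psi> g) v v) \<le> Re (sform ?d (g l) v v) - (l2 ?d v)\<^sup>2"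
      unfolding g_form[OF l] by simp
    moreover have "Re (sform ?d (g l) v v) / (2 * C + 2) \<le> (l2 ?d v)\<^sup>2"
      using g_le[of v] C(1) by (simp add: pos_divide_le_eq mult.commute)
    ultimately show ?thesis unfolding r_def by (simp add: algebra_simps)
  qed
  define Q where "Q v = Re (qform (block_index n ?d) (block (\<lambda>p q. Y p q l)) v)" for v
  define N where "N Z v = (\<Sum>p<n. Re (sform ?d Z (\<lambda>a. v (p, a)) (\<lambda>a. v (p, a))))"
    for Z and v :: "nat \<times> nat \<Rightarrow> complex"
  define M where "M = (\<Sum>i\<in>block_index n ?d. \<Sum>i'\<in>block_index n ?d. cmod (block (\<lambda>p q. Y p q l) i i'))"
  have M: "M \<ge> 0" unfolding M_def by (auto intro!: sum_nonneg)
  have diag: "Re (qform (block_index n d) (block (\<lambda>p q. Y' p q + (if p = q then of_real s \<cdot>\<^sub>m Z else 0\<^sub>m d d))) v) =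
      Re (qform (block_index n d) (block Y') v) + s * (\<Sum>p<n. Re (sform d Z (\<lambda>a. v (p, a)) (\<lambda>a. v (p, a))))"
    if "\<And>p q. p < n \<Longrightarrow> q < n \<Longrightarrow> Y' p q \<in> carrier_mat d d" "Z \<in> carrier_mat d d" for Y' Z s d v
  proof -
    have dims: "dim_row (Y' p q) = d" "dim_col (Y' p q) = d" if "p < n" "q < n" for p q
      using \<open>\<And>p q. p < n \<Longrightarrow> q < n \<Longrightarrow> Y' p q \<in> carrier_mat d d\<close>[OF that] by auto
    have "qform (block_index n d) (block (\<lambda>p q. Y' p q + (if p = q then of_real s \<cdot>\<^sub>m Z else 0\<^sub>m d d))) v =
       qform (block_index n d) (\<lambda>i i'. block Y' i i' + block (\<lambda>p q. if p = q then of_real s \<cdot>\<^sub>m Z else 0\<^sub>m d d) i i') v"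
      using dims that(2) by (intro qform_cong) (auto simp: block_def)
    then show ?thesis
      unfolding qform_add qform_block_diag sform_smult[OF that(2)] by (simp add: sum_distrib_left)
  qed
  have Yc: "Y p q \<in> ?A" if "p < n" "q < n" for p q using Y[OF that] S by blast
  have claim: "0 \<le> Q v + M * r ^ m * N (g l) v" for m v
  proof (induction m arbitrary: v)
    case 0
    have "\<bar>Q v\<bar> \<le> M * (\<Sum>p<n. (l2 ?d (\<lambda>a. v (p, a)))\<^sup>2)"
      unfolding Q_def M_def sum_block_sq[symmetric]
      by (rule order_trans[OF abs_Re_le_cmod qform_bound]) simp
    also have "\<dots> \<le> M * N (g l) v"
      unfolding N_def by (intro mult_left_mono sum_mono g_ge l M)
    finally show ?case by simp
  next
    case (Suc m)
    define s where "s = M * r ^ m"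
    have s: "s \<ge> 0" unfolding s_def using M r by simp
    define Z where "Z p q = (\<lambda>j\<in>J. Y p q j + (\<lambda>j\<in>J. (if p = q then of_real s else 0) \<cdot>\<^sub>m g j) j)" for p q :: nat
    have Z: "Z p q \<in> ?A" if "p < n" "q < n" for p q
      unfolding Z_def by (intro mat_sum_add_closed mat_sum_smult_closed g_A Yc that)
    have zero: "0 \<cdot>\<^sub>m W = 0\<^sub>m d d" if "W \<in> carrier_mat d d" for W :: "complex mat" and d
      using that by (auto intro!: eq_matI)
    have "block_accretive J k n Z"
      unfolding block_accretive_def
    proof
      fix j assume j: "j \<in> J"
      have gj: "g j \<in> carrier_mat (k j) (k j)" using mat_sum_carrierD[OF g_A j] .
      have Zj: "Z p q j = Y p q j + (if p = q then of_real s \<cdot>\<^sub>m g j else 0\<^sub>m (k j) (k j))" for p q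
        unfolding Z_def using j zero[OF gj] by simp
      have "0 \<le> Re (qform (block_index n (k j)) (block (\<lambda>p q. Y p q j)) v) +
         s * (\<Sum>p<n. Re (sform (k j) (g j) (\<lambda>a. v (p, a)) (\<lambda>a. v (p, a))))" for v
      proof (cases "j = l")
        case True
        then show ?thesis using Suc.IH[of v] unfolding Q_def N_def s_def by simp
      next
        case False
        then have "0 \<le> Re (qform (block_index n (k j)) (block (\<lambda>p q. Y p q j)) v)"
          using acc j unfolding block_accretive_def accretive_def by blast
        moreover have "0 \<le> Re (sform (k j) (g j) u u)" for u
          using g_ge[OF j, of u] zero_le_power2[of "l2 (k j) u"] by linarith
        ultimately show ?thesis using s by (simp add: sum_nonneg)
      qed
      then show "accretive (block_index n (k j)) (block (\<lambda>p q. Z p q j))"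
        unfolding accretive_def Zj using diag[of "\<lambda>p q. Y p q j" "k j" "g j"] gj mat_sum_carrierD[OF Yc j] by simp
    qed
    from ucp_accretive[OF \<psi> star_subspace_carrier Z this]
    have "accretive (block_index n ?d) (block (\<lambda>p q. \<psi> (Z p q)))" .
    moreover have "\<psi> (Z p q) = Y p q l + (if p = q then of_real s \<cdot>\<^sub>m \<psi> g else 0\<^sub>m ?d ?d)" if "p < n" "q < n" for p q
      unfolding Z_def lin(2)[OF Yc[OF that] mat_sum_smult_closed[OF g_A]] lin(3)[OF g_A] fix_S[OF Y[OF that]]
      using zero[OF lin(1)[OF g_A]] by simp
    ultimately have "accretive (block_index n ?d)
        (block (\<lambda>p q. Y p q l + (if p = q then of_real s \<cdot>\<^sub>m \<psi> g else 0\<^sub>m ?d ?d)))"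
      by (subst accretive_cong[where H = "block (\<lambda>p q. \<psi> (Z p q))"]) (auto simp: block_def)
    then have "0 \<le> Re (qform (block_index n ?d)
        (block (\<lambda>p q. Y p q l + (if p = q then of_real s \<cdot>\<^sub>m \<psi> g else 0\<^sub>m ?d ?d))) v)"
      unfolding accretive_def by blast
    also have "\<dots> = Q v + s * N (\<psi> g) v"
      unfolding Q_def N_def by (rule diag) (use mat_sum_carrierD[OF Yc l] lin(1)[OF g_A] in auto)
    finally have "0 \<le> Q v + s * N (\<psi> g) v" .
    moreover have "Q v + s * N (\<psi> g) v \<le> Q v + s * (r * N (g l) v)"
      using \<psi>g_le unfolding N_def sum_distrib_left by (intro add_left_mono sum_mono mult_left_mono s)
    ultimately have "0 \<le> Q v + s * (r * N (g l) v)" by linarith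
    then show ?case unfolding s_def by (simp add: mult_ac)
  qed
  have "0 \<le> Q v" for v
  proof (rule LIMSEQ_le_const)
    have "(\<lambda>m. Q v + M * r ^ m * N (g l) v) \<longlonglongrightarrow> Q v + M * 0 * N (g l) v"
      using r by (intro tendsto_intros LIMSEQ_realpow_zero)
    then show "(\<lambda>m. Q v + M * r ^ m * N (g l) v) \<longlonglongrightarrow> Q v" by simp
  qed (use claim in blast)
  then show ?thesis unfolding accretive_def Q_def by blast
qed

text \<open>
  By the previous lemma \<open>x' \<mapsto> x\<^sub>l\<close> is completely positive.  It is also well defined: if \<open>x' = 0\<close>, then all
  complex multiples of \<open>x\<^sub>l\<close> are accretive, so \<open>x\<^sub>l = 0\<close>.
\<close>

lemma strict_gain_imp_matrix_range:
  assumes \<psi>: "ucp (mat_sum J k) (carrier (mat_sum J k)) (mat_alg (k l)) \<psi>" and l: "l \<in> J"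
    and T: "restrict T J \<in> carrier (mat_sum J k)"
    and fix_S: "\<And>x. x \<in> op_sys (mat_sum J k) (restrict T J) \<Longrightarrow> \<psi> x = x l"
    and X: "X \<in> carrier (mat_sum J k)"
    and gain: "accretive {..<k l} (\<lambda>a b. \<psi> X $$ (a, b) - X l $$ (a, b) - 1\<^sub>m (k l) $$ (a, b))"
  shows "T l \<in> matrix_range (k l) (mat_sum (J - {l}) k) (restrict T (J - {l}))"
proof -
  let ?J' = "J - {l}" and ?d = "k l"
  let ?S = "op_sys (mat_sum J k) (restrict T J)" and ?S' = "op_sys (mat_sum ?J' k) (restrict T ?J')"
  have T': "restrict T ?J' \<in> carrier (mat_sum ?J' k)"
    using mat_sum_restrict_closed[OF T, of ?J'] by (simp add: Int_absorb1)
  note S = star_subspace_op_sys[OF T] and S' = star_subspace_op_sys[OF T']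
  note cl = star_subspaceD[OF S] and cl' = star_subspaceD[OF S']
  note acc = strict_gain_imp_accretive[OF \<psi> l _ fix_S X gain]
  have SA: "?S \<subseteq> carrier (mat_sum J k)" using cl(1) by blast
  have uniq: "x l = y l" if x: "x \<in> ?S" and y: "y \<in> ?S" and xy: "restrict x ?J' = restrict y ?J'" for x y
  proof -
    have xl: "x l \<in> carrier_mat ?d ?d" "y l \<in> carrier_mat ?d ?d"
      using mat_sum_carrierD[OF cl(1)[OF x] l] mat_sum_carrierD[OF cl(1)[OF y] l] .
    have rot: "accretive (block_index 1 ?d) (\<lambda>i i'. c * (x l $$ (snd i, snd i') - y l $$ (snd i, snd i')))" for c
    proof -
      define D where "D = (\<lambda>j\<in>J. c \<cdot>\<^sub>m (\<lambda>j\<in>J. x j + (\<lambda>j\<in>J. (- 1) \<cdot>\<^sub>m y j) j) j)"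
      have D: "D \<in> ?S" unfolding D_def using x y cl(3,4) by blast
      have "accretive (block_index 1 ?d) (block (\<lambda>p q. D l))"
      proof (rule acc[OF SA, where Y = "\<lambda>_ _. D"])
        show "block_accretive ?J' k 1 (\<lambda>_ _. D)"
          unfolding block_accretive_def
        proof
          fix j assume j: "j \<in> ?J'"
          then have "x j = y j" using fun_cong[OF xy, of j] by simp
          then have "block (\<lambda>_ _. D j) i i' = 0" if "i \<in> block_index 1 (k j)" "i' \<in> block_index 1 (k j)" for i i'
            using that j mat_sum_dim[OF cl(1)[OF y], of j] by (auto simp: block_def D_def)
          then show "accretive (block_index 1 (k j)) (block (\<lambda>p q. D j))"
            by (subst accretive_cong[where H = "\<lambda>_ _. 0"]) (auto simp: accretive_def qform_def)
        qed
      qed (use D in auto)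
      then show ?thesis using xl l
        by (subst accretive_cong[where H = "block (\<lambda>p q. D l)"]) (auto simp: block_def D_def algebra_simps)
    qed
    show ?thesis
    proof (rule eq_matI)
      fix a b assume "a < dim_row (y l)" "b < dim_col (y l)"
      then have "a < ?d" "b < ?d" using xl by auto
      then have "x l $$ (snd (0::nat, a), snd (0::nat, b)) - y l $$ (snd (0::nat, a), snd (0::nat, b)) = 0"
        by (intro accretive_rotations_imp_zero[OF _ rot]) auto
      then show "x l $$ (a, b) = y l $$ (a, b)" by simp
    qed (use xl in auto)
  qed
  define rep where "rep z = (SOME x. x \<in> ?S \<and> restrict x ?J' = z)" for z
  have rep: "rep z \<in> ?S" "restrict (rep z) ?J' = z" if z: "z \<in> ?S'" for z
  proof -
    have "\<exists>x. x \<in> ?S \<and> restrict x ?J' = z" using op_sys_restrict_surj[OF _ z, of J] by blast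
    from someI_ex[OF this] show "rep z \<in> ?S" "restrict (rep z) ?J' = z" unfolding rep_def by auto
  qed
  have rep_j: "rep z j = z j" if "z \<in> ?S'" "j \<in> J" "j \<noteq> l" for z j
    using fun_cong[OF rep(2)[OF that(1)], of j] that(2,3) by simp
  define \<phi> where "\<phi> z = rep z l" for z
  have \<phi>_eq: "\<phi> (restrict x ?J') = x l" if x: "x \<in> ?S" for x
    unfolding \<phi>_def using rep[OF op_sys_restrict[OF _ x]] uniq x by simp
  have repA: "rep z \<in> carrier (mat_sum J k)" if "z \<in> ?S'" for z using cl(1)[OF rep(1)[OF that]] .
  have "ucp (mat_sum ?J' k) ?S' (mat_alg ?d) \<phi>"
  proof (rule ucpI[OF S'])
    have "\<phi> (\<lambda>j\<in>?J'. x j + y j) = \<phi> x + \<phi> y" if xy: "x \<in> ?S'" "y \<in> ?S'" for x y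
    proof -
      have "(\<lambda>j\<in>?J'. x j + y j) = restrict (\<lambda>j\<in>J. rep x j + rep y j) ?J'"
        using rep_j[OF xy(1)] rep_j[OF xy(2)] by (auto simp: fun_eq_iff restrict_def)
      then show ?thesis using \<phi>_eq[OF cl(3)[OF rep(1)[OF xy(1)] rep(1)[OF xy(2)]]] l by (simp add: \<phi>_def)
    qed
    moreover have "\<phi> (\<lambda>j\<in>?J'. c \<cdot>\<^sub>m x j) = c \<cdot>\<^sub>m \<phi> x" if x: "x \<in> ?S'" for c x
    proof -
      have "(\<lambda>j\<in>?J'. c \<cdot>\<^sub>m x j) = restrict (\<lambda>j\<in>J. c \<cdot>\<^sub>m rep x j) ?J'"
        using rep_j[OF x] by (auto simp: fun_eq_iff restrict_def)
      then show ?thesis using \<phi>_eq[OF cl(4)[OF rep(1)[OF x]]] l by (simp add: \<phi>_def)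
    qed
    ultimately show "linear_map_on (mat_sum ?J' k) ?S' (mat_alg ?d) \<phi>"
      unfolding linear_map_on_def using mat_sum_carrierD[OF repA l] by (auto simp: \<phi>_def)
    have "restrict (\<lambda>j\<in>J. 1\<^sub>m (k j) :: complex mat) ?J' = (\<lambda>j\<in>?J'. 1\<^sub>m (k j))"
      by (auto simp: fun_eq_iff restrict_def)
    from \<phi>_eq[OF cl(2), unfolded this] show "\<phi> (\<lambda>j\<in>?J'. 1\<^sub>m (k j)) = 1\<^sub>m ?d" using l by simp
    fix n X assume X: "\<And>p q. p < n \<Longrightarrow> q < n \<Longrightarrow> X p q \<in> ?S'" and accX: "block_accretive ?J' k n X"
    have "accretive (block_index n ?d) (block (\<lambda>p q. rep (X p q) l))"
    proof (rule acc[OF SA])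
      show "block_accretive ?J' k n (\<lambda>p q. rep (X p q))"
        unfolding block_accretive_def
      proof
        fix j assume j: "j \<in> ?J'"
        have "rep (X p q) j = X p q j" if "p < n" "q < n" for p q
          using fun_cong[OF rep(2)[OF X[OF that]], of j] j by simp
        then show "accretive (block_index n (k j)) (block (\<lambda>p q. rep (X p q) j))"
          using accX j unfolding block_accretive_def
          by (subst accretive_cong[where H = "block (\<lambda>p q. X p q j)"]) (auto simp: block_def)
      qed
    qed (use rep X in auto)
    then show "accretive (block_index n ?d) (block (\<lambda>p q. \<phi> (X p q)))" unfolding \<phi>_def .
  qed
  moreover have "\<phi> (restrict T ?J') = T l"
  proof -
    have "restrict T ?J' = restrict (restrict T J) ?J'" by (auto simp: fun_eq_iff restrict_def)
    then show ?thesis using \<phi>_eq[OF gen_in_op_sys[OF T]] l by simp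
  qed
  ultimately show ?thesis unfolding matrix_range_def by (auto intro!: exI[of _ \<phi>])
qed

section \<open>Positive functionals on a matrix algebra\<close>

definition linear_functional :: "nat \<Rightarrow> (complex mat \<Rightarrow> complex) \<Rightarrow> bool" where
  "linear_functional d F \<longleftrightarrow>
     (\<forall>M\<in>carrier_mat d d. \<forall>N\<in>carrier_mat d d. F (M + N) = F M + F N) \<and>
     (\<forall>c. \<forall>M\<in>carrier_mat d d. F (c \<cdot>\<^sub>m M) = c * F M)"

definition pos_functional :: "nat \<Rightarrow> (complex mat \<Rightarrow> complex) \<Rightarrow> bool" where
  "pos_functional d F \<longleftrightarrow> linear_functional d F \<and>
     (\<forall>M\<in>carrier_mat d d. accretive {..<d} (\<lambda>a b. M $$ (a, b)) \<longrightarrow> 0 \<le> Re (F M))"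

lemma linear_functionalD:
  assumes "linear_functional d F"
  shows "M \<in> carrier_mat d d \<Longrightarrow> N \<in> carrier_mat d d \<Longrightarrow> F (M + N) = F M + F N"
    "M \<in> carrier_mat d d \<Longrightarrow> F (c \<cdot>\<^sub>m M) = c * F M"
  using assms unfolding linear_functional_def by auto

lemma pos_functionalD:
  assumes "pos_functional d F"
  shows "linear_functional d F"
    "M \<in> carrier_mat d d \<Longrightarrow> accretive {..<d} (\<lambda>a b. M $$ (a, b)) \<Longrightarrow> 0 \<le> Re (F M)"
  using assms unfolding pos_functional_def by auto

lemma linear_functional_sum:
  assumes F: "linear_functional d F" and "finite I" "\<And>i. i \<in> I \<Longrightarrow> N i \<in> carrier_mat d d"
  shows "F (mat d d (\<lambda>x. \<Sum>i\<in>I. c i * N i $$ x)) = (\<Sum>i\<in>I. c i * F (N i))"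
  using assms(2,3)
proof (induction I rule: finite_induct)
  case empty
  have "mat d d (\<lambda>_. 0 :: complex) = 0 \<cdot>\<^sub>m 1\<^sub>m d" by (auto intro!: eq_matI)
  then show ?case using linear_functionalD(2)[OF F, of "1\<^sub>m d" 0] by simp
next
  case (insert i I)
  have "mat d d (\<lambda>x. \<Sum>i\<in>insert i I. c i * N i $$ x) =
      c i \<cdot>\<^sub>m N i + mat d d (\<lambda>x. \<Sum>i\<in>I. c i * N i $$ x)"
    using insert.hyps carrier_matD[OF insert.prems[of i]] by (auto intro!: eq_matI)
  then show ?case using insert linear_functionalD[OF F] by simp
qed

text \<open>
  This instance lets \<open>linear_functional_sum\<close> compute quadratic forms of linear combinations of matrices.
\<close>

lemma linear_functional_sform: "linear_functional d (\<lambda>M. sform d M u v)"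
  unfolding linear_functional_def by (simp add: sform_add sform_smult)

definition unit_mat :: "nat \<Rightarrow> nat \<Rightarrow> nat \<Rightarrow> complex mat" where
  "unit_mat d a b = mat d d (\<lambda>(x, y). if x = a \<and> y = b then 1 else 0)"

lemma unit_mat_carrier [simp]: "unit_mat d a b \<in> carrier_mat d d"
  by (simp add: unit_mat_def)

lemma linear_functional_entries:
  assumes F: "linear_functional d F" and M: "M \<in> carrier_mat d d"
  shows "F M = (\<Sum>i\<in>block_index d d. M $$ i * F (unit_mat d (fst i) (snd i)))"
proof -
  have "M = mat d d (\<lambda>x. \<Sum>i\<in>block_index d d. M $$ i * unit_mat d (fst i) (snd i) $$ x)"
  proof (rule eq_matI)
    fix a b
    assume "a < dim_row (mat d d (\<lambda>x. \<Sum>i\<in>block_index d d. M $$ i * unit_mat d (fst i) (snd i) $$ x))"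
      "b < dim_col (mat d d (\<lambda>x. \<Sum>i\<in>block_index d d. M $$ i * unit_mat d (fst i) (snd i) $$ x))"
    then have ab: "a < d" "b < d" by auto
    have "(\<Sum>i\<in>block_index d d. M $$ i * unit_mat d (fst i) (snd i) $$ (a, b)) = (\<Sum>i\<in>{(a, b)}. M $$ i)"
      using ab by (intro sum.mono_neutral_cong_right) (auto simp: unit_mat_def)
    then show "M $$ (a, b) = mat d d (\<lambda>x. \<Sum>i\<in>block_index d d. M $$ i * unit_mat d (fst i) (snd i) $$ x) $$ (a, b)"
      using ab by simp
  qed (use M in auto)
  then have "F M = F (mat d d (\<lambda>x. \<Sum>i\<in>block_index d d. M $$ i * unit_mat d (fst i) (snd i) $$ x))" by simp
  also have "\<dots> = (\<Sum>i\<in>block_index d d. M $$ i * F (unit_mat d (fst i) (snd i)))"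
    by (rule linear_functional_sum[OF F]) auto
  finally show ?thesis .
qed

lemma linear_functional_tendsto_zero:
  assumes F: "linear_functional d F" and M: "\<And>n. M n \<in> carrier_mat d d"
    and lim: "\<And>a b. a < d \<Longrightarrow> b < d \<Longrightarrow> (\<lambda>n. M n $$ (a, b)) \<longlonglongrightarrow> 0"
  shows "(\<lambda>n. F (M n)) \<longlonglongrightarrow> 0"
  unfolding linear_functional_entries[OF F M]
  by (intro tendsto_null_sum tendsto_mult_left_zero) (use lim in auto)

lemma pos_functional_skew:
  assumes F: "pos_functional d F" and M: "M \<in> carrier_mat d d"
    and skew: "\<And>v. Re (qform {..<d} (\<lambda>a b. M $$ (a, b)) v) = 0"
  shows "Re (F M) = 0"
proof -
  have "accretive {..<d} (\<lambda>a b. M $$ (a, b))" unfolding accretive_def using skew by simp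
  moreover have "qform {..<d} (\<lambda>a b. ((- 1) \<cdot>\<^sub>m M) $$ (a, b)) v = - 1 * qform {..<d} (\<lambda>a b. M $$ (a, b)) v" for v
    unfolding qform_scale[symmetric] using M by (intro qform_cong) auto
  then have "accretive {..<d} (\<lambda>a b. ((- 1) \<cdot>\<^sub>m M) $$ (a, b))"
    unfolding accretive_def using skew by simp
  ultimately show ?thesis
    using pos_functionalD(2)[OF F M] pos_functionalD(2)[OF F, of "(- 1) \<cdot>\<^sub>m M"] M
      linear_functionalD(2)[OF pos_functionalD(1)[OF F] M, of "- 1"] by simp
qed

lemma pos_functional_adjoint:
  assumes F: "pos_functional d F" and M: "M \<in> carrier_mat d d"
  shows "F (mat_adjoint M) = cnj (F M)"
proof -
  note lin = linear_functionalD[OF pos_functionalD(1)[OF F]]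
  have Re: "Re (F (mat_adjoint M)) = Re (F M)" if M: "M \<in> carrier_mat d d" for M
  proof -
    have "sform d (M + (- 1) \<cdot>\<^sub>m mat_adjoint M) v v = sform d M v v - cnj (sform d M v v)" for v
      using M by (simp add: sform_add[of _ d] sform_smult[of _ d] sform_adjoint[of _ d])
    then have "Re (F (M + (- 1) \<cdot>\<^sub>m mat_adjoint M)) = 0"
      using M by (intro pos_functional_skew[OF F]) (simp_all flip: sform_qform)
    then show ?thesis using lin(1)[OF M, of "(- 1) \<cdot>\<^sub>m mat_adjoint M"] lin(2)[of "mat_adjoint M" "- 1"] M by simp
  qed
  have "Re (F (mat_adjoint (\<i> \<cdot>\<^sub>m M))) = Re (F (\<i> \<cdot>\<^sub>m M))" using M by (intro Re) simp
  then have "Im (F (mat_adjoint M)) = - Im (F M)"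
    unfolding mat_adjoint_smult using lin(2)[OF M, of \<i>] lin(2)[of "mat_adjoint M" "- \<i>"] M by simp
  with Re[OF M] show ?thesis by (simp add: complex_eq_iff)
qed

lemma pos_functional_psd:
  assumes F: "pos_functional d F" and M: "M \<in> carrier_mat d d" and psd: "psd {..<d} (\<lambda>a b. M $$ (a, b))"
  shows "Im (F M) = 0" "0 \<le> Re (F M)"
proof -
  show "0 \<le> Re (F M)" using pos_functionalD(2)[OF F M psd_imp_accretive[OF psd]] .
  have "qform {..<d} (\<lambda>a b. (\<i> \<cdot>\<^sub>m M) $$ (a, b)) v = \<i> * qform {..<d} (\<lambda>a b. M $$ (a, b)) v" for v
    unfolding qform_scale[symmetric] using M by (intro qform_cong) auto
  then have "Re (F (\<i> \<cdot>\<^sub>m M)) = 0"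
    using M psd by (intro pos_functional_skew[OF F]) (auto simp: psd_def)
  then show "Im (F M) = 0" using linear_functionalD(2)[OF pos_functionalD(1)[OF F] M, of \<i>] by simp
qed

text \<open>
  Positive functionals are completely positive because the form of the scalar matrix at \<open>z\<close> is the value
  of \<open>F\<close> at the compression of \<open>N\<close> by \<open>z\<close>, the matrix \<open>M\<close> below.
\<close>

lemma pos_functional_block_psd:
  assumes F: "pos_functional d F" and N: "\<And>p q. p < n \<Longrightarrow> q < n \<Longrightarrow> N p q \<in> carrier_mat d d"
    and psd: "psd (block_index n d) (block N)"
  shows "psd {..<n} (\<lambda>p q. F (N p q))"
  unfolding psd_def
proof
  fix z :: "nat \<Rightarrow> complex"
  let ?I = "{..<n} \<times> {..<n}"
  define c where "c i = cnj (z (fst i)) * z (snd i)" for i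
  define M where "M = mat d d (\<lambda>x. \<Sum>i\<in>?I. c i * N (fst i) (snd i) $$ x)"
  have M: "M \<in> carrier_mat d d" by (simp add: M_def)
  have sum: "G M = (\<Sum>p<n. \<Sum>q<n. cnj (z p) * G (N p q) * z q)" if G: "linear_functional d G" for G
  proof -
    have "G M = (\<Sum>i\<in>?I. c i * G (N (fst i) (snd i)))"
      unfolding M_def by (rule linear_functional_sum[OF G]) (use N in auto)
    then show ?thesis unfolding sum_block_index by (simp add: c_def mult_ac)
  qed
  have "qform {..<d} (\<lambda>a b. M $$ (a, b)) w = qform (block_index n d) (block N) (\<lambda>(p, a). z p * w a)" for w
  proof -
    have "sform d X (\<lambda>a. x * w a) (\<lambda>a. y * w a) = cnj x * sform d X w w * y" for X x y
      unfolding sform_def sum_distrib_left sum_distrib_right by (simp add: mult_ac)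
    then show ?thesis
      unfolding qform_block sform_qform[symmetric] sum[OF linear_functional_sform] by simp
  qed
  then have "psd {..<d} (\<lambda>a b. M $$ (a, b))" using psd unfolding psd_def by simp
  from pos_functional_psd[OF F M this] sum[OF pos_functionalD(1)[OF F]]
  show "Im (qform {..<n} (\<lambda>p q. F (N p q)) z) = 0 \<and> 0 \<le> Re (qform {..<n} (\<lambda>p q. F (N p q)) z)"
    unfolding qform_def by simp
qed

lemma mat_gram_psd:
  assumes c: "\<And>p. p < n \<Longrightarrow> c p \<in> carrier_mat d d"
  shows "psd (block_index n d) (block (\<lambda>p q. mat_adjoint (c p) * c q))"
proof (rule gram_imp_psd[where R = "{..<d}" and Y = "\<lambda>r i. c (fst i) $$ (r, snd i)"])
  fix i i' assume "i \<in> block_index n d" "i' \<in> block_index n d"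
  then show "block (\<lambda>p q. mat_adjoint (c p) * c q) i i' =
      (\<Sum>r<d. cnj (c (fst i) $$ (r, snd i)) * c (fst i') $$ (r, snd i'))"
    unfolding block_def by (intro gram_entry c) auto
qed

text \<open>
  The Cauchy-Schwarz inequality for the form \<open>(x, y) \<mapsto> F (x\<^sup>* y)\<close>.
\<close>

lemma pos_functional_null:
  assumes F: "pos_functional d F" and x: "x \<in> carrier_mat d d" and y: "y \<in> carrier_mat d d"
    and null: "F (x * mat_adjoint x) = 0"
  shows "F (x * y) = 0"
proof -
  define c where "c p = (if p = 0 then mat_adjoint x else y)" for p :: nat
  have c: "c p \<in> carrier_mat d d" for p using x y by (simp add: c_def)
  define B where "B p q = F (mat_adjoint (c p) * c q)" for p q
  have "psd {..<2} B"
    unfolding B_def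
    by (rule pos_functional_block_psd[OF F _ mat_gram_psd]) (use c in \<open>auto intro: mult_carrier_mat[of _ d d]\<close>)
  moreover have "qform {..<2} B ((\<lambda>_. 0)(0 := 1)) = 0"
    by (subst qform_single) (simp_all add: B_def c_def null)
  ultimately have "(\<Sum>j<2. B 1 j * ((\<lambda>_. 0)(0 := 1)) j) = 0"
    by (rule psd_kernel[rotated]) auto
  then have "F (mat_adjoint y * mat_adjoint x) = 0" by (simp add: sum_lessThan_2 B_def c_def)
  then show ?thesis
    using pos_functional_adjoint[OF F, of "x * y"] x y by (simp add: mat_adjoint_mult[of x d d y d] mult_carrier_mat[of _ d d])
qed

lemma sform_adjoint_mult:
  assumes "C \<in> carrier_mat d d" "M \<in> carrier_mat d d"
  shows "sform d (mat_adjoint C * M) u v = sform d M (mapply d C u) v"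
proof -
  have "mat_adjoint C * M = mat_adjoint (mat_adjoint M * C)"
    using assms by (simp add: mat_adjoint_mult[of _ d d _ d])
  then have "sform d (mat_adjoint C * M) u v = cnj (sform d (mat_adjoint M * C) v u)"
    using assms by (simp add: sform_adjoint mult_carrier_mat[of _ d d])
  also have "\<dots> = cnj (sform d (mat_adjoint M) v (mapply d C u))"
    using assms by (simp add: sform_mult)
  also have "\<dots> = sform d M (mapply d C u) v" using assms by (simp add: sform_adjoint)
  finally show ?thesis .
qed

section \<open>Induction over a generated C*-algebra\<close>

text \<open>
  Multiplicativity conditions such as \<open>\<psi> (Y x) = \<psi> Y * x l\<close> are not visibly stable under adjoints.  This does
  not matter: the elements that satisfy \<open>Q\<close> together with their adjoints form a C*-subalgebra.
\<close>

lemma cstar_gen_induct [consumes 3, case_names one gen gen_adj add mult scale limit]: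
  assumes x: "x \<in> carrier (mat_sum J k)" and gen: "cstar_gen (mat_sum J k) T = carrier (mat_sum J k)"
    and T: "T \<in> carrier (mat_sum J k)"
    and one: "Q (\<lambda>j\<in>J. 1\<^sub>m (k j))" and T1: "Q T" and T2: "Q (\<lambda>j\<in>J. mat_adjoint (T j))"
    and add: "\<And>x y. x \<in> carrier (mat_sum J k) \<Longrightarrow> y \<in> carrier (mat_sum J k) \<Longrightarrow> Q x \<Longrightarrow> Q y \<Longrightarrow> Q (\<lambda>j\<in>J. x j + y j)"
    and mult: "\<And>x y. x \<in> carrier (mat_sum J k) \<Longrightarrow> y \<in> carrier (mat_sum J k) \<Longrightarrow> Q x \<Longrightarrow> Q y \<Longrightarrow> Q (\<lambda>j\<in>J. x j * y j)"
    and scale: "\<And>c x. x \<in> carrier (mat_sum J k) \<Longrightarrow> Q x \<Longrightarrow> Q (\<lambda>j\<in>J. c \<cdot>\<^sub>m x j)"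
    and limit: "\<And>X x \<epsilon>. (\<And>n::nat. X n \<in> carrier (mat_sum J k)) \<Longrightarrow> (\<And>n. Q (X n)) \<Longrightarrow> x \<in> carrier (mat_sum J k) \<Longrightarrow>
      (\<And>n j. j \<in> J \<Longrightarrow> op_bounded (k j) (X n j + (- 1) \<cdot>\<^sub>m x j) (\<epsilon> n)) \<Longrightarrow> (\<And>n. \<epsilon> n \<ge> 0) \<Longrightarrow> \<epsilon> \<longlonglongrightarrow> 0 \<Longrightarrow> Q x"
  shows "Q x"
proof -
  let ?A = "mat_sum J k"
  define ad where "ad x = (\<lambda>j\<in>J. mat_adjoint (x j))" for x :: "nat \<Rightarrow> complex mat"
  define B where "B = {x \<in> carrier ?A. Q x \<and> Q (ad x)}"
  have ad_A: "ad x \<in> carrier ?A" if "x \<in> carrier ?A" for x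
    unfolding ad_def by (rule mat_sum_adj_closed[OF that])
  have ad_ad: "ad (ad x) = x" if "x \<in> carrier ?A" for x
    unfolding ad_def using mat_sum_extensional[OF that] by (auto simp: extensional_def fun_eq_iff)
  have ad_add: "ad (\<lambda>j\<in>J. x j + y j) = (\<lambda>j\<in>J. ad x j + ad y j)" if "x \<in> carrier ?A" "y \<in> carrier ?A" for x y
    using mat_sum_carrierD[OF that(1)] mat_sum_carrierD[OF that(2)]
    unfolding ad_def by (auto intro!: restrict_ext mat_adjoint_add)
  have ad_mult: "ad (\<lambda>j\<in>J. x j * y j) = (\<lambda>j\<in>J. ad y j * ad x j)" if "x \<in> carrier ?A" "y \<in> carrier ?A" for x y
    using mat_sum_carrierD[OF that(1)] mat_sum_carrierD[OF that(2)]
    unfolding ad_def by (auto intro!: restrict_ext mat_adjoint_mult)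
  have ad_scale: "ad (\<lambda>j\<in>J. c \<cdot>\<^sub>m x j) = (\<lambda>j\<in>J. cnj c \<cdot>\<^sub>m ad x j)" for c x
    unfolding ad_def by (auto simp: mat_adjoint_smult intro!: restrict_ext)
  have ad_one: "ad (\<lambda>j\<in>J. 1\<^sub>m (k j)) = (\<lambda>j\<in>J. 1\<^sub>m (k j))"
    unfolding ad_def by (auto intro!: restrict_ext)
  have B_add: "(\<lambda>j\<in>J. x j + y j) \<in> B" if "x \<in> B" "y \<in> B" for x y
    using that add mat_sum_add_closed ad_A by (auto simp: B_def ad_add)
  have B_scale: "(\<lambda>j\<in>J. c \<cdot>\<^sub>m x j) \<in> B" if "x \<in> B" for c x
    using that scale mat_sum_smult_closed ad_A by (auto simp: B_def ad_scale)
  have B_one: "(\<lambda>j\<in>J. 1\<^sub>m (k j)) \<in> B" using one mat_sum_one_closed by (auto simp: B_def ad_one)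
  have B_ad: "ad x \<in> B" if "x \<in> B" for x using that ad_A by (auto simp: B_def ad_ad)
  have B_T: "T \<in> B" using T T1 T2 by (simp add: B_def ad_def)
  have B_mult: "(\<lambda>j\<in>J. x j * y j) \<in> B" if "x \<in> B" "y \<in> B" for x y
    using that mult mat_sum_mult_closed ad_A by (auto simp: B_def ad_mult)
  have "cstar_subalgebra ?A B"
    unfolding cstar_subalgebra_def
  proof (intro conjI allI ballI impI)
    fix X x
    assume "(\<forall>n. X n \<in> B) \<and> x \<in> carrier ?A \<and> (\<lambda>n. nrm ?A (X n \<ominus>\<^bsub>?A\<^esub> x)) \<longlonglongrightarrow> 0"
    then have X: "\<And>n. X n \<in> B" and x: "x \<in> carrier ?A" and lim: "(\<lambda>n. nrm ?A (X n \<ominus>\<^bsub>?A\<^esub> x)) \<longlonglongrightarrow> 0" by auto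
    have XA: "X n \<in> carrier ?A" for n using X by (auto simp: B_def)
    define \<epsilon> where "\<epsilon> n = nrm ?A (\<lambda>j\<in>J. X n j + (- 1) \<cdot>\<^sub>m x j)" for n
    have \<epsilon>: "\<epsilon> \<longlonglongrightarrow> 0" using lim unfolding \<epsilon>_def[abs_def] mat_sum_minus[OF XA x] .
    have D: "(\<lambda>j\<in>J. X n j + (- 1) \<cdot>\<^sub>m x j) \<in> carrier ?A" for n
      using mat_sum_add_closed[OF XA mat_sum_smult_closed[OF x]] by (simp cong: restrict_cong)
    have \<epsilon>0: "\<epsilon> n \<ge> 0" for n unfolding \<epsilon>_def by (rule mat_sum_nrm_bound(2)[OF D])
    have bd: "op_bounded (k j) (X n j + (- 1) \<cdot>\<^sub>m x j) (\<epsilon> n)" if "j \<in> J" for n j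
      using mat_sum_nrm_bound(1)[OF D[of n] that] that unfolding \<epsilon>_def by simp
    have "Q x" by (rule limit[OF XA _ x bd \<epsilon>0 \<epsilon>]) (use X in \<open>auto simp: B_def\<close>)
    moreover have "Q (ad x)"
    proof (rule limit[OF _ _ ad_A[OF x] _ \<epsilon>0 \<epsilon>])
      show "ad (X n) \<in> carrier ?A" "Q (ad (X n))" for n using X[of n] ad_A by (auto simp: B_def)
      fix n j assume j: "j \<in> J"
      have c: "X n j \<in> carrier_mat (k j) (k j)" "x j \<in> carrier_mat (k j) (k j)"
        using mat_sum_carrierD[OF XA j] mat_sum_carrierD[OF x j] .
      then have "mat_adjoint (X n j + (- 1) \<cdot>\<^sub>m x j) = ad (X n) j + (- 1) \<cdot>\<^sub>m ad x j"
        using j by (simp add: ad_def mat_adjoint_add[of _ "k j" "k j"] mat_adjoint_smult)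
      then show "op_bounded (k j) (ad (X n) j + (- 1) \<cdot>\<^sub>m ad x j) (\<epsilon> n)"
        using op_bounded_adjoint[OF _ bd[OF j, of n]] c by simp
    qed
    ultimately show "x \<in> B" using x by (simp add: B_def)
  qed (use B_add B_scale B_one B_ad B_mult in \<open>auto simp: ad_def B_def\<close>)
  moreover have "op_sys ?A T \<subseteq> B"
  proof
    fix y assume "y \<in> op_sys ?A T"
    then obtain a b c where y: "y = (\<lambda>j\<in>J. a \<cdot>\<^sub>m 1\<^sub>m (k j) + b \<cdot>\<^sub>m T j + c \<cdot>\<^sub>m mat_adjoint (T j))"
      unfolding op_sys_mat_sum by blast
    have "y = (\<lambda>j\<in>J. (\<lambda>j\<in>J. (\<lambda>j\<in>J. a \<cdot>\<^sub>m (\<lambda>j\<in>J. 1\<^sub>m (k j)) j) j + (\<lambda>j\<in>J. b \<cdot>\<^sub>m T j) j) j + (\<lambda>j\<in>J. c \<cdot>\<^sub>m ad T j) j)"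
      unfolding y ad_def by (auto simp: restrict_def fun_eq_iff)
    also have "\<dots> \<in> B" by (intro B_add B_scale B_one B_T B_ad)
    finally show "y \<in> B" .
  qed
  ultimately have "cstar_gen ?A T \<subseteq> B" unfolding cstar_gen_def by blast
  then show ?thesis using x gen by (auto simp: B_def)
qed

section \<open>Maps with an invariant functional\<close>

locale block_ucp =
  fixes J :: "nat set" and k :: "nat \<Rightarrow> nat" and l :: nat and \<psi> :: "(nat \<Rightarrow> complex mat) \<Rightarrow> complex mat"
  assumes l: "l \<in> J" and \<psi>: "ucp (mat_sum J k) (carrier (mat_sum J k)) (mat_alg (k l)) \<psi>"
begin

abbreviation A where "A \<equiv> carrier (mat_sum J k)"
abbreviation d where "d \<equiv> k l"

lemmas lin = linear_map_onD[OF ucpD(1)[OF \<psi>]]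
lemmas \<psi>_one = ucpD(2)[OF \<psi>]
lemmas \<psi>_adjoint = ucp_adjoint[OF \<psi> star_subspace_carrier]

lemma at_l [simp]: "X \<in> A \<Longrightarrow> X l \<in> carrier_mat d d"
  using mat_sum_carrierD l by blast

definition invariant :: "(complex mat \<Rightarrow> complex) \<Rightarrow> bool" where
  "invariant F \<longleftrightarrow> pos_functional d F \<and> (\<forall>X\<in>A. F (\<psi> X) = F (X l))"

lemma invariantD:
  assumes "invariant F"
  shows "pos_functional d F" "linear_functional d F" "X \<in> A \<Longrightarrow> F (\<psi> X) = F (X l)"
  using assms pos_functionalD(1) unfolding invariant_def by auto

text \<open>
  A functional that is nonnegative on all matrices that dominate some \<open>\<psi> X - X\<^sub>l\<close> is positive, and it
  vanishes on \<open>\<psi> X - X\<^sub>l\<close> since all complex multiples of this difference have the same form.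
\<close>

lemma exists_invariant:
  assumes no_gain: "\<And>X. X \<in> A \<Longrightarrow> \<not> accretive {..<d} (\<lambda>a b. \<psi> X $$ (a, b) - X l $$ (a, b) - 1\<^sub>m d $$ (a, b))"
  shows "\<exists>F. invariant F \<and> F (1\<^sub>m d) \<noteq> 0"
proof -
  \<comment> \<open>The hypothesis says that the cone of all matrices above some \<open>\<psi> X - X l\<close> omits \<open>- e\<close>.\<close>
  define K where "K = {G. \<exists>X\<in>A. accretive {..<d} (\<lambda>a b. G (a, b) - (\<psi> X $$ (a, b) - X l $$ (a, b)))}"
  define e where "e = (\<lambda>(a :: nat, b :: nat). if a = b then 1 else 0 :: complex)"
  have dims: "dim_row (\<psi> X) = d" "dim_col (\<psi> X) = d" "dim_row (X l) = d" "dim_col (X l) = d" if "X \<in> A" for X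
    using lin(1)[OF that] at_l[OF that] by auto
  have K_comb: "(\<lambda>i. of_real r * G i + of_real s * H i) \<in> K" if GH: "G \<in> K" "H \<in> K" and rs: "r \<ge> 0" "s \<ge> 0" for G H r s
  proof -
    obtain X Y where X: "X \<in> A" "accretive {..<d} (\<lambda>a b. G (a, b) - (\<psi> X $$ (a, b) - X l $$ (a, b)))"
      and Y: "Y \<in> A" "accretive {..<d} (\<lambda>a b. H (a, b) - (\<psi> Y $$ (a, b) - Y l $$ (a, b)))"
      using GH unfolding K_def by blast
    define Z where "Z = (\<lambda>j\<in>J. (\<lambda>j\<in>J. of_real r \<cdot>\<^sub>m X j) j + (\<lambda>j\<in>J. of_real s \<cdot>\<^sub>m Y j) j)"
    have Z: "Z \<in> A" unfolding Z_def by (intro mat_sum_add_closed mat_sum_smult_closed X Y)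
    have "\<psi> Z = of_real r \<cdot>\<^sub>m \<psi> X + of_real s \<cdot>\<^sub>m \<psi> Y"
      unfolding Z_def lin(2)[OF mat_sum_smult_closed[OF X(1)] mat_sum_smult_closed[OF Y(1)]] lin(3)[OF X(1)] lin(3)[OF Y(1)] ..
    moreover have "accretive {..<d} (\<lambda>a b. of_real r * (G (a, b) - (\<psi> X $$ (a, b) - X l $$ (a, b)))
       + of_real s * (H (a, b) - (\<psi> Y $$ (a, b) - Y l $$ (a, b))))"
      using X(2) Y(2) rs by (intro accretive_add accretive_scale)
    ultimately have "accretive {..<d} (\<lambda>a b. (of_real r * G (a, b) + of_real s * H (a, b)) - (\<psi> Z $$ (a, b) - Z l $$ (a, b)))"
      using dims[OF X(1)] dims[OF Y(1)] l
      by (subst accretive_cong[where H = "\<lambda>a b. of_real r * (G (a, b) - (\<psi> X $$ (a, b) - X l $$ (a, b)))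
       + of_real s * (H (a, b) - (\<psi> Y $$ (a, b) - Y l $$ (a, b)))"]) (auto simp: Z_def algebra_simps)
    then show ?thesis unfolding K_def using Z by blast
  qed
  have \<psi>0: "\<psi> (\<lambda>j\<in>J. 0\<^sub>m (k j) (k j)) = 0\<^sub>m d d"
  proof -
    have "(\<lambda>j\<in>J. 0 \<cdot>\<^sub>m (\<lambda>j\<in>J. 1\<^sub>m (k j)) j) = (\<lambda>j\<in>J. 0\<^sub>m (k j) (k j) :: complex mat)"
      by (auto intro!: restrict_ext eq_matI)
    moreover have "0 \<cdot>\<^sub>m 1\<^sub>m d = (0\<^sub>m d d :: complex mat)" by (auto intro!: eq_matI)
    ultimately show ?thesis using lin(3)[OF mat_sum_one_closed, of 0] \<psi>_one by simp
  qed
  have acc_K: "G \<in> K" if "accretive {..<d} (\<lambda>a b. G (a, b))" for G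
  proof -
    have "accretive {..<d} (\<lambda>a b. G (a, b) - (\<psi> (\<lambda>j\<in>J. 0\<^sub>m (k j) (k j)) $$ (a, b) - (\<lambda>j\<in>J. 0\<^sub>m (k j) (k j)) l $$ (a, b)))"
      using that l by (subst accretive_cong[where H = "\<lambda>a b. G (a, b)"]) (auto simp: \<psi>0)
    then show ?thesis unfolding K_def using mat_sum_zero_closed by blast
  qed
  have qform_e: "qform {..<d} (\<lambda>a b. e (a, b)) v = of_real (\<Sum>a<d. (cmod (v a))\<^sup>2)" for v
    unfolding qform_def of_real_sum complex_norm_square
    by (intro sum.cong refl) (simp add: e_def if_distrib if_distribR mult.commute cong: if_cong)
  have zero_K: "(\<lambda>_. 0) \<in> K" by (rule acc_K) (simp add: accretive_def qform_def)
  have "\<exists>f. complex_linear_on UNIV f \<and> (\<forall>G\<in>UNIV \<inter> K. 0 \<le> Re (f G)) \<and> Re (f e) = 1"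
  proof (rule order_unit_complex_functional)
    show "(\<lambda>i. G i + H i) \<in> K" if "G \<in> K" "H \<in> K" for G H using K_comb[OF that, of 1 1] by simp
    show "(\<lambda>i. of_real r * G i) \<in> K" if "r > 0" "G \<in> K" for r :: real and G
      using K_comb[OF that(2) zero_K, of r 0] that(1) by simp
    show "\<exists>t::real. (\<lambda>i. of_real t * e i - G i) \<in> K" for G
    proof -
      define t where "t = (\<Sum>a<d. \<Sum>b<d. cmod (G (a, b)))"
      have "0 \<le> Re (qform {..<d} (\<lambda>a b. of_real t * e (a, b) - G (a, b)) v)" for v
      proof -
        have "Re (qform {..<d} (\<lambda>a b. G (a, b)) v) \<le> t * (\<Sum>a<d. (cmod (v a))\<^sup>2)"
          unfolding t_def by (rule order_trans[OF complex_Re_le_cmod qform_bound]) simp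
        then show ?thesis unfolding qform_diff qform_scale qform_e by (simp flip: of_real_mult)
      qed
      then have "(\<lambda>i. of_real t * e i - G i) \<in> K" by (intro acc_K) (simp add: accretive_def)
      then show ?thesis by blast
    qed
    show "(\<lambda>i. - e i) \<notin> K"
    proof
      assume "(\<lambda>i. - e i) \<in> K"
      then obtain X where X: "X \<in> A" "accretive {..<d} (\<lambda>a b. - e (a, b) - (\<psi> X $$ (a, b) - X l $$ (a, b)))"
        unfolding K_def by blast
      define Y where "Y = (\<lambda>j\<in>J. (- 1) \<cdot>\<^sub>m X j)"
      have Y: "Y \<in> A" "\<psi> Y = (- 1) \<cdot>\<^sub>m \<psi> X"
        unfolding Y_def by (rule mat_sum_smult_closed[OF X(1)], rule lin(3)[OF X(1)])
      have "accretive {..<d} (\<lambda>a b. \<psi> Y $$ (a, b) - Y l $$ (a, b) - 1\<^sub>m d $$ (a, b))"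
        using X(2) dims[OF X(1)] l unfolding Y(2)
        by (subst accretive_cong[where H = "\<lambda>a b. - e (a, b) - (\<psi> X $$ (a, b) - X l $$ (a, b))"])
          (auto simp: Y_def e_def)
      then show False using no_gain[OF Y(1)] by blast
    qed
  qed (auto simp: complex_subspace_def zero_K)
  then obtain f where f: "complex_linear_on UNIV f" and f_pos: "\<And>G. G \<in> K \<Longrightarrow> 0 \<le> Re (f G)" and f_e: "Re (f e) = 1"
    by blast
  have f_add: "f (\<lambda>i. G i + H i) = f G + f H" and f_scale: "f (\<lambda>i. c * G i) = c * f G" for G H c
    using f unfolding complex_linear_on_def by blast+
  define emb where "emb M = (\<lambda>(a, b). if a < d \<and> b < d then M $$ (a, b) else 0 :: complex)" for M
  define F where "F M = f (emb M)" for M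
  have lin_F: "linear_functional d F"
    unfolding linear_functional_def
  proof (intro conjI ballI allI)
    fix M N :: "complex mat" assume MN: "M \<in> carrier_mat d d" "N \<in> carrier_mat d d"
    then have "emb (M + N) = (\<lambda>i. emb M i + emb N i)" by (auto simp: emb_def fun_eq_iff)
    then show "F (M + N) = F M + F N" unfolding F_def by (simp add: f_add)
  next
    fix c and M :: "complex mat" assume "M \<in> carrier_mat d d"
    then have "emb (c \<cdot>\<^sub>m M) = (\<lambda>i. c * emb M i)" by (auto simp: emb_def fun_eq_iff)
    then show "F (c \<cdot>\<^sub>m M) = c * F M" unfolding F_def by (simp add: f_scale)
  qed
  have pos_F: "pos_functional d F"
    unfolding pos_functional_def
  proof (intro conjI ballI impI lin_F)
    fix M assume "accretive {..<d} (\<lambda>a b. M $$ (a, b))"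
    then have "accretive {..<d} (\<lambda>a b. emb M (a, b))"
      by (subst accretive_cong[where H = "\<lambda>a b. M $$ (a, b)"]) (auto simp: emb_def)
    then show "0 \<le> Re (F M)" unfolding F_def using f_pos acc_K by blast
  qed
  have "F (\<psi> X) = F (X l)" if X: "X \<in> A" for X
  proof -
    define G where "G = (\<lambda>i. emb (\<psi> X) i + (- 1) * emb (X l) i)"
    have fG: "f G = F (\<psi> X) - F (X l)"
      unfolding G_def F_def using f_add[of "emb (\<psi> X)" "\<lambda>i. (- 1) * emb (X l) i"] f_scale[of "- 1" "emb (X l)"] by simp
    have "0 \<le> Re (c * f G)" for c
    proof -
      have cX: "(\<lambda>j\<in>J. c \<cdot>\<^sub>m X j) \<in> A" "\<psi> (\<lambda>j\<in>J. c \<cdot>\<^sub>m X j) = c \<cdot>\<^sub>m \<psi> X"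
        using mat_sum_smult_closed[OF X] lin(3)[OF X] by auto
      have "accretive {..<d} (\<lambda>a b. c * G (a, b) - (\<psi> (\<lambda>j\<in>J. c \<cdot>\<^sub>m X j) $$ (a, b) - (\<lambda>j\<in>J. c \<cdot>\<^sub>m X j) l $$ (a, b)))"
        using dims[OF X] l unfolding cX(2)
        by (subst accretive_cong[where H = "\<lambda>_ _. 0"]) (auto simp: G_def emb_def algebra_simps accretive_def qform_def)
      then have "(\<lambda>i. c * G i) \<in> K" unfolding K_def using cX(1) by blast
      then show ?thesis using f_pos f_scale by metis
    qed
    from this[of 1] this[of "- 1"] this[of \<i>] this[of "- \<i>"] have "f G = 0" by (simp add: complex_eq_iff)
    then show ?thesis using fG by simp
  qed
  moreover have "F (1\<^sub>m d) \<noteq> 0"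
  proof -
    have "emb (1\<^sub>m d) (a, b) = e (a, b)" if "a < d" "b < d" for a b using that by (simp add: emb_def e_def)
    then have "(\<lambda>i. emb (1\<^sub>m d) i - e i) \<in> K" "(\<lambda>i. e i - emb (1\<^sub>m d) i) \<in> K"
      by (intro acc_K; subst accretive_cong[where H = "\<lambda>_ _. 0"]; auto simp: accretive_def qform_def)+
    then have "0 \<le> Re (f (\<lambda>i. e i - emb (1\<^sub>m d) i))" "0 \<le> Re (f (\<lambda>i. emb (1\<^sub>m d) i - e i))" using f_pos by blast+
    moreover have "f (\<lambda>i. G i - H i) = f G - f H" for G H
      using f_add[of G "\<lambda>i. (- 1) * H i"] f_scale[of "- 1" H] by simp
    ultimately have "Re (F (1\<^sub>m d)) = 1" unfolding F_def using f_e by simp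
    then show ?thesis by auto
  qed
  ultimately show ?thesis using pos_F unfolding invariant_def by blast
qed

lemma conj_gram_psd:
  assumes a: "\<And>p. p < n \<Longrightarrow> a p \<in> A" and c: "\<And>p. p < n \<Longrightarrow> c p \<in> carrier_mat d d"
  shows "psd (block_index n d) (block (\<lambda>p q. mat_adjoint (c p) * (\<psi> (\<lambda>j\<in>J. mat_adjoint (a p j) * a q j) * c q)))"
proof -
  define g where "g p q = (\<lambda>j\<in>J. mat_adjoint (a p j) * a q j)" for p q
  have g: "g p q \<in> A" if "p < n" "q < n" for p q
    using mat_sum_mult_closed[OF mat_sum_adj_closed[OF a[OF that(1)]] a[OF that(2)]]
    by (simp add: g_def cong: restrict_cong)
  have "psd (block_index n d) (block (\<lambda>p q. \<psi> (g p q)))"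
  proof (rule ucp_psd[OF \<psi> order_refl g])
    fix j assume j: "j \<in> J"
    have "psd (block_index n (k j)) (block (\<lambda>p q. mat_adjoint (a p j) * a q j))"
      using mat_sum_carrierD[OF a j] by (rule mat_gram_psd)
    then show "psd (block_index n (k j)) (block (\<lambda>p q. g p q j))" using j by (simp add: g_def)
  qed
  moreover have "qform (block_index n d) (block (\<lambda>p q. mat_adjoint (c p) * (\<psi> (g p q) * c q))) v =
    qform (block_index n d) (block (\<lambda>p q. \<psi> (g p q))) (\<lambda>(p, x). mapply d (c p) (\<lambda>a. v (p, a)) x)" for v
    unfolding qform_block
  proof (intro sum.cong refl)
    fix p q assume "p \<in> {..<n}" "q \<in> {..<n}"
    then have m: "\<psi> (g p q) \<in> carrier_mat d d" "c p \<in> carrier_mat d d" "c q \<in> carrier_mat d d"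
      using lin(1)[OF g] c by auto
    show "sform d (mat_adjoint (c p) * (\<psi> (g p q) * c q)) (\<lambda>a. v (p, a)) (\<lambda>b. v (q, b)) =
      sform d (\<psi> (g p q)) (\<lambda>a. case (p, a) of (p, x) \<Rightarrow> mapply d (c p) (\<lambda>a. v (p, a)) x)
        (\<lambda>b. case (q, b) of (p, x) \<Rightarrow> mapply d (c p) (\<lambda>a. v (p, a)) x)"
      using sform_adjoint_mult[OF m(2) mult_carrier_mat[OF m(1,3)]] sform_mult[OF m(1,3)] by simp
  qed
  ultimately show ?thesis unfolding g_def psd_def by simp
qed

text \<open>
  Equality in the Schwarz inequality.  On formal sums \<open>a \<otimes> c\<close> with \<open>a\<close> in \<open>A\<close> and \<open>c\<close> in \<open>M\<^sub>d\<close> the expression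
  \<open>F (c\<^sup>* \<psi>(a\<^sup>* a') c')\<close> is a positive semidefinite form.  The vector \<open>t \<otimes> 1 - 1 \<otimes> t\<^sub>l\<close> is isotropic,
  because \<open>F (\<psi> (t\<^sup>* t)) = F (t\<^sub>l\<^sup>* t\<^sub>l)\<close> and \<open>\<psi> t = t\<^sub>l\<close>, so it is orthogonal to \<open>Y\<^sup>* \<otimes> b\<^sup>*\<close>.
\<close>

lemma invariant_multiplicative:
  assumes F: "invariant F" and t: "t \<in> A" "\<psi> t = t l" and Y: "Y \<in> A" and b: "b \<in> carrier_mat d d"
  shows "F (b * \<psi> (\<lambda>j\<in>J. Y j * t j)) = F (b * (\<psi> Y * t l))"
proof -
  define ad where "ad x = (\<lambda>j\<in>J. mat_adjoint (x j))" for x :: "nat \<Rightarrow> complex mat"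
  define one where "one = (\<lambda>j\<in>J. 1\<^sub>m (k j) :: complex mat)"
  have one: "one \<in> A" unfolding one_def by (rule mat_sum_one_closed)
  have adA: "ad x \<in> A" if "x \<in> A" for x unfolding ad_def by (rule mat_sum_adj_closed[OF that])
  define a where "a p = (if p = 0 then t else if p = 1 then one else ad Y)" for p :: nat
  define c where "c p = (if p = 0 then 1\<^sub>m d else if p = 1 then t l else mat_adjoint b)" for p :: nat
  define N where "N p q = mat_adjoint (c p) * (\<psi> (\<lambda>j\<in>J. mat_adjoint (a p j) * a q j) * c q)" for p q
  define B where "B p q = F (N p q)" for p q
  have a: "a p \<in> A" for p unfolding a_def using t one adA[OF Y] by simp
  have c: "c p \<in> carrier_mat d d" for p unfolding c_def using t b by simp
  have g: "(\<lambda>j\<in>J. mat_adjoint (a p j) * a q j) \<in> A" for p q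
    using mat_sum_mult_closed[OF mat_sum_adj_closed[OF a] a] by (simp cong: restrict_cong)
  have N: "N p q \<in> carrier_mat d d" for p q
    unfolding N_def by (intro mult_carrier_mat[of _ d d] mat_adjoint_carrier c lin(1)[OF g])
  have psdB: "psd {..<3} B"
    unfolding B_def by (rule pos_functional_block_psd[OF invariantD(1)[OF F] N])
      (unfold N_def, rule conj_gram_psd[OF a c])
  have td: "dim_row (t j) = k j" "dim_col (t j) = k j" if "j \<in> J" for j using mat_sum_dim[OF t(1) that] .
  have Yd: "dim_row (Y j) = k j" "dim_col (Y j) = k j" if "j \<in> J" for j using mat_sum_dim[OF Y that] .
  have tl: "t l \<in> carrier_mat d d" using t(1) by simp
  have m: "mat_adjoint (t l) * t l \<in> carrier_mat d d" using tl by (intro mult_carrier_mat[of _ d d]) auto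
  have \<psi>_c: "\<psi> (\<lambda>j\<in>J. mat_adjoint (t j) * t j) \<in> carrier_mat d d"
    using lin(1)[OF g[of 0 0]] by (simp add: a_def)
  have Yt: "(\<lambda>j\<in>J. Y j * t j) \<in> A" by (rule mat_sum_mult_closed[OF Y t(1)])
  have B00: "B 0 0 = F (mat_adjoint (t l) * t l)"
    using invariantD(3)[OF F g[of 0 0]] \<psi>_c l by (simp add: B_def N_def c_def a_def)
  have "(\<lambda>j\<in>J. mat_adjoint (t j) * one j) = ad t"
    using right_mult_one_mat[OF mat_adjoint_carrier[OF mat_sum_carrierD[OF t(1)]]]
    unfolding ad_def one_def by (intro restrict_ext) simp
  then have B01: "B 0 1 = F (mat_adjoint (t l) * t l)"
    using \<psi>_adjoint[OF t(1)] t left_mult_one_mat[OF m] by (simp add: B_def N_def c_def a_def ad_def)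
  have "(\<lambda>j\<in>J. mat_adjoint (one j) * t j) = t"
  proof (rule extensionalityI[of _ J])
    show "(\<lambda>j\<in>J. mat_adjoint (one j) * t j) j = t j" if "j \<in> J" for j
      using left_mult_one_mat[OF mat_sum_carrierD[OF t(1) that]] that by (simp add: one_def)
  qed (simp_all add: mat_sum_extensional[OF t(1)])
  then have B10: "B 1 0 = F (mat_adjoint (t l) * t l)"
    using t right_mult_one_mat[OF tl] by (simp add: B_def N_def c_def a_def)
  have "(\<lambda>j\<in>J. mat_adjoint (one j) * one j) = one"
    by (auto simp: one_def fun_eq_iff)
  then have B11: "B 1 1 = F (mat_adjoint (t l) * t l)"
    using \<psi>_one left_mult_one_mat[OF tl] by (simp add: B_def N_def c_def a_def one_def)
  have "(\<lambda>j\<in>J. mat_adjoint (ad Y j) * t j) = (\<lambda>j\<in>J. Y j * t j)"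
    by (auto simp: ad_def fun_eq_iff)
  then have B20: "B 2 0 = F (b * \<psi> (\<lambda>j\<in>J. Y j * t j))"
    using right_mult_one_mat[OF lin(1)[OF Yt]] by (simp add: B_def N_def c_def a_def)
  have "(\<lambda>j\<in>J. mat_adjoint (ad Y j) * one j) = Y"
  proof (rule extensionalityI[of _ J])
    show "(\<lambda>j\<in>J. mat_adjoint (ad Y j) * one j) j = Y j" if "j \<in> J" for j
      using right_mult_one_mat[OF mat_sum_carrierD[OF Y that]] that by (simp add: one_def ad_def)
  qed (simp_all add: mat_sum_extensional[OF Y])
  then have B21: "B 2 1 = F (b * (\<psi> Y * t l))"
    by (simp add: B_def N_def c_def a_def)
  have null: "qform {..<3} B ((\<lambda>_. 0)(0 := 1, 1 := - 1)) = 0"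
    by (subst qform_pair) (simp_all add: B00 B01[simplified] B10[simplified] B11[simplified])
  have "(\<Sum>q<3. B 2 q * ((\<lambda>_. 0)(0 := 1, 1 := - 1)) q) = 0"
    by (rule psd_kernel[OF _ psdB null]) simp_all
  then have "B 2 0 - B 2 1 = 0" by (simp add: numeral_3_eq_3)
  then show ?thesis unfolding B20 B21 by simp
qed

lemma adjoint_fixed: "t \<in> A \<Longrightarrow> \<psi> t = t l \<Longrightarrow> \<psi> (\<lambda>j\<in>J. mat_adjoint (t j)) = mat_adjoint (t l)"
  using \<psi>_adjoint by simp

text \<open>
  Apply \<open>invariant_multiplicative\<close> once on the right and, after taking adjoints, once on the left:
  \<open>F (t\<^sub>l\<^sup>* \<psi>(X) t\<^sub>l) = F (t\<^sub>l\<^sup>* \<psi>(X t)) = F (\<psi>(t\<^sup>* X t)) = F (t\<^sub>l\<^sup>* X\<^sub>l t\<^sub>l)\<close>.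
\<close>

lemma invariant_compress:
  assumes F: "invariant F" and t: "t \<in> A" "\<psi> t = t l"
  shows "invariant (\<lambda>M. F (mat_adjoint (t l) * (M * t l)))"
  unfolding invariant_def
proof
  have tl: "t l \<in> carrier_mat d d" using t(1) by simp
  note cl = mult_carrier_mat[of _ d d _ d]
  note lin_F = linear_functionalD[OF invariantD(2)[OF F]]
  show "pos_functional d (\<lambda>M. F (mat_adjoint (t l) * (M * t l)))"
    unfolding pos_functional_def linear_functional_def
  proof (intro conjI ballI allI impI)
    fix M N :: "complex mat" assume MN: "M \<in> carrier_mat d d" "N \<in> carrier_mat d d"
    have "mat_adjoint (t l) * ((M + N) * t l) = mat_adjoint (t l) * (M * t l) + mat_adjoint (t l) * (N * t l)"
      using MN tl by (simp add: add_mult_distrib_mat[of _ d d] mult_add_distrib_mat[of _ d d _ d] cl)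
    then show "F (mat_adjoint (t l) * ((M + N) * t l)) = F (mat_adjoint (t l) * (M * t l)) + F (mat_adjoint (t l) * (N * t l))"
      using lin_F(1) MN tl by (simp add: cl)
  next
    fix c and M :: "complex mat" assume M: "M \<in> carrier_mat d d"
    have "mat_adjoint (t l) * (c \<cdot>\<^sub>m M * t l) = c \<cdot>\<^sub>m (mat_adjoint (t l) * (M * t l))"
      using M tl by (simp add: mult_smult_assoc_mat[of _ d d _ d] mult_smult_distrib[of _ d d _ d] cl)
    then show "F (mat_adjoint (t l) * (c \<cdot>\<^sub>m M * t l)) = c * F (mat_adjoint (t l) * (M * t l))"
      using lin_F(2) M tl by (simp add: cl)
  next
    fix M :: "complex mat" assume M: "M \<in> carrier_mat d d" and acc: "accretive {..<d} (\<lambda>a b. M $$ (a, b))"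
    have "sform d (mat_adjoint (t l) * (M * t l)) v v = sform d M (mapply d (t l) v) (mapply d (t l) v)" for v
      using sform_adjoint_mult[OF tl cl[OF M tl]] sform_mult[OF M tl] by simp
    then have "accretive {..<d} (\<lambda>a b. (mat_adjoint (t l) * (M * t l)) $$ (a, b))"
      using acc unfolding accretive_def sform_qform[symmetric] by simp
    then show "0 \<le> Re (F (mat_adjoint (t l) * (M * t l)))"
      using pos_functionalD(2)[OF invariantD(1)[OF F]] M tl by (simp add: cl)
  qed
  show "\<forall>X\<in>A. F (mat_adjoint (t l) * (\<psi> X * t l)) = F (mat_adjoint (t l) * (X l * t l))"
  proof
    fix X assume X: "X \<in> A"
    define Z where "Z = (\<lambda>j\<in>J. X j * t j)"
    define Zs where "Zs = (\<lambda>j\<in>J. mat_adjoint (Z j))"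
    define W where "W = (\<lambda>j\<in>J. Zs j * t j)"
    have Z: "Z \<in> A" unfolding Z_def by (rule mat_sum_mult_closed[OF X t(1)])
    have Zs: "Zs \<in> A" unfolding Zs_def by (rule mat_sum_adj_closed[OF Z])
    have W: "W \<in> A" unfolding W_def by (rule mat_sum_mult_closed[OF Zs t(1)])
    have \<psi>Z: "\<psi> Z \<in> carrier_mat d d" "\<psi> Zs = mat_adjoint (\<psi> Z)"
      using lin(1)[OF Z] \<psi>_adjoint[OF Z] unfolding Zs_def by auto
    have "F (mat_adjoint (t l) * (\<psi> X * t l)) = F (mat_adjoint (t l) * \<psi> Z)"
      unfolding Z_def using invariant_multiplicative[OF F t X] tl by simp
    also have "\<dots> = cnj (F (mat_adjoint (\<psi> Z) * t l))"
      using pos_functional_adjoint[OF invariantD(1)[OF F], of "mat_adjoint (\<psi> Z) * t l"] tl \<psi>Z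
      by (simp add: mat_adjoint_mult[of _ d d _ d] cl)
    also have "F (mat_adjoint (\<psi> Z) * t l) = F (W l)"
      using invariant_multiplicative[OF F t Zs, of "1\<^sub>m d"] invariantD(3)[OF F W] lin(1)[OF W] \<psi>Z tl
      by (simp add: W_def cl)
    also have "cnj (F (W l)) = F (mat_adjoint (W l))"
      using pos_functional_adjoint[OF invariantD(1)[OF F], of "W l"] W by simp
    also have "mat_adjoint (W l) = mat_adjoint (t l) * (X l * t l)"
      using l X tl by (simp add: W_def Zs_def Z_def mat_adjoint_mult[of _ d d _ d] cl)
    finally show "F (mat_adjoint (t l) * (\<psi> X * t l)) = F (mat_adjoint (t l) * (X l * t l))" .
  qed
qed

definition null_ideal :: "complex mat set" where
  "null_ideal = {x \<in> carrier_mat d d. \<forall>F. invariant F \<longrightarrow> (\<forall>y\<in>carrier_mat d d. F (x * y) = 0)}"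

text \<open>
  The compression of an invariant functional by \<open>t\<^sub>l\<^sup>*\<close> is invariant and so vanishes at \<open>x x\<^sup>*\<close>; this is the
  value of the original functional at \<open>(t\<^sub>l x) (t\<^sub>l x)\<^sup>*\<close>.
\<close>

lemma null_ideal_left:
  assumes t: "t \<in> A" "\<psi> t = t l" and x: "x \<in> null_ideal"
  shows "t l * x \<in> null_ideal"
proof -
  note cl = mult_carrier_mat[of _ d d _ d]
  have xc: "x \<in> carrier_mat d d" using x by (simp add: null_ideal_def)
  have tl: "t l \<in> carrier_mat d d" using t(1) by simp
  define s where "s = (\<lambda>j\<in>J. mat_adjoint (t j))"
  have s: "s \<in> A" "\<psi> s = s l" "s l = mat_adjoint (t l)"
    unfolding s_def using mat_sum_adj_closed[OF t(1)] adjoint_fixed[OF t] l by auto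
  have "F ((t l * x) * y) = 0" if F: "invariant F" and y: "y \<in> carrier_mat d d" for F y
  proof (rule pos_functional_null[OF invariantD(1)[OF F] _ y])
    have "F (t l * ((x * mat_adjoint x) * mat_adjoint (t l))) = 0"
    proof -
      have "x * mat_adjoint x \<in> carrier_mat d d" "mat_adjoint x \<in> carrier_mat d d" using xc by (simp_all add: cl)
      moreover have "invariant (\<lambda>M. F (t l * (M * mat_adjoint (t l))))"
        using invariant_compress[OF F s(1,2)] unfolding s(3) mat_adjoint_adjoint .
      ultimately show ?thesis using x unfolding null_ideal_def by blast
    qed
    moreover have "(t l * x) * mat_adjoint (t l * x) = t l * ((x * mat_adjoint x) * mat_adjoint (t l))"
      using tl xc by (simp add: mat_adjoint_mult[of _ d d _ d] assoc_mult_mat[of _ d d _ d _ d] cl)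
    ultimately show "F ((t l * x) * mat_adjoint (t l * x)) = 0" by simp
  qed (use tl xc in \<open>simp add: cl\<close>)
  then show ?thesis using tl xc by (simp add: null_ideal_def cl)
qed

end

section \<open>Identifying the map with the block projection\<close>

context block_ucp
begin

lemma null_ideal_add:
  assumes "x \<in> null_ideal" "y \<in> null_ideal"
  shows "x + y \<in> null_ideal"
  unfolding null_ideal_def
proof (safe intro!: add_carrier_mat)
  fix F and z :: "complex mat" assume F: "invariant F" and z: "z \<in> carrier_mat d d"
  have xy: "x \<in> carrier_mat d d" "y \<in> carrier_mat d d" "F (x * z) = 0" "F (y * z) = 0"
    using assms F z by (auto simp: null_ideal_def)
  have "(x + y) * z = x * z + y * z" by (rule add_mult_distrib_mat[OF xy(1,2) z])
  then show "F ((x + y) * z) = 0"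
    using linear_functionalD(1)[OF invariantD(2)[OF F] mult_carrier_mat[OF xy(1) z] mult_carrier_mat[OF xy(2) z]] xy by simp
qed (use assms in \<open>simp add: null_ideal_def\<close>)

lemma null_ideal_smult:
  assumes "x \<in> null_ideal"
  shows "c \<cdot>\<^sub>m x \<in> null_ideal"
  unfolding null_ideal_def
proof (safe intro!: smult_carrier_mat)
  fix F and z :: "complex mat" assume F: "invariant F" and z: "z \<in> carrier_mat d d"
  have x: "x \<in> carrier_mat d d" "F (x * z) = 0" using assms F z by (auto simp: null_ideal_def)
  have "(c \<cdot>\<^sub>m x) * z = c \<cdot>\<^sub>m (x * z)" by (rule mult_smult_assoc_mat[OF x(1) z])
  then show "F ((c \<cdot>\<^sub>m x) * z) = 0"
    using linear_functionalD(2)[OF invariantD(2)[OF F] mult_carrier_mat[OF x(1) z], of c] x by simp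
qed (use assms in \<open>simp add: null_ideal_def\<close>)

lemma mat_mult_entry: "X \<in> carrier_mat d d \<Longrightarrow> Y \<in> carrier_mat d d \<Longrightarrow> a < d \<Longrightarrow> b < d \<Longrightarrow>
    (X * Y) $$ (a, b) = (\<Sum>c<d. X $$ (a, c) * Y $$ (c, b))" for X Y :: "complex mat"
  by (auto simp: scalar_prod_def lessThan_atLeast0)

lemma op_bounded_tendsto_entry:
  assumes "\<And>n. op_bounded d (X n) (\<epsilon> n)" "\<epsilon> \<longlonglongrightarrow> 0" "a < d" "b < d"
  shows "(\<lambda>n. X n $$ (a, b)) \<longlonglongrightarrow> 0"
proof (rule tendsto_0_le[OF assms(2), where K = 1])
  have "cmod (X n $$ (a, b)) \<le> norm (\<epsilon> n) * 1" for n
    using op_bounded_entry[OF assms(1)[of n] assms(3,4)] by simp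
  then show "\<forall>\<^sub>F n in sequentially. cmod (X n $$ (a, b)) \<le> norm (\<epsilon> n) * 1" by simp
qed

text \<open>
  The elements of \<open>A\<close> whose \<open>l\<close>-th block maps the null ideal into itself from the left form a norm closed
  algebra that contains \<open>T\<close> and its adjoint, hence everything; and every matrix is the \<open>l\<close>-th block of an
  element of \<open>A\<close>.
\<close>

lemma null_ideal_left_ideal:
  assumes gen: "cstar_gen (mat_sum J k) T = A" and T: "T \<in> A" and \<psi>T: "\<psi> T = T l"
    and x: "x \<in> null_ideal" and M: "M \<in> carrier_mat d d"
  shows "M * x \<in> null_ideal"
proof -
  define X where "X = (\<lambda>j\<in>J. 0\<^sub>m (k j) (k j))(l := M)"
  have X: "X \<in> A" unfolding X_def by (rule mat_sum_upd_closed[where k = k and l = l, OF mat_sum_zero_closed l M])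
  have "\<forall>x\<in>null_ideal. X l * x \<in> null_ideal"
    using X gen T
  proof (induction rule: cstar_gen_induct)
    case one
    have "1\<^sub>m d * x = x" if "x \<in> null_ideal" for x
      using that left_mult_one_mat[of x d d] by (simp add: null_ideal_def)
    then show ?case using l by simp
  next
    case gen
    then show ?case using null_ideal_left[OF T \<psi>T] by blast
  next
    case gen_adj
    show ?case using null_ideal_left[OF mat_sum_adj_closed[OF T]] adjoint_fixed[OF T \<psi>T] l by simp
  next
    case (add x y)
    have "(x l + y l) * z = x l * z + y l * z" if "z \<in> null_ideal" for z
      using add_mult_distrib_mat[OF at_l[OF add(1)] at_l[OF add(2)], of z d] that by (simp add: null_ideal_def)
    then show ?case using add l null_ideal_add by simp
  next
    case (mult x y)
    have "x l * y l * z = x l * (y l * z)" if "z \<in> null_ideal" for z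
      using assoc_mult_mat[OF at_l[OF mult(1)] at_l[OF mult(2)], of z d] that by (simp add: null_ideal_def)
    then show ?case using mult l by simp
  next
    case (scale c x)
    have "c \<cdot>\<^sub>m x l * z = c \<cdot>\<^sub>m (x l * z)" if "z \<in> null_ideal" for z
      using mult_smult_assoc_mat[OF at_l[OF scale(1)], of z d] that by (simp add: null_ideal_def)
    then show ?case using scale l null_ideal_smult by simp
  next
    case (limit X x \<epsilon>)
    show ?case
    proof
      fix z assume z: "z \<in> null_ideal"
      then have zc: "z \<in> carrier_mat d d" by (simp add: null_ideal_def)
      have xl: "x l \<in> carrier_mat d d" and Xl: "X n l \<in> carrier_mat d d" for n using limit.hyps(1,2) by simp_all
      have "F (x l * z * y) = 0" if F: "invariant F" and y: "y \<in> carrier_mat d d" for F y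
      proof -
        note lin_F = linear_functionalD[OF invariantD(2)[OF F]]
        note cl = mult_carrier_mat[of _ d d _ d]
        define D where "D n = X n l + (- 1) \<cdot>\<^sub>m x l" for n
        have D: "D n \<in> carrier_mat d d" for n unfolding D_def using Xl xl by simp
        have "(\<lambda>n. F (D n * (z * y))) \<longlonglongrightarrow> 0"
        proof (rule linear_functional_tendsto_zero[OF invariantD(2)[OF F]])
          show "D n * (z * y) \<in> carrier_mat d d" for n by (intro cl D zc y)
          fix a b assume ab: "a < d" "b < d"
          have "(\<lambda>n. D n $$ (a, c)) \<longlonglongrightarrow> 0" if "c < d" for c
            by (rule op_bounded_tendsto_entry[OF _ limit.hyps(5) ab(1) that]) (use limit.hyps(3)[OF l] in \<open>simp add: D_def\<close>)
          then show "(\<lambda>n. (D n * (z * y)) $$ (a, b)) \<longlonglongrightarrow> 0"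
            unfolding mat_mult_entry[OF D cl[OF zc y] ab] by (intro tendsto_null_sum tendsto_mult_left_zero) auto
        qed
        moreover have "F (D n * (z * y)) = - F (x l * z * y)" for n
        proof -
          have "F (X n l * z * y) = 0" using limit.IH[of n] z F y by (simp add: null_ideal_def)
          moreover have "D n * (z * y) = X n l * z * y + (- 1) \<cdot>\<^sub>m (x l * z * y)"
            unfolding D_def add_mult_distrib_mat[OF Xl smult_carrier_mat[OF xl] cl[OF zc y]]
              mult_smult_assoc_mat[OF xl cl[OF zc y]] assoc_mult_mat[OF Xl zc y] assoc_mult_mat[OF xl zc y] ..
          ultimately show ?thesis
            using lin_F(1)[OF cl[OF cl[OF Xl[of n] zc] y] smult_carrier_mat[OF cl[OF cl[OF xl zc] y]], of "- 1"]
              lin_F(2)[OF cl[OF cl[OF xl zc] y], of "- 1"] by simp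
        qed
        ultimately show ?thesis by (simp add: LIMSEQ_const_iff)
      qed
      then show "x l * z \<in> null_ideal" using mult_carrier_mat[OF xl zc] by (simp add: null_ideal_def)
    qed
  qed
  then show ?thesis using x by (simp add: X_def)
qed

text \<open>
  Simplicity of \<open>M\<^sub>d\<close>: a nonzero entry of \<open>x\<close> can be moved to every diagonal position by multiplying with
  matrix units, and then \<open>F\<close> vanishes at the identity.
\<close>

lemma null_ideal_trivial:
  assumes gen: "cstar_gen (mat_sum J k) T = A" and T: "T \<in> A" and \<psi>T: "\<psi> T = T l"
    and F: "invariant F" "F (1\<^sub>m d) \<noteq> 0" and x: "x \<in> null_ideal"
  shows "x = 0\<^sub>m d d"
proof (rule ccontr)
  assume "x \<noteq> 0\<^sub>m d d"
  moreover have xc: "x \<in> carrier_mat d d" using x by (simp add: null_ideal_def)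
  ultimately obtain a b where ab: "a < d" "b < d" "x $$ (a, b) \<noteq> 0"
    using eq_matI[of "0\<^sub>m d d" x] by auto
  note lin_F = linear_functionalD[OF invariantD(2)[OF F(1)]]
  have "F (unit_mat d i i) = 0" if i: "i < d" for i
  proof -
    have c: "unit_mat d i a * x \<in> carrier_mat d d" by (rule mult_carrier_mat[OF _ xc]) simp
    have 1: "(unit_mat d i a * x) $$ (r, s) = (if r = i then x $$ (a, s) else 0)" if "r < d" "s < d" for r s
      unfolding mat_mult_entry[OF unit_mat_carrier xc that]
      using that ab by (subst sum.mono_neutral_cong_right[of "{..<d}" "{a}" _ "\<lambda>_. if r = i then x $$ (a, s) else 0"])
        (auto simp: unit_mat_def)
    have "(unit_mat d i a * x * unit_mat d b i) $$ (r, s) = (if r = i \<and> s = i then x $$ (a, b) else 0)" if "r < d" "s < d" for r s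
      unfolding mat_mult_entry[OF c unit_mat_carrier that]
      using that ab 1 by (subst sum.mono_neutral_cong_right[of "{..<d}" "{b}" _ "\<lambda>_. if r = i \<and> s = i then x $$ (a, b) else 0"])
        (auto simp: unit_mat_def)
    then have "unit_mat d i a * x * unit_mat d b i = x $$ (a, b) \<cdot>\<^sub>m unit_mat d i i"
      using mult_carrier_mat[OF c unit_mat_carrier[of d b i]] by (intro eq_matI) (auto simp: unit_mat_def)
    moreover have "F (unit_mat d i a * x * unit_mat d b i) = 0"
      using null_ideal_left_ideal[OF gen T \<psi>T x unit_mat_carrier[of d i a]] F(1) by (simp add: null_ideal_def)
    ultimately show ?thesis using lin_F(2)[OF unit_mat_carrier, of "x $$ (a, b)" i i] ab by simp
  qed
  then have "F (1\<^sub>m d) = 0"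
    unfolding linear_functional_entries[OF invariantD(2)[OF F(1)] one_carrier_mat]
    by (intro sum.neutral) auto
  then show False using F(2) by simp
qed

text \<open>
  By \<open>invariant_multiplicative\<close> the adjoint of the difference of both sides lies in the null ideal.
\<close>

lemma multiplicative_at_fixed:
  assumes gen: "cstar_gen (mat_sum J k) T = A" and T: "T \<in> A" and \<psi>T: "\<psi> T = T l"
    and F: "invariant F" "F (1\<^sub>m d) \<noteq> 0" and t: "t \<in> A" "\<psi> t = t l" and Y: "Y \<in> A"
  shows "\<psi> (\<lambda>j\<in>J. Y j * t j) = \<psi> Y * t l"
proof -
  note cl = mult_carrier_mat[of _ d d _ d]
  define P where "P = \<psi> (\<lambda>j\<in>J. Y j * t j)"
  define R where "R = \<psi> Y * t l"
  have P: "P \<in> carrier_mat d d" unfolding P_def by (rule lin(1)[OF mat_sum_mult_closed[OF Y t(1)]])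
  have R: "R \<in> carrier_mat d d" unfolding R_def by (rule cl[OF lin(1)[OF Y] at_l[OF t(1)]])
  define D where "D = P + (- 1) \<cdot>\<^sub>m R"
  have D: "D \<in> carrier_mat d d" unfolding D_def using P R by simp
  have "mat_adjoint D \<in> null_ideal"
    unfolding null_ideal_def
  proof (safe intro!: mat_adjoint_carrier D)
    fix G and y :: "complex mat" assume G: "invariant G" and y: "y \<in> carrier_mat d d"
    note lin_G = linear_functionalD[OF invariantD(2)[OF G]]
    have ya: "mat_adjoint y \<in> carrier_mat d d" using y by simp
    have "mat_adjoint y * D = mat_adjoint y * P + (- 1) \<cdot>\<^sub>m (mat_adjoint y * R)"
      unfolding D_def mult_add_distrib_mat[OF ya P smult_carrier_mat[OF R]] mult_smult_distrib[OF ya R] ..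
    moreover have "G (mat_adjoint y * P) = G (mat_adjoint y * R)"
      unfolding P_def R_def by (rule invariant_multiplicative[OF G t Y ya])
    ultimately have "G (mat_adjoint y * D) = 0"
      using lin_G(1)[OF cl[OF ya P] smult_carrier_mat[OF cl[OF ya R]], of "- 1"] lin_G(2)[OF cl[OF ya R], of "- 1"] by simp
    moreover have "mat_adjoint D * y = mat_adjoint (mat_adjoint y * D)"
      using mat_adjoint_mult[OF ya D] by simp
    ultimately show "G (mat_adjoint D * y) = 0"
      using pos_functional_adjoint[OF invariantD(1)[OF G] cl[OF ya D]] by simp
  qed
  then have "mat_adjoint D = 0\<^sub>m d d" by (rule null_ideal_trivial[OF gen T \<psi>T F])
  then have "mat_adjoint (mat_adjoint D) = mat_adjoint (0\<^sub>m d d)" by simp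
  then have "D = mat_adjoint (0\<^sub>m d d)" by simp
  then have "D $$ (a, b) = 0" if "a < d" "b < d" for a b using that by simp
  then have "P $$ (a, b) = R $$ (a, b)" if "a < d" "b < d" for a b
    using that P R unfolding D_def by fastforce
  then have "P = R" using P R by (intro eq_matI) auto
  then show ?thesis unfolding P_def R_def .
qed

text \<open>
  The \<open>x\<close> with \<open>\<psi>(Y x) = \<psi>(Y) x\<^sub>l\<close> for all \<open>Y\<close> form a norm closed algebra that contains \<open>T\<close> and its adjoint.
\<close>

lemma eq_projection_if_invariant:
  assumes gen: "cstar_gen (mat_sum J k) T = A" and T: "T \<in> A" and \<psi>T: "\<psi> T = T l"
    and F: "invariant F" "F (1\<^sub>m d) \<noteq> 0" and x: "x \<in> A"
  shows "\<psi> x = x l"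
proof -
  note cl = mult_carrier_mat[of _ d d _ d]
  have "\<forall>Y\<in>A. \<psi> (\<lambda>j\<in>J. Y j * x j) = \<psi> Y * x l"
    using x gen T
  proof (induction rule: cstar_gen_induct)
    case one
    have "(\<lambda>j\<in>J. Y j * (\<lambda>j\<in>J. 1\<^sub>m (k j)) j) = Y" if "Y \<in> A" for Y
    proof (rule extensionalityI[of _ J])
      show "(\<lambda>j\<in>J. Y j * (\<lambda>j\<in>J. 1\<^sub>m (k j)) j) j = Y j" if "j \<in> J" for j
        using right_mult_one_mat[OF mat_sum_carrierD[OF \<open>Y \<in> A\<close> that]] that by simp
    qed (simp_all add: mat_sum_extensional[OF that])
    then show ?case using l right_mult_one_mat[OF lin(1)] by simp
  next
    case gen
    then show ?case using multiplicative_at_fixed[OF assms(1) T \<psi>T F T \<psi>T] by blast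
  next
    case gen_adj
    have "\<psi> (\<lambda>j\<in>J. mat_adjoint (T j)) = (\<lambda>j\<in>J. mat_adjoint (T j)) l"
      using adjoint_fixed[OF T \<psi>T] l by simp
    then show ?case using multiplicative_at_fixed[OF assms(1) T \<psi>T F mat_sum_adj_closed[OF T]] by blast
  next
    case (add x y)
    show ?case
    proof
      fix Y assume Y: "Y \<in> A"
      have "(\<lambda>j\<in>J. Y j * (\<lambda>j\<in>J. x j + y j) j) = (\<lambda>j\<in>J. (\<lambda>j\<in>J. Y j * x j) j + (\<lambda>j\<in>J. Y j * y j) j)"
        using mult_add_distrib_mat[OF mat_sum_carrierD[OF Y] mat_sum_carrierD[OF add(1)] mat_sum_carrierD[OF add(2)]]
        by (auto intro!: restrict_ext)
      then show "\<psi> (\<lambda>j\<in>J. Y j * (\<lambda>j\<in>J. x j + y j) j) = \<psi> Y * (\<lambda>j\<in>J. x j + y j) l"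
        using lin(2)[OF mat_sum_mult_closed[OF Y add(1)] mat_sum_mult_closed[OF Y add(2)]] add(3,4) Y l
          mult_add_distrib_mat[OF lin(1)[OF Y] at_l[OF add(1)] at_l[OF add(2)]] by simp
    qed
  next
    case (mult x y)
    show ?case
    proof
      fix Y assume Y: "Y \<in> A"
      have Yx: "(\<lambda>j\<in>J. Y j * x j) \<in> A" by (rule mat_sum_mult_closed[OF Y mult(1)])
      have "(\<lambda>j\<in>J. Y j * (\<lambda>j\<in>J. x j * y j) j) = (\<lambda>j\<in>J. (\<lambda>j\<in>J. Y j * x j) j * y j)"
        using assoc_mult_mat[OF mat_sum_carrierD[OF Y] mat_sum_carrierD[OF mult(1)] mat_sum_carrierD[OF mult(2)]]
        by (auto intro!: restrict_ext)
      then have "\<psi> (\<lambda>j\<in>J. Y j * (\<lambda>j\<in>J. x j * y j) j) = \<psi> Y * x l * y l"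
        using bspec[OF mult(4) Yx] bspec[OF mult(3) Y] by (simp only:)
      then show "\<psi> (\<lambda>j\<in>J. Y j * (\<lambda>j\<in>J. x j * y j) j) = \<psi> Y * (\<lambda>j\<in>J. x j * y j) l"
        using assoc_mult_mat[OF lin(1)[OF Y] at_l[OF mult(1)] at_l[OF mult(2)]] l by simp
    qed
  next
    case (scale c x)
    show ?case
    proof
      fix Y assume Y: "Y \<in> A"
      have "(\<lambda>j\<in>J. Y j * (\<lambda>j\<in>J. c \<cdot>\<^sub>m x j) j) = (\<lambda>j\<in>J. c \<cdot>\<^sub>m (\<lambda>j\<in>J. Y j * x j) j)"
        using mult_smult_distrib[OF mat_sum_carrierD[OF Y] mat_sum_carrierD[OF scale(1)]]
        by (auto intro!: restrict_ext)
      then show "\<psi> (\<lambda>j\<in>J. Y j * (\<lambda>j\<in>J. c \<cdot>\<^sub>m x j) j) = \<psi> Y * (\<lambda>j\<in>J. c \<cdot>\<^sub>m x j) l"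
        using lin(3)[OF mat_sum_mult_closed[OF Y scale(1)]] scale(2) Y l
          mult_smult_distrib[OF lin(1)[OF Y] at_l[OF scale(1)]] by simp
    qed
  next
    case (limit X x \<epsilon>)
    show ?case
    proof
      fix Y assume Y: "Y \<in> A"
      obtain C where C: "0 \<le> C" "\<And>j. j \<in> J \<Longrightarrow> op_bounded (k j) (Y j) C"
        using mat_sum_bounded[OF Y] by metis
      define D where "D n = (\<lambda>j\<in>J. X n j + (\<lambda>j\<in>J. (- 1) \<cdot>\<^sub>m x j) j)" for n
      have DA: "D n \<in> A" for n
        unfolding D_def by (rule mat_sum_add_closed[OF limit.hyps(1) mat_sum_smult_closed[OF limit.hyps(2)]])
      have D_bd: "op_bounded (k j) (D n j) (\<epsilon> n)" if "j \<in> J" for n j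
        using limit.hyps(3)[OF that, of n] that by (simp add: D_def)
      have YD: "(\<lambda>j\<in>J. Y j * D n j) \<in> A" for n by (rule mat_sum_mult_closed[OF Y DA])
      have Yx: "(\<lambda>j\<in>J. Y j * x j) \<in> A" by (rule mat_sum_mult_closed[OF Y limit.hyps(2)])
      have YX: "(\<lambda>j\<in>J. Y j * X n j) \<in> A" for n by (rule mat_sum_mult_closed[OF Y limit.hyps(1)])
      have "(\<lambda>j\<in>J. Y j * D n j) = (\<lambda>j\<in>J. (\<lambda>j\<in>J. Y j * X n j) j + (\<lambda>j\<in>J. (- 1) \<cdot>\<^sub>m (\<lambda>j\<in>J. Y j * x j) j) j)" for n
        using mult_add_distrib_mat[OF mat_sum_carrierD[OF Y] mat_sum_carrierD[OF limit.hyps(1)] smult_carrier_mat[OF mat_sum_carrierD[OF limit.hyps(2)]]]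
          mult_smult_distrib[OF mat_sum_carrierD[OF Y] mat_sum_carrierD[OF limit.hyps(2)]]
        by (auto simp: D_def intro!: restrict_ext)
      then have \<psi>YD: "\<psi> (\<lambda>j\<in>J. Y j * D n j) = \<psi> Y * X n l + (- 1) \<cdot>\<^sub>m \<psi> (\<lambda>j\<in>J. Y j * x j)" for n
        using lin(2)[OF YX[of n] mat_sum_smult_closed[OF Yx, of "- 1"]] lin(3)[OF Yx, of "- 1"] bspec[OF limit.IH[of n] Y]
        by (simp only:)
      have Dl: "D n l = X n l + (- 1) \<cdot>\<^sub>m x l" for n using l by (simp add: D_def)
      have c: "\<psi> Y \<in> carrier_mat d d" "x l \<in> carrier_mat d d" "\<psi> (\<lambda>j\<in>J. Y j * x j) \<in> carrier_mat d d"
        "\<And>n. X n l \<in> carrier_mat d d" "\<And>n. D n l \<in> carrier_mat d d"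
        using lin(1)[OF Y] at_l[OF limit.hyps(2)] lin(1)[OF Yx] at_l[OF limit.hyps(1)] at_l[OF DA] by auto
      show "\<psi> (\<lambda>j\<in>J. Y j * x j) = \<psi> Y * x l"
      proof (rule eq_matI)
        fix a b assume "a < dim_row (\<psi> Y * x l)" "b < dim_col (\<psi> Y * x l)"
        then have ab: "a < d" "b < d" using c by auto
        let ?z = "(\<psi> Y * x l) $$ (a, b) - \<psi> (\<lambda>j\<in>J. Y j * x j) $$ (a, b)"
        have z: "?z = \<psi> (\<lambda>j\<in>J. Y j * D n j) $$ (a, b) - (\<psi> Y * D n l) $$ (a, b)" for n
        proof -
          have "(\<psi> Y * D n l) = \<psi> Y * X n l + (- 1) \<cdot>\<^sub>m (\<psi> Y * x l)"
            unfolding Dl mult_add_distrib_mat[OF c(1) c(4) smult_carrier_mat[OF c(2)]] mult_smult_distrib[OF c(1,2)] ..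
          then show ?thesis unfolding \<psi>YD using ab c cl[OF c(1,2)] cl[OF c(1) c(4)[of n]]
            by (simp del: index_mult_mat(1))
        qed
        have 1: "(\<lambda>n. \<psi> (\<lambda>j\<in>J. Y j * D n j) $$ (a, b)) \<longlonglongrightarrow> 0"
        proof (rule tendsto_0_le[where K = 1])
          have "cmod (\<psi> (\<lambda>j\<in>J. Y j * D n j) $$ (a, b)) \<le> C * \<epsilon> n" for n
          proof (rule ucp_entry_bound[OF \<psi> star_subspace_carrier YD _ ab])
            fix j assume j: "j \<in> J"
            then show "op_bounded (k j) ((\<lambda>j\<in>J. Y j * D n j) j) (C * \<epsilon> n)"
              using op_bounded_mult[OF mat_sum_carrierD[OF Y j] mat_sum_carrierD[OF DA j] C(2)[OF j] D_bd[OF j] C(1) limit.hyps(4)]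
              by simp
          qed
          then have "cmod (\<psi> (\<lambda>j\<in>J. Y j * D n j) $$ (a, b)) \<le> norm (C * \<epsilon> n) * 1" for n
            unfolding real_norm_def mult_1_right by (rule order_trans[OF _ abs_ge_self])
          then show "\<forall>\<^sub>F n in sequentially. cmod (\<psi> (\<lambda>j\<in>J. Y j * D n j) $$ (a, b)) \<le> norm (C * \<epsilon> n) * 1" by simp
          show "(\<lambda>n. C * \<epsilon> n) \<longlonglongrightarrow> 0" using tendsto_mult_right_zero[OF limit.hyps(5)] .
        qed
        have 2: "(\<lambda>n. (\<psi> Y * D n l) $$ (a, b)) \<longlonglongrightarrow> 0"
          unfolding mat_mult_entry[OF c(1) c(5) ab]
          by (intro tendsto_null_sum tendsto_mult_right_zero op_bounded_tendsto_entry[OF D_bd[OF l] limit.hyps(5) _ ab(2)]) auto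
        have "(\<lambda>n. ?z) \<longlonglongrightarrow> 0 - 0"
          using tendsto_diff[OF 1 2] by (simp only: z[symmetric])
        then show "\<psi> (\<lambda>j\<in>J. Y j * x j) $$ (a, b) = (\<psi> Y * x l) $$ (a, b)"
          by (simp add: LIMSEQ_const_iff)
      qed (use c in auto)
    qed
  qed
  then have "\<psi> (\<lambda>j\<in>J. (\<lambda>j\<in>J. 1\<^sub>m (k j)) j * x j) = \<psi> (\<lambda>j\<in>J. 1\<^sub>m (k j)) * x l"
    using mat_sum_one_closed by blast
  moreover have "(\<lambda>j\<in>J. (\<lambda>j\<in>J. 1\<^sub>m (k j)) j * x j) = x"
  proof (rule extensionalityI[of _ J])
    show "(\<lambda>j\<in>J. (\<lambda>j\<in>J. 1\<^sub>m (k j)) j * x j) j = x j" if "j \<in> J" for j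
      using left_mult_one_mat[OF mat_sum_carrierD[OF x that]] that by simp
  qed (simp_all add: mat_sum_extensional[OF x])
  ultimately show ?thesis using \<psi>_one left_mult_one_mat[OF at_l[OF x]] by simp
qed

end

section \<open>Irreducibility and the characterization\<close>

text \<open>
  Every matrix occurs as the \<open>l\<close>-th block of some element, and all matrices together act transitively
  on the nonzero vectors.
\<close>

lemma irreducible_on_block:
  assumes l: "l \<in> J" and kl: "k l \<ge> 1"
  shows "irreducible_on (carrier (mat_sum J k)) (k l) (\<lambda>X. X l)"
  unfolding irreducible_on_def
proof (intro conjI allI impI)
  let ?d = "k l"
  show "?d \<noteq> 0" using kl by simp
  fix W
  assume "VectorSpace.subspace class_ring W (module_vec TYPE(complex) ?d) \<and>
      (\<forall>x\<in>carrier (mat_sum J k). \<forall>w\<in>W. x l *\<^sub>v w \<in> W)"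
  then have sub: "VectorSpace.subspace class_ring W (module_vec TYPE(complex) ?d)"
    and inv: "\<And>x w. x \<in> carrier (mat_sum J k) \<Longrightarrow> w \<in> W \<Longrightarrow> x l *\<^sub>v w \<in> W" by auto
  have submodule: "submodule class_ring W (module_vec TYPE(complex) ?d)"
    using sub unfolding VectorSpace.subspace_def by blast
  have W: "W \<subseteq> carrier_vec ?d" using submodule.subset[OF submodule] by (simp add: module_vec_simps)
  have W0: "0\<^sub>v ?d \<in> W" using submodule.zero_closed[OF submodule] by (simp add: module_vec_simps)
  have invM: "M *\<^sub>v w \<in> W" if M: "M \<in> carrier_mat ?d ?d" and w: "w \<in> W" for M w
    using inv[OF mat_sum_upd_closed[where k = k and l = l, OF mat_sum_zero_closed l M] w] by simp
  show "W = {0\<^sub>v ?d} \<or> W = carrier_vec ?d"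
  proof (cases "W = {0\<^sub>v ?d}")
    case False
    then obtain w where w: "w \<in> W" "w \<noteq> 0\<^sub>v ?d" using W0 by blast
    have wc: "w \<in> carrier_vec ?d" using w W by blast
    then obtain b where b: "b < ?d" "w $ b \<noteq> 0" using w(2) by (metis eq_vecI carrier_vecD index_zero_vec)
    have "u \<in> W" if u: "u \<in> carrier_vec ?d" for u
    proof -
      \<comment> \<open>The rank one matrix that maps \<open>w\<close> to \<open>u\<close> through the nonzero coordinate \<open>b\<close>.\<close>
      define M where "M = mat ?d ?d (\<lambda>(x, y). if y = b then u $ x / w $ b else 0)"
      have M: "M \<in> carrier_mat ?d ?d" by (simp add: M_def)
      have "M *\<^sub>v w = u"
      proof (rule eq_vecI)
        fix i assume "i < dim_vec u"
        then have i: "i < ?d" using u by auto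
        have "(M *\<^sub>v w) $ i = (\<Sum>y<?d. M $$ (i, y) * w $ y)"
          using M wc i by (auto simp: scalar_prod_def lessThan_atLeast0)
        also have "\<dots> = (\<Sum>y\<in>{b}. u $ i)"
          using b i by (intro sum.mono_neutral_cong_right) (auto simp: M_def)
        finally show "(M *\<^sub>v w) $ i = u $ i" by simp
      qed (use u M in auto)
      then show ?thesis using invM[OF M w(1)] by simp
    qed
    then show ?thesis using W by blast
  qed simp
qed

lemma boundary_representation_block_iff:
  assumes kl: "k l \<ge> 1" and T: "restrict T J \<in> carrier (mat_sum J k)"
    and gen: "cstar_gen (mat_sum J k) (restrict T J) = carrier (mat_sum J k)" and l: "l \<in> J"
  shows "boundary_representation (mat_sum J k) (restrict T J) (k l) (\<lambda>X. X l) \<longleftrightarrow>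
    T l \<notin> matrix_range (k l) (mat_sum (J - {l}) k) (restrict T (J - {l}))"
proof
  assume "boundary_representation (mat_sum J k) (restrict T J) (k l) (\<lambda>X. X l)"
  then show "T l \<notin> matrix_range (k l) (mat_sum (J - {l}) k) (restrict T (J - {l}))"
    using matrix_range_imp_not_boundary[OF T gen l kl] by blast
next
  assume nrange: "T l \<notin> matrix_range (k l) (mat_sum (J - {l}) k) (restrict T (J - {l}))"
  have "\<psi> x = x l"
    if \<psi>: "ucp (mat_sum J k) (carrier (mat_sum J k)) (mat_alg (k l)) \<psi>"
      and fix_S: "\<And>x. x \<in> op_sys (mat_sum J k) (restrict T J) \<Longrightarrow> \<psi> x = x l" and x: "x \<in> carrier (mat_sum J k)" for \<psi> x
  proof -
    interpret block_ucp J k l \<psi> by unfold_locales (fact l, fact \<psi>)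
    have "\<exists>F. invariant F \<and> F (1\<^sub>m (k l)) \<noteq> 0"
      using exists_invariant strict_gain_imp_matrix_range[OF \<psi> l T fix_S] nrange by blast
    then show ?thesis using eq_projection_if_invariant[OF gen T fix_S[OF gen_in_op_sys[OF T]] _ _ x] by blast
  qed
  moreover have "star_representation (mat_sum J k) (carrier (mat_sum J k)) (k l) (\<lambda>X. X l)"
    unfolding star_representation_def linear_map_on_def using l by (auto dest: mat_sum_carrierD)
  ultimately show "boundary_representation (mat_sum J k) (restrict T J) (k l) (\<lambda>X. X l)"
    unfolding boundary_representation_def gen
    using irreducible_on_block[where k = k, OF l kl] ucp_projection[OF l] by blast
qed

theorem theorem1p4:
  fixes m :: enat and k :: "nat \<Rightarrow> nat" and T :: "nat \<Rightarrow> complex mat" and l :: nat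
  assumes "\<And>j. j \<in> block_indices m \<Longrightarrow> k j \<ge> 1"
    and "(\<lambda>j\<in>block_indices m. T j) \<in> carrier (mat_sum (block_indices m) k)"
    and "irreducible_family (block_indices m) k T"
    and "l \<in> block_indices m"
  shows "boundary_representation (mat_sum (block_indices m) k) (\<lambda>j\<in>block_indices m. T j)
           (k l) (\<lambda>X. X l)
     \<longleftrightarrow> T l \<notin> matrix_range (k l) (mat_sum (block_indices m - {l}) k)
           (\<lambda>j\<in>block_indices m - {l}. T j)"
  using boundary_representation_block_iff[OF assms(1)[OF assms(4)] assms(2) _ assms(4)] assms(3)
  unfolding irreducible_family_def by blast

end
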